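(* For each positive integer $n$, there exist $w_1,\ldots,w_n\in\mathfrak{H}$ such that \[ f_n(\tau)=\frac{\eta^4(\tau)}{\prod_{i=1}^n(J(\tau)-J(w_i))^2} \] is a weight $2$ modular form with a character of $\mathrm{SL}_2(\mathbb{Z})$ that is non-vanishing on $\mathfrak{H}$, has a double pole and zero residue at each $w_i$, and is holomorphic elsewhere in $\mathfrak{H}$ and at $\infty$.
   Context: $\mathfrak{H}$ is the complex upper half-plane, $q=e^{2\pi i\tau}$. $\eta(\tau)=q^{1/24}\prod_{m\geq1}(1-q^m)$ is the Dedekind eta function, $\Delta=\eta^{24}$, $E_4(\tau)=1+240\sum_{m\geq1}\sigma_3(m)q^m$ with $\sigma_3(m)=\sum_{0<d\mid m}d^3$, and $J=\dfrac{E_4^3}{1728\,\Delta}$ is the elliptic modular invariant. A (meromorphic) weight $2$ modular form with character $\chi:\mathrm{SL}_2(\mathbb{Z})\to\mathbb{C}^\times$ is a meromorphic function $g$ on $\mathfrak{H}$ with $g\left(\frac{a\tau+b}{c\tau+d}\right)=\chi(\gamma)(c\tau+d)^2g(\tau)$ for all $\gamma=\begin{pmatrix}a&b\\c&d\end{pmatrix}\in\mathrm{SL}_2(\mathbb{Z})$. *)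

theory Defs
  imports "HOL-Complex_Analysis.Complex_Analysis"
begin

definition upper_half_plane :: "complex set" where
  "upper_half_plane = {z. Im z > 0}"

definition qpar :: "complex \<Rightarrow> complex" where
  "qpar \<tau> = exp (2 * pi * \<i> * \<tau>)"

definition dedekind_eta :: "complex \<Rightarrow> complex" where
  "dedekind_eta \<tau> = exp (2 * pi * \<i> * \<tau> / 24) * (\<Prod>m. (1 - qpar \<tau> ^ Suc m))"

definition sigma3 :: "nat \<Rightarrow> nat" where
  "sigma3 m = (\<Sum>d\<in>{d. d dvd m}. d ^ 3)"

definition eisenstein_E4 :: "complex \<Rightarrow> complex" where
  "eisenstein_E4 \<tau> = 1 + 240 * (\<Sum>m. of_nat (sigma3 (Suc m)) * qpar \<tau> ^ Suc m)"

definition modular_Delta :: "complex \<Rightarrow> complex" where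
  "modular_Delta \<tau> = dedekind_eta \<tau> ^ 24"

definition modular_J :: "complex \<Rightarrow> complex" where
  "modular_J \<tau> = eisenstein_E4 \<tau> ^ 3 / (1728 * modular_Delta \<tau>)"

definition SL2Z :: "(int \<times> int \<times> int \<times> int) set" where
  "SL2Z = {(a, b, c, d). a * d - b * c = 1}"

fun sl2_mult :: "int \<times> int \<times> int \<times> int \<Rightarrow> int \<times> int \<times> int \<times> int \<Rightarrow> int \<times> int \<times> int \<times> int" where
  "sl2_mult (a, b, c, d) (a', b', c', d') =
     (a * a' + b * c', a * b' + b * d', c * a' + d * c', c * b' + d * d')"

definition is_character :: "(int \<times> int \<times> int \<times> int \<Rightarrow> complex) \<Rightarrow> bool" where
  "is_character chi \<longleftrightarrow> (\<forall>g\<in>SL2Z. chi g \<noteq> 0) \<and>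
     (\<forall>g\<in>SL2Z. \<forall>h\<in>SL2Z. chi (sl2_mult g h) = chi g * chi h)"

definition weight2_with_character ::
  "(int \<times> int \<times> int \<times> int \<Rightarrow> complex) \<Rightarrow> (complex \<Rightarrow> complex) \<Rightarrow> bool" where
  "weight2_with_character chi g \<longleftrightarrow>
     (\<forall>(a, b, c, d)\<in>SL2Z. \<forall>\<tau>\<in>upper_half_plane.
        g ((of_int a * \<tau> + of_int b) / (of_int c * \<tau> + of_int d)) =
        chi (a, b, c, d) * (of_int c * \<tau> + of_int d) ^ 2 * g \<tau>)"

end

theory Submission
  imports Defs "HOL-Computational_Algebra.Fundamental_Theorem_Algebra"
begin

text \<open>
  With \<open>x = J(\<tau>)\<close>, the differential \<open>\<eta>^4 d\<tau>\<close> is a constant multiple of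
  \<open>x^(-2/3) (x - 1)^(-1/2) dx\<close>.  Hence, for distinct values \<open>x_i = J(w_i)\<close> other than 0 and 1,
  the residues of \<open>\<eta>^4 / \<Prod> (J - x_i)^2\<close> vanish if and only if
  \<open>2/(3 x_i) + 1/(2 (x_i - 1)) + \<Sum>_{j \<noteq> i} 2/(x_i - x_j) = 0\<close> for all \<open>i\<close>.  These are the
  Stieltjes equations for the zeros of the polynomial solution of degree \<open>n\<close> of
  \<open>x (x - 1) P'' + (7x/6 - 2/3) P' = n (n + 1/6) P\<close>; the zeros are simple and avoid 0 and 1
  because of the differential equation, and \<open>J\<close> attains them since it is surjective.

  The modular transformation laws come from the function
  \<open>\<pi> cot \<pi>z + 2\<pi>i \<Sum>_{n \<ge> 1} (q^n/X / (1 - q^n/X) - q^n X / (1 - q^n X))\<close>, \<open>X = exp (2\<pi>iz)\<close>,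
  which is quasi-periodic with simple poles on the lattice.  Comparing it for \<open>\<tau>\<close> and \<open>-1/\<tau>\<close> with
  Liouville's theorem, the Taylor coefficients of order 1 and 3 at 0 give the inversion formulas of
  \<open>E_2\<close> (hence, by integrating the logarithmic derivative, of \<open>\<eta>^4\<close>) and of \<open>E_4\<close>.
\<close>

section \<open>Lambert series\<close>


text \<open>The exponents 2/3 and 1/2 are 1 - 1/3 and 1 - 1/2: \<open>J\<close> is ramified of order
  3 over 0 and of order 2 over 1. In the coordinate \<open>x\<close>, the residue at
  \<open>x_i\<close> vanishes when the logarithmic derivative of the remaining factor is 0 there,
  which is the stated equation. At a simple zero \<open>x_i\<close> of \<open>P\<close> one has
  \<open>P''/P' = \<Sum> 2/(x_i - x_j)\<close>, so the system says that
  \<open>x (x - 1) P'' + (7x/6 - 2/3) P'\<close> vanishes at all zeros of \<open>P\<close>. Its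
  degree is at most \<open>n\<close>, so it is a multiple of \<open>P\<close>, and the leading
  coefficient n (n - 1) + 7n/6 gives the factor n (n + 1/6). The valence formula is replaced by a
  maximum modulus argument: an invariant holomorphic function that tends to 0 at the cusp is 0. It
  yields both the relation between \<open>E_4\<close>, \<open>E_6\<close>, \<open>\<Delta>\<close>
  and the surjectivity of \<open>J\<close>. The character is never computed: the two generators
  force some factor for every matrix, and a point where \<open>f\<close> does not vanish makes these
  factors multiplicative.\<close>

definition divisor_sum :: "nat \<Rightarrow> nat \<Rightarrow> nat" where
  "divisor_sum k m = (\<Sum>d | d dvd m. d ^ k)"

text \<open>Every number divides 0, and a sum over an infinite set is 0 by convention. Hence series
  in \<open>divisor_sum k m\<close> may start at \<open>m = 0\<close>.\<close>

lemma divisor_sum_0_right [simp]: "divisor_sum k 0 = 0"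
  by (simp add: divisor_sum_def)

text \<open>The term for \<open>m = 0\<close> vanishes because of \<open>1 / 0 = 0\<close>.\<close>

definition lambert :: "nat \<Rightarrow> complex \<Rightarrow> complex \<Rightarrow> complex" where
  "lambert k q x = (\<Sum>m. of_nat m ^ k / (1 - q ^ m) * x ^ m)"

text \<open>The Euler operator x d/dx multiplies the m-th coefficient by m. Stating it through
  \<open>x * D\<close> instead of a formula for \<open>D\<close> keeps the power of \<open>x\<close>
  unchanged and covers \<open>x = 0\<close>.\<close>

lemma euler_power_series:
  fixes c :: "nat \<Rightarrow> complex"
  assumes "\<And>x. norm x < 1 \<Longrightarrow> summable (\<lambda>m. c m * x ^ m)" and "norm x < 1"
  shows "summable (\<lambda>m. of_nat m * c m * x ^ m)"
    and "\<exists>D. ((\<lambda>x. \<Sum>m. c m * x ^ m) has_field_derivative D) (at x)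
             \<and> x * D = (\<Sum>m. of_nat m * c m * x ^ m)"
proof -
  obtain r where r: "norm x < r" "r < 1" using assms(2) dense by blast
  have "0 < r" using r(1) norm_ge_zero[of x] by linarith
  have sm: "summable (\<lambda>m. diffs c m * x ^ m)"
    by (rule termdiff_converges[of x 1]) (use assms in auto)
  have "summable (\<lambda>m. x * (diffs c m * x ^ m))" by (rule summable_mult[OF sm])
  hence "summable (\<lambda>m. of_nat (Suc m) * c (Suc m) * x ^ Suc m)"
    by (simp add: diffs_def algebra_simps)
  thus s2: "summable (\<lambda>m. of_nat m * c m * x ^ m)" by (subst (asm) summable_Suc_iff)
  have "((\<lambda>x. \<Sum>m. c m * x ^ m) has_field_derivative (\<Sum>m. diffs c m * x ^ m)) (at x)"
    by (rule termdiffs_strong[of c "of_real r"]) (use r \<open>0 < r\<close> assms in auto)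
  moreover have "x * (\<Sum>m. diffs c m * x ^ m) = (\<Sum>m. x * (diffs c m * x ^ m))"
    using sm by (rule suminf_mult[symmetric])
  moreover have "\<dots> = (\<Sum>m. of_nat (Suc m) * c (Suc m) * x ^ Suc m)"
    by (simp add: diffs_def algebra_simps)
  moreover have "\<dots> = (\<Sum>m. of_nat m * c m * x ^ m)"
    using suminf_split_head[OF s2] by simp
  ultimately show "\<exists>D. ((\<lambda>x. \<Sum>m. c m * x ^ m) has_field_derivative D) (at x)
             \<and> x * D = (\<Sum>m. of_nat m * c m * x ^ m)" by metis
qed

lemma summable_power_times:
  fixes c :: "nat \<Rightarrow> complex"
  assumes "\<And>x. norm x < 1 \<Longrightarrow> summable (\<lambda>m. c m * x ^ m)" and "norm x < 1"
  shows "summable (\<lambda>m. of_nat m ^ k * c m * x ^ m)"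
  using assms(2)
proof (induction k arbitrary: x)
  case 0
  thus ?case using assms(1) by simp
next
  case (Suc k)
  show ?case using euler_power_series(1)[of "\<lambda>m. of_nat m ^ k * c m", OF Suc.IH Suc.prems]
    by (simp add: mult_ac)
qed

lemma norm_one_minus_power_ge:
  fixes q :: complex
  assumes "norm q < 1" "m > 0"
  shows "norm (1 - q ^ m) \<ge> 1 - norm q"
proof -
  have "norm (q ^ m) \<le> norm q ^ 1"
    unfolding norm_power by (rule power_decreasing) (use assms in auto)
  thus ?thesis using norm_triangle_ineq2[of 1 "q ^ m"] by simp
qed

lemma summable_lambert_0:
  fixes q x :: complex
  assumes "norm q < 1" "norm x < 1"
  shows "summable (\<lambda>m. 1 / (1 - q ^ m) * x ^ m)"
proof (rule summable_comparison_test')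
  show "summable (\<lambda>m. 1 / (1 - norm q) * norm x ^ m)"
    by (intro summable_mult summable_geometric) (use assms in auto)
  show "norm (1 / (1 - q ^ m) * x ^ m) \<le> 1 / (1 - norm q) * norm x ^ m" for m
  proof (cases "m = 0")
    case False
    thus ?thesis using norm_one_minus_power_ge[of q m] assms
      by (auto simp: norm_divide norm_mult norm_power intro!: mult_right_mono frac_le)
  qed (use assms in auto)
qed

lemma summable_lambert:
  fixes q x :: complex
  assumes "norm q < 1" "norm x < 1"
  shows "summable (\<lambda>m. of_nat m ^ k / (1 - q ^ m) * x ^ m)"
  using summable_power_times[of "\<lambda>m. 1 / (1 - q ^ m)" x k] summable_lambert_0[OF assms(1)] assms
  by simp

lemma lambert_has_derivative:
  assumes "norm q < 1" "norm x < 1"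
  obtains D where "(lambert k q has_field_derivative D) (at x)" "x * D = lambert (Suc k) q x"
proof -
  have "\<exists>D. ((\<lambda>x. \<Sum>m. of_nat m ^ k / (1 - q ^ m) * x ^ m) has_field_derivative D) (at x)
     \<and> x * D = (\<Sum>m. of_nat m * (of_nat m ^ k / (1 - q ^ m)) * x ^ m)"
    by (rule euler_power_series(2)) (use summable_lambert assms in auto)
  thus ?thesis using that unfolding lambert_def by auto
qed

text \<open>Both sides are iterated sums of the double series of \<open>(q ^ n * x) ^ m\<close> with
  \<open>n \<ge> 0\<close> and \<open>m \<ge> 1\<close>: summing over \<open>m\<close> first gives
  the left terms, summing over \<open>n\<close> first gives the Lambert terms. Absolute convergence
  justifies the exchange.\<close>

lemma lambert_0_eq:
  assumes q: "norm q < 1" and x: "norm x < 1"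
  shows "(\<lambda>n. q ^ n * x / (1 - q ^ n * x)) sums lambert 0 q x"
proof -
  have nq: "norm (q ^ n * x) \<le> norm x" for n
    using q by (simp add: norm_mult norm_power mult_left_le_one_le power_le_one)
  have lt: "norm (q ^ n * x) < 1" for n using nq[of n] x by linarith
  have g1: "((\<lambda>m. norm ((q ^ n * x) ^ Suc m)) has_sum (norm (q^n * x) / (1 - norm (q^n*x)))) UNIV" for n
  proof (rule sums_nonneg_imp_has_sum)
    show "(\<lambda>m. norm ((q ^ n * x) ^ Suc m)) sums (norm (q ^ n * x) / (1 - norm (q ^ n * x)))"
      using sums_mult[OF geometric_sums[of "norm (q^n*x)"], of "norm (q^n*x)"] lt[of n]
      by (simp add: norm_power norm_mult)
  qed auto
  have "(\<lambda>p. norm (case p of (n,m) \<Rightarrow> (q ^ n * x) ^ Suc m)) summable_on UNIV \<times> UNIV"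
  proof (subst Infinite_Sum.abs_summable_on_Sigma_iff, intro conjI ballI)
    fix n
    show "(\<lambda>m. norm (case (n, m) of (n, m) \<Rightarrow> (q ^ n * x) ^ Suc m)) summable_on UNIV"
      using g1[of n] has_sum_imp_summable by fastforce
  next
    have eq: "(\<Sum>\<^sub>\<infinity>m\<in>UNIV. norm (case (n, m) of (n, m) \<Rightarrow> (q ^ n * x) ^ Suc m)) = norm (q^n * x) / (1 - norm (q^n*x))" for n
      using infsumI[OF g1[of n]] by simp
    have "summable (\<lambda>n. norm (q^n * x) / (1 - norm (q^n*x)))"
    proof (rule summable_comparison_test')
      show "summable (\<lambda>n. (1 / (1 - norm x)) * norm q ^ n)"
        by (intro summable_mult summable_geometric) (use q in auto)
      fix n
      have "norm (q^n*x) / (1 - norm (q^n*x)) \<le> norm (q^n) * 1 / (1 - norm x)"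
        unfolding norm_mult by (intro frac_le mult_left_mono) (use x nq[of n] in \<open>auto simp: norm_mult\<close>)
      thus "norm (norm (q^n * x) / (1 - norm (q^n*x))) \<le> (1 / (1 - norm x)) * norm q ^ n"
        using lt[of n] by (simp add: norm_power)
    qed
    hence "(\<lambda>n. norm (q^n * x) / (1 - norm (q^n*x))) summable_on UNIV"
      by (rule summable_nonneg_imp_summable_on) (use lt in \<open>auto intro!: divide_nonneg_nonneg simp: less_imp_le\<close>)
    thus "(\<lambda>n. norm (\<Sum>\<^sub>\<infinity>m\<in>UNIV. norm (case (n, m) of (n, m) \<Rightarrow> (q ^ n * x) ^ Suc m))) summable_on UNIV"
      unfolding eq using lt by (auto simp: less_imp_le abs_of_nonneg)
  qed
  hence sm: "(\<lambda>(n,m). (q ^ n * x) ^ Suc m) summable_on UNIV \<times> UNIV"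
    by (rule abs_summable_summable)
  have s1: "((\<lambda>m. (q ^ n * x) ^ Suc m) has_sum (q ^ n * x / (1 - q ^ n * x))) UNIV" for n
  proof (rule norm_summable_imp_has_sum)
    show "summable (\<lambda>m. norm ((q ^ n * x) ^ Suc m))"
      using g1[of n] has_sum_imp_sums sums_summable by blast
    show "(\<lambda>m. (q ^ n * x) ^ Suc m) sums (q ^ n * x / (1 - q ^ n * x))"
      using sums_mult[OF geometric_sums[of "q^n*x"], of "q^n*x"] lt[of n] by simp
  qed
  have s2: "((\<lambda>n. (q ^ n * x) ^ Suc m) has_sum (1 / (1 - q ^ Suc m) * x ^ Suc m)) UNIV" for m
  proof (rule norm_summable_imp_has_sum)
    have lq: "norm (q ^ Suc m) < 1" using q unfolding norm_power by (subst power_less_one_iff) auto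
    have e: "(q ^ n * x) ^ Suc m = (q ^ Suc m) ^ n * x ^ Suc m" for n
      by (simp only: power_mult_distrib power_mult[symmetric] mult.commute)
    have "summable (\<lambda>n. norm (q ^ Suc m) ^ n * norm (x ^ Suc m))"
      by (intro summable_mult2 summable_geometric) (use lq in auto)
    thus "summable (\<lambda>n. norm ((q ^ n * x) ^ Suc m))" unfolding e norm_mult norm_power .
    show "(\<lambda>n. (q ^ n * x) ^ Suc m) sums (1 / (1 - q ^ Suc m) * x ^ Suc m)"
      unfolding e using sums_mult2[OF geometric_sums[OF lq]] .
  qed
  define S where "S = (\<Sum>\<^sub>\<infinity>(n,m)\<in>UNIV \<times> UNIV. (q ^ n * x) ^ Suc m)"
  have hs: "((\<lambda>(n,m). (q ^ n * x) ^ Suc m) has_sum S) (UNIV \<times> UNIV)"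
    unfolding S_def using sm by (rule has_sum_infsum)
  have a: "((\<lambda>n. q ^ n * x / (1 - q ^ n * x)) has_sum S) UNIV"
    by (rule has_sum_SigmaD[OF hs]) (use s1 in auto)
  have hs': "((\<lambda>(m,n). (q ^ n * x) ^ Suc m) has_sum S) (UNIV \<times> UNIV)"
    using has_sum_swap[THEN iffD1, OF hs] by simp
  have b: "((\<lambda>m. 1 / (1 - q ^ Suc m) * x ^ Suc m) has_sum S) UNIV"
    by (rule has_sum_SigmaD[OF hs']) (use s2 in auto)
  have "(\<lambda>m. 1 / (1 - q ^ Suc m) * x ^ Suc m) sums S" using b by (rule has_sum_imp_sums)
  hence "(\<lambda>m. 1 / (1 - q ^ m) * x ^ m) sums S" by (subst (asm) sums_Suc_iff) auto
  hence "lambert 0 q x = S" unfolding lambert_def by (simp add: sums_iff)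
  thus ?thesis using has_sum_imp_sums[OF a] by simp
qed

text \<open>The double series of \<open>m ^ k * q ^ (m * n)\<close> over positive \<open>m\<close>,
  \<open>n\<close> is summed along rows, giving the Lambert series, and along the hyperbolas
  \<open>m * n = N\<close>, giving the divisor sums.\<close>

lemma lambert_conv_divisor_sum:
  assumes q: "norm q < 1"
  shows "(\<lambda>m. of_nat (divisor_sum k m) * q ^ m) sums lambert k q q"
proof -
  define f where "f = (\<lambda>(m::nat,n::nat). of_nat m ^ k * q ^ (m * n) :: complex)"
  have gs: "((\<lambda>n. y ^ n) has_sum (y / (1 - y))) {1..}" "((\<lambda>n. norm (y ^ n)) has_sum (norm y / (1 - norm y))) {1..}" 
    if "norm y < 1" for y :: complex
  proof -
    have *: "((\<lambda>n. y ^ Suc n) has_sum (y / (1 - y))) UNIV"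
    proof (rule norm_summable_imp_has_sum)
      have "summable (\<lambda>n. norm y * norm y ^ n)" by (intro summable_mult summable_geometric) (use that in auto)
      thus "summable (\<lambda>n. norm (y ^ Suc n))" by (simp add: norm_mult norm_power)
      show "(\<lambda>n. y ^ Suc n) sums (y / (1 - y))" using sums_mult[OF geometric_sums[OF that], of y] by simp
    qed
    have **: "((\<lambda>n. norm (y ^ Suc n)) has_sum (norm y / (1 - norm y))) UNIV"
      by (rule sums_nonneg_imp_has_sum)
        (use sums_mult[OF geometric_sums[of "norm y"], of "norm y"] that in \<open>auto simp: norm_mult norm_power\<close>)
    have im: "range Suc = {1..}" using Suc_le_D by force
    show "((\<lambda>n. y ^ n) has_sum (y / (1 - y))) {1..}"
      using has_sum_reindex[of Suc UNIV "\<lambda>n. y ^ n"] * im by (simp add: o_def)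
    show "((\<lambda>n. norm (y ^ n)) has_sum (norm y / (1 - norm y))) {1..}"
      using has_sum_reindex[of Suc UNIV "\<lambda>n. norm (y ^ n)"] ** im by (simp add: o_def)
  qed
  have lm: "norm (q ^ m) < 1" if "m \<ge> 1" for m
    unfolding norm_power by (subst power_less_one_iff) (use that q in auto)
  have s1: "((\<lambda>n. f (m,n)) has_sum (of_nat m ^ k / (1 - q ^ m) * q ^ m)) {1..}" if "m \<in> {1..}" for m
    using has_sum_cmult_right[OF gs(1)[OF lm[of m]], of "of_nat m ^ k"] that
    by (simp add: f_def power_mult)
  have s2: "((\<lambda>n. norm (f (m,n))) has_sum (of_nat m ^ k / (1 - norm q ^ m) * norm q ^ m)) {1..}" if "m \<in> {1..}" for m
    using has_sum_cmult_right[OF gs(2)[OF lm[of m]], of "of_nat m ^ k"] that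
    by (simp add: f_def power_mult norm_mult norm_power)
  have "(\<lambda>p. norm (f p)) summable_on {1..} \<times> {1..}"
  proof (subst Infinite_Sum.abs_summable_on_Sigma_iff, intro conjI ballI)
    fix m :: nat assume "m \<in> {1..}"
    thus "(\<lambda>n. norm (f (m,n))) summable_on {1..}" using s2 has_sum_imp_summable by blast
  next
    \<comment> \<open>The real majorant is treated as a complex series at the point
      \<open>norm q\<close>, so that \<open>summable_power_times\<close> applies to it.\<close>
    have "summable (\<lambda>m. norm (of_nat m ^ k / (1 - of_real (norm q) ^ m) * of_real (norm q) ^ m :: complex))"
    proof (rule summable_comparison_test')
      have "norm (complex_of_real (norm q)) < 1" using q by simp
      hence "summable (\<lambda>m. of_nat m ^ k * 1 * (complex_of_real (norm q)) ^ m)"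
        by (rule summable_power_times[rotated]) (auto intro: summable_geometric)
      hence "summable (\<lambda>m. complex_of_real (real m ^ k * norm q ^ m))" by simp
      hence "summable (\<lambda>m. real m ^ k * norm q ^ m)" by (simp only: summable_complex_of_real)
      thus "summable (\<lambda>m. 1 / (1 - norm q) * (real m ^ k * norm q ^ m))" by (rule summable_mult)
      fix m
      show "norm (norm (of_nat m ^ k / (1 - of_real (norm q) ^ m) * of_real (norm q) ^ m :: complex))
         \<le> 1 / (1 - norm q) * (real m ^ k * norm q ^ m)"
      proof (cases "m = 0")
        case False
        have "norm (of_nat m ^ k / (1 - of_real (norm q) ^ m) * of_real (norm q) ^ m :: complex) 
           = (real m ^ k * norm q ^ m) / norm (1 - complex_of_real (norm q) ^ m)"
          by (simp add: norm_mult norm_divide norm_power)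
        also have "\<dots> \<le> (real m ^ k * norm q ^ m) / (1 - norm q)"
          using norm_one_minus_power_ge[of "of_real (norm q)" m] q False by (intro divide_left_mono mult_pos_pos) auto
        finally show ?thesis by simp
      qed (use q in auto)
    qed
    hence "summable (\<lambda>m. norm (of_real (of_nat m ^ k / (1 - norm q ^ m) * norm q ^ m) :: complex))"
      by simp
    hence "summable (\<lambda>m. norm (of_nat m ^ k / (1 - norm q ^ m) * norm q ^ m))"
      by (simp only: norm_of_real real_norm_def)
    hence "(\<lambda>m. norm (of_nat m ^ k / (1 - norm q ^ m) * norm q ^ m)) summable_on UNIV"
      by (intro summable_nonneg_imp_summable_on) auto
    hence "(\<lambda>m. norm (of_nat m ^ k / (1 - norm q ^ m) * norm q ^ m)) summable_on {1..}"
      by (rule summable_on_subset_banach) auto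
    thus "(\<lambda>m. norm (\<Sum>\<^sub>\<infinity>n\<in>{1..}. norm (f (m, n)))) summable_on {1..}"
      by (rule summable_on_cong[THEN iffD1, rotated]) (use infsumI[OF s2] in auto)
  qed
  hence sm: "f summable_on {1..} \<times> {1..}" by (rule abs_summable_summable)
  define S where "S = infsum f ({1..} \<times> {1..})"
  have hs: "(f has_sum S) ({1..} \<times> {1..})" unfolding S_def using sm by (rule has_sum_infsum)
  have a: "((\<lambda>m. of_nat m ^ k / (1 - q ^ m) * q ^ m) has_sum S) {1..}"
    by (rule has_sum_SigmaD[OF hs]) (use s1 in auto)
  \<comment> \<open>Reindexing by the bijection between pairs \<open>(m, n)\<close> and pairs of a
    product \<open>N = m * n\<close> with its divisor \<open>d = m\<close>.\<close>
  have h2: "((\<lambda>(N,d). of_nat d ^ k * q ^ N) has_sum S) (Sigma {1..} (\<lambda>N. {d. d dvd N}))"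
    using hs
    by (rule has_sum_reindex_bij_witness[where i = "\<lambda>(m,n). (m * n, m)" and j = "\<lambda>(N,d). (d, N div d)", THEN iffD2, rotated -1])
       (auto simp: f_def dvd_div_eq_0_iff Suc_le_eq intro!: Nat.gr0I)
  have b: "((\<lambda>N. of_nat (divisor_sum k N) * q ^ N) has_sum S) {1..}"
  proof (rule has_sum_SigmaD[OF h2])
    fix N :: nat assume "N \<in> {1..}"
    hence "finite {d. d dvd N}" by auto
    thus "((\<lambda>d. case (N, d) of (N, d) \<Rightarrow> of_nat d ^ k * q ^ N) has_sum of_nat (divisor_sum k N) * q ^ N) {d. d dvd N}"
      by (auto simp: divisor_sum_def sum_distrib_right intro!: has_sum_finiteI)
  qed
  \<comment> \<open>The index 0 adds nothing on either side: the Lambert term is a division by 0,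
    and \<open>divisor_sum k 0\<close> is 0.\<close>
  have ext: "(g has_sum S) UNIV" if "(g has_sum S) {1..}" "g 0 = 0" for g :: "nat \<Rightarrow> complex"
    using that(1) by (rule has_sum_cong_neutral[THEN iffD1, rotated -1]) (use that(2) in \<open>auto simp: not_le\<close>)
  have "lambert k q q = S"
    using has_sum_imp_sums[OF ext[OF a]] unfolding lambert_def by (simp add: sums_iff)
  thus ?thesis using has_sum_imp_sums[OF ext[OF b]] by simp
qed

section \<open>The quasi-periodic function with simple poles on a lattice\<close>


text \<open>Continuation in \<open>x\<close> of \<open>lambert 0 q\<close>, whose power series
  converges only in the unit disc. The poles are the points where
  \<open>q ^ n * x = 1\<close>.\<close>

definition lambertG :: "complex \<Rightarrow> complex \<Rightarrow> complex" where
  "lambertG q x = (\<Sum>n. q ^ n * x / (1 - q ^ n * x))"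

lemma lambertG_eq: "norm q < 1 \<Longrightarrow> norm x < 1 \<Longrightarrow> lambertG q x = lambert 0 q x"
  unfolding lambertG_def using lambert_0_eq by (simp add: sums_iff)

lemma ex_power_mult_norm_less_1:
  fixes q x :: complex
  assumes "norm q < 1"
  obtains N where "norm (q ^ N * x) < 1"
proof -
  have "(\<lambda>N. q ^ N * x) \<longlonglongrightarrow> 0 * x"
    by (intro tendsto_intros LIMSEQ_power_zero assms)
  hence "eventually (\<lambda>N. norm (q ^ N * x) < 1) sequentially"
    by (intro order_tendstoD[of _ 0] tendsto_norm_zero) auto
  thus ?thesis using that by (auto simp: eventually_sequentially)
qed

lemma summable_lambertG:
  fixes q x :: complex
  assumes "norm q < 1"
  shows "summable (\<lambda>n. q ^ n * x / (1 - q ^ n * x))"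
proof -
  obtain N where N: "norm (q ^ N * x) < 1" using ex_power_mult_norm_less_1[OF assms] .
  have "summable (\<lambda>n. q ^ (n + N) * x / (1 - q ^ (n + N) * x))"
    using lambert_0_eq[OF assms N] by (simp add: sums_iff power_add mult_ac)
  thus ?thesis by (subst (asm) summable_iff_shift)
qed

lemma lambertG_shift:
  assumes "norm q < 1"
  shows "lambertG q x = (\<Sum>n<N. q ^ n * x / (1 - q ^ n * x)) + lambertG q (q ^ N * x)"
  unfolding lambertG_def
  by (subst suminf_split_initial_segment[OF summable_lambertG[OF assms], of _ N])
     (simp add: power_add mult_ac)

lemma lambertG_step:
  "norm q < 1 \<Longrightarrow> lambertG q x = x / (1 - x) + lambertG q (q * x)"
  using lambertG_shift[of q x 1] by simp

text \<open>Multiplicative form of the shift by \<open>\<tau>\<close>: the left side is the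
  right-hand difference at \<open>q * X\<close> in place of \<open>X\<close>. Only the terms of
  index 0 move, and \<open>1 / (X - 1) + X / (1 - X) = -1\<close>.\<close>

lemma lambertG_reflect:
  assumes "norm q < 1" "X \<noteq> 0" "X \<noteq> 1"
  shows "lambertG q (1 / X) - lambertG q (q * X) = lambertG q (q / X) - lambertG q X - 1"
proof -
  have "lambertG q (1 / X) = (1/X) / (1 - 1/X) + lambertG q (q / X)"
    using lambertG_step[of q "1/X"] assms by simp
  moreover have "(1/X) / (1 - 1/X) = 1 / (X - 1)" using assms by (simp add: field_simps)
  moreover have "lambertG q X = X / (1 - X) + lambertG q (q * X)"
    using lambertG_step[of q "X"] assms by simp
  moreover have "X / (1 - X) = - 1 - 1 / (X - 1)" using assms by (simp add: divide_simps) algebra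
  ultimately show ?thesis by simp
qed

text \<open>Near a given point some \<open>q ^ N * x\<close> stays in the unit disc, so the
  conditions for \<open>n \<ge> N\<close> hold automatically and finitely many open conditions
  remain.\<close>

lemma open_lambertG_domain:
  fixes q :: complex
  assumes "norm q < 1"
  shows "open {x. \<forall>n. q ^ n * x \<noteq> 1}"
proof (subst open_subopen, intro ballI)
  fix x0 assume x0: "x0 \<in> {x. \<forall>n. q ^ n * x \<noteq> 1}"
  obtain N where N: "norm (q ^ N * x0) < 1" using ex_power_mult_norm_less_1[OF assms] .
  let ?T = "{x. norm (q ^ N * x) < 1} \<inter> (\<Inter>n\<in>{..<N}. {x. q ^ n * x \<noteq> 1})"
  have "open ?T"
    by (intro open_Int open_INT open_Collect_less ballI finite_lessThan open_Collect_neq continuous_intros)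
  moreover have "?T \<subseteq> {x. \<forall>n. q ^ n * x \<noteq> 1}"
  proof safe
    fix x n assume x: "norm (q ^ N * x) < 1" "x \<in> (\<Inter>n\<in>{..<N}. {x. q ^ n * x \<noteq> 1})" "q ^ n * x = 1"
    hence "n \<ge> N" by (auto simp: not_less[symmetric])
    then obtain k where "n = k + N" using le_Suc_ex by (metis add.commute)
    hence "norm (q ^ k) * norm (q ^ N * x) = 1" using x(3) by (metis mult.assoc norm_mult norm_one power_add)
    moreover have "norm (q ^ k) * norm (q ^ N * x) \<le> 1 * norm (q ^ N * x)"
      by (intro mult_right_mono) (use assms in \<open>auto simp: norm_power power_le_one\<close>)
    ultimately show False using x(1) by simp
  qed
  ultimately show "\<exists>T. open T \<and> x0 \<in> T \<and> T \<subseteq> {x. \<forall>n. q ^ n * x \<noteq> 1}"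
    using N x0 by (intro exI[of _ ?T]) auto
qed

text \<open>With \<open>N\<close> fixed on a neighbourhood, \<open>lambertG_shift\<close> writes the
  function as a finite sum of rational terms plus the power series \<open>lambert 0 q\<close> inside
  its disc of convergence.\<close>

lemma lambertG_holomorphic:
  fixes q :: complex
  assumes "norm q < 1"
  shows "lambertG q holomorphic_on {x. \<forall>n. q ^ n * x \<noteq> 1}"
proof (rule holomorphic_onI, rule field_differentiable_at_within)
  fix x0 assume x0: "x0 \<in> {x. \<forall>n. q ^ n * x \<noteq> 1}"
  obtain N where N: "norm (q ^ N * x0) < 1" using ex_power_mult_norm_less_1[OF assms] .
  obtain D where "(lambert 0 q has_field_derivative D) (at (q ^ N * x0))"
    using lambert_has_derivative[OF assms N] by metis
  hence "lambert 0 q field_differentiable at (q ^ N * x0)" by (auto simp: field_differentiable_def)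
  hence d: "(\<lambda>x. lambert 0 q (q ^ N * x)) field_differentiable at x0"
    using field_differentiable_compose[of "\<lambda>x. q ^ N * x" x0 "lambert 0 q"]
    by (auto simp: o_def intro!: derivative_intros)
  have "(\<lambda>x. (\<Sum>n<N. q ^ n * x / (1 - q ^ n * x)) + lambert 0 q (q ^ N * x)) field_differentiable at x0"
    by (intro field_differentiable_add d field_differentiable_sum field_differentiable_divide derivative_intros)
       (use x0 in auto)
  moreover have "eventually (\<lambda>x. (\<Sum>n<N. q ^ n * x / (1 - q ^ n * x)) + lambert 0 q (q ^ N * x) = lambertG q x) (nhds x0)"
  proof -
    have "open {x. norm (q ^ N * x) < 1}" by (intro open_Collect_less continuous_intros)
    hence "eventually (\<lambda>x. x \<in> {x. norm (q ^ N * x) < 1}) (nhds x0)" using N by (intro eventually_nhds_in_open) auto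
    thus ?thesis
    proof eventually_elim
      case (elim x)
      show ?case by (subst lambertG_shift[OF assms, of x N], subst lambertG_eq[OF assms]) (use elim in auto)
    qed
  qed
  ultimately show "lambertG q field_differentiable at x0"
    unfolding field_differentiable_def by (subst (asm) DERIV_cong_ev[OF refl _ refl])
qed

section \<open>The exponential coordinate and the lattice of poles\<close>

lemma qpar_add: "qpar (x + y) = qpar x * qpar y"
  by (simp add: qpar_def algebra_simps exp_add)

lemma qpar_minus: "qpar (- x) = inverse (qpar x)"
  by (simp add: qpar_def exp_minus)

lemma qpar_diff: "qpar (x - y) = qpar x / qpar y"
  by (simp add: qpar_def algebra_simps exp_diff)

lemma qpar_nonzero [simp]: "qpar x \<noteq> 0"
  by (simp add: qpar_def)

lemma qpar_1 [simp]: "qpar 1 = 1"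
  by (simp add: qpar_def)

lemma qpar_0 [simp]: "qpar 0 = 1"
  by (simp add: qpar_def)

lemma qpar_of_nat_mult: "qpar (of_nat n * z) = qpar z ^ n"
  by (simp add: qpar_def exp_of_nat_mult[symmetric] mult_ac)

lemma norm_qpar: "norm (qpar x) = exp (- 2 * pi * Im x)"
  by (simp add: qpar_def)

lemma norm_qpar_less_1_iff [simp]: "norm (qpar x) < 1 \<longleftrightarrow> Im x > 0"
  by (simp add: norm_qpar zero_less_mult_iff)

lemma qpar_eq_1_iff: "qpar x = 1 \<longleftrightarrow> x \<in> \<int>"
proof -
  have "qpar x = 1 \<longleftrightarrow> (\<exists>n. 2 * pi * \<i> * x = of_int (2 * n) * pi * \<i>)"
    unfolding qpar_def exp_eq_1 by (auto simp: complex_eq_iff algebra_simps)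
  also have "\<dots> \<longleftrightarrow> x \<in> \<int>" by (auto simp: Ints_def)
  finally show ?thesis .
qed

lemma has_field_derivative_qpar [derivative_intros]:
  assumes "(f has_field_derivative f') (at x within A)"
  shows "((\<lambda>x. qpar (f x)) has_field_derivative (2 * pi * \<i> * f' * qpar (f x))) (at x within A)"
  unfolding qpar_def by (rule derivative_eq_intros assms refl)+ (simp add: mult_ac)

lemma holomorphic_on_qpar [holomorphic_intros]:
  "f holomorphic_on A \<Longrightarrow> (\<lambda>x. qpar (f x)) holomorphic_on A"
  unfolding qpar_def by (intro holomorphic_intros)

definition lattice :: "complex \<Rightarrow> complex set" where
  "lattice \<tau> = {of_int m + of_int n * \<tau> |m n. True}"

text \<open>The two alternatives are the poles of the two \<open>lambertG\<close> terms in
  \<open>qzeta\<close>: the first gives the lattice points whose coefficient of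
  \<open>\<tau>\<close> is at most 0, the second those where it is at least 1.\<close>

lemma lattice_iff:
  "z \<in> lattice \<tau> \<longleftrightarrow> (\<exists>n. qpar \<tau> ^ n * qpar z = 1) \<or> (\<exists>n. qpar \<tau> ^ n * (qpar \<tau> / qpar z) = 1)"
proof -
  have 1: "qpar \<tau> ^ n * qpar z = 1 \<longleftrightarrow> (\<exists>m. of_nat n * \<tau> + z = of_int m)" for n
    unfolding qpar_of_nat_mult[symmetric] qpar_add[symmetric] qpar_eq_1_iff by (auto simp: Ints_def)
  have 2: "qpar \<tau> ^ n * (qpar \<tau> / qpar z) = 1 \<longleftrightarrow> (\<exists>m. of_nat n * \<tau> + (\<tau> - z) = of_int m)" for n
    unfolding qpar_of_nat_mult[symmetric] qpar_diff[symmetric] qpar_add[symmetric] qpar_eq_1_iff by (auto simp: Ints_def)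
  show ?thesis unfolding 1 2
  proof safe
    assume "z \<in> lattice \<tau>" and no: "\<nexists>n m. of_nat n * \<tau> + (\<tau> - z) = of_int m"
    then obtain m n where z: "z = of_int m + of_int n * \<tau>" by (auto simp: lattice_def)
    have "n \<le> 0"
    proof (rule ccontr)
      assume "\<not> n \<le> 0"
      hence "of_nat (nat (n - 1)) * \<tau> + (\<tau> - z) = of_int (- m)" by (simp add: z algebra_simps of_nat_nat)
      thus False using no by blast
    qed
    hence "of_nat (nat (- n)) * \<tau> + z = of_int m" by (simp add: z of_nat_nat)
    thus "\<exists>n m. of_nat n * \<tau> + z = of_int m" by blast
  next
    fix n m assume "of_nat n * \<tau> + z = of_int m"
    hence "z = of_int m + of_int (- int n) * \<tau>" by (simp add: algebra_simps)
    thus "z \<in> lattice \<tau>" unfolding lattice_def by blast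
  next
    fix n m assume "of_nat n * \<tau> + (\<tau> - z) = of_int m"
    hence "z = of_int (- m) + of_int (int n + 1) * \<tau>" by (simp add: algebra_simps)
    thus "z \<in> lattice \<tau>" unfolding lattice_def by blast
  qed
qed

lemma lattice_minus_iff: "- z \<in> lattice \<tau> \<longleftrightarrow> z \<in> lattice \<tau>"
proof -
  have "- z \<in> lattice \<tau>" if z: "z \<in> lattice \<tau>" for z
  proof -
    obtain m n where "z = of_int m + of_int n * \<tau>" using z by (auto simp: lattice_def)
    hence "- z = of_int (-m) + of_int (-n) * \<tau>" by simp
    thus ?thesis unfolding lattice_def by blast
  qed
  from this[of z] this[of "-z"] show ?thesis by auto
qed

lemma lattice_add_iff: 
  assumes "w \<in> lattice \<tau>"
  shows "z + w \<in> lattice \<tau> \<longleftrightarrow> z \<in> lattice \<tau>"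
proof -
  have add: "z + w \<in> lattice \<tau>" if zw: "z \<in> lattice \<tau>" "w \<in> lattice \<tau>" for z w
  proof -
    obtain m n m' n' where "z = of_int m + of_int n * \<tau>" "w = of_int m' + of_int n' * \<tau>"
      using zw by (auto simp: lattice_def)
    hence "z + w = of_int (m + m') + of_int (n + n') * \<tau>" by (simp add: algebra_simps)
    thus ?thesis unfolding lattice_def by blast
  qed
  from add[of z w] add[of "z + w" "-w"] assms lattice_minus_iff show ?thesis by auto
qed

lemma lattice_period: "1 \<in> lattice \<tau>" "\<tau> \<in> lattice \<tau>" "0 \<in> lattice \<tau>"
proof -
  have "1 = of_int 1 + of_int 0 * \<tau>" "\<tau> = of_int 0 + of_int 1 * \<tau>" "0 = of_int 0 + of_int 0 * \<tau>" by simp_all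
  thus "1 \<in> lattice \<tau>" "\<tau> \<in> lattice \<tau>" "0 \<in> lattice \<tau>" unfolding lattice_def by blast+
qed

lemma lattice_inversion:
  assumes "\<tau> \<noteq> 0" shows "z / \<tau> \<in> lattice (-1 / \<tau>) \<longleftrightarrow> z \<in> lattice \<tau>"
proof
  assume "z / \<tau> \<in> lattice (-1 / \<tau>)"
  then obtain m n where "z / \<tau> = of_int m + of_int n * (-1/\<tau>)" by (auto simp: lattice_def)
  hence "z = of_int (- n) + of_int m * \<tau>" using assms by (simp add: field_simps)
  thus "z \<in> lattice \<tau>" unfolding lattice_def by blast
next
  assume "z \<in> lattice \<tau>"
  then obtain m n where "z = of_int m + of_int n * \<tau>" by (auto simp: lattice_def)
  hence "z / \<tau> = of_int n + of_int (- m) * (-1/\<tau>)" using assms by (simp add: field_simps)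
  thus "z / \<tau> \<in> lattice (-1 / \<tau>)" unfolding lattice_def by blast
qed

text \<open>The function of the overview in another grouping: the constant and the term of index 0
  in \<open>lambertG (qpar \<tau>) (qpar z)\<close> together form the cotangent. It is the
  Weierstrass zeta function of the lattice minus the linear term that makes it 1-periodic.\<close>

definition qzeta :: "complex \<Rightarrow> complex \<Rightarrow> complex" where
  "qzeta \<tau> z = - pi * \<i> + 2 * pi * \<i> * (lambertG (qpar \<tau>) (qpar \<tau> / qpar z) - lambertG (qpar \<tau>) (qpar z))"

lemma qzeta_add_1: "qzeta \<tau> (z + 1) = qzeta \<tau> z"
  by (simp add: qzeta_def qpar_add)

lemma qzeta_add_tau:
  assumes "Im \<tau> > 0" "z \<notin> lattice \<tau>"
  shows "qzeta \<tau> (z + \<tau>) = qzeta \<tau> z - 2 * pi * \<i>"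
proof -
  define q X where "q = qpar \<tau>" and "X = qpar z"
  have nz [simp]: "q \<noteq> 0" "X \<noteq> 0" "norm q < 1" using assms by (auto simp: q_def X_def)
  have "X \<noteq> 1" using assms(2) unfolding lattice_iff X_def by (metis mult_1 power_0)
  hence "lambertG q (1 / X) - lambertG q (q * X) = lambertG q (q / X) - lambertG q X - 1"
    by (intro lambertG_reflect) auto
  moreover have "qzeta \<tau> (z + \<tau>) = - pi * \<i> + 2 * pi * \<i> * (lambertG q (1 / X) - lambertG q (q * X))"
    by (simp add: qzeta_def qpar_add q_def X_def mult.commute)
  moreover have "qzeta \<tau> z = - pi * \<i> + 2 * pi * \<i> * (lambertG q (q / X) - lambertG q X)"
    by (simp add: qzeta_def q_def X_def)
  ultimately show ?thesis unfolding of_real_mult of_real_minus of_real_numeral by algebra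
qed

lemma closed_lattice:
  assumes "Im \<tau> > 0" shows "closed (lattice \<tau>)"
proof -
  let ?U = "{x. \<forall>n. qpar \<tau> ^ n * x \<noteq> 1}"
  have o: "open ?U" using open_lambertG_domain assms by simp
  have "- lattice \<tau> = qpar -` ?U \<inter> (\<lambda>z. qpar \<tau> / qpar z) -` ?U"
    by (auto simp: lattice_iff)
  also have "open \<dots>"
    by (intro open_Int open_vimage o) (auto simp: qpar_def intro!: continuous_intros)
  finally show ?thesis by (simp add: closed_def)
qed

lemma qzeta_holomorphic:
  assumes "Im \<tau> > 0" shows "qzeta \<tau> holomorphic_on (- lattice \<tau>)"
proof -
  let ?U = "{x. \<forall>n. qpar \<tau> ^ n * x \<noteq> 1}"
  have h: "lambertG (qpar \<tau>) holomorphic_on ?U" using lambertG_holomorphic assms by simp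
  have 1: "(\<lambda>z. lambertG (qpar \<tau>) (qpar z)) holomorphic_on (- lattice \<tau>)"
    by (rule holomorphic_on_compose_gen[of qpar, unfolded o_def, OF _ h])
       (auto simp: lattice_iff intro!: holomorphic_intros)
  have 2: "(\<lambda>z. lambertG (qpar \<tau>) (qpar \<tau> / qpar z)) holomorphic_on (- lattice \<tau>)"
    by (rule holomorphic_on_compose_gen[of "\<lambda>z. qpar \<tau> / qpar z", unfolded o_def, OF _ h])
       (auto simp: lattice_iff intro!: holomorphic_intros)
  show ?thesis unfolding qzeta_def by (intro holomorphic_intros 1 2)
qed


text \<open>In the variable \<open>x = qpar \<tau> * qpar (a * z)\<close>, d/dz is
  \<open>2 * pi * \<i> * a\<close> times the Euler operator, which raises the index of
  \<open>lambert\<close> by one. The values 1 and -1 of \<open>a\<close> serve the two Lambert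
  series in \<open>qzeta\<close>.\<close>

lemma higher_deriv_lambert_qpar:
  assumes "Im \<tau> > 0" "Im (\<tau> + a * z) > 0"
  shows "(deriv ^^ k) (\<lambda>z. lambert 0 (qpar \<tau>) (qpar \<tau> * qpar (a * z))) z
           = (2 * pi * \<i> * a) ^ k * lambert k (qpar \<tau>) (qpar \<tau> * qpar (a * z))"
  using assms(2)
proof (induction k arbitrary: z)
  case 0
  thus ?case by simp
next
  case (Suc k)
  let ?U = "{z. Im (\<tau> + a * z) > 0}"
  have "open ?U" by (intro open_Collect_less continuous_intros)
  hence ev: "eventually (\<lambda>z. z \<in> ?U) (nhds z)" using Suc.prems by (intro eventually_nhds_in_open) auto
  have nq: "norm (qpar \<tau>) < 1" using assms by simp
  have "norm (qpar \<tau> * qpar (a * z)) < 1" using Suc.prems by (simp only: qpar_add[symmetric] norm_qpar_less_1_iff)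
  from lambert_has_derivative[OF nq this, of k] obtain D where
    D: "(lambert k (qpar \<tau>) has_field_derivative D) (at (qpar \<tau> * qpar (a * z)))"
       "qpar \<tau> * qpar (a * z) * D = lambert (Suc k) (qpar \<tau>) (qpar \<tau> * qpar (a * z))" by blast
  have i: "((\<lambda>z. qpar \<tau> * qpar (a * z)) has_field_derivative (2 * pi * \<i> * a * (qpar \<tau> * qpar (a * z)))) (at z)"
    by (rule derivative_eq_intros refl)+ (simp add: mult_ac)
  have "(deriv ^^ Suc k) (\<lambda>z. lambert 0 (qpar \<tau>) (qpar \<tau> * qpar (a * z))) z
     = deriv (\<lambda>z. (2 * pi * \<i> * a) ^ k * lambert k (qpar \<tau>) (qpar \<tau> * qpar (a * z))) z"
    unfolding funpow.simps o_apply
    by (rule deriv_cong_ev) (use ev Suc.IH in \<open>auto elim!: eventually_mono\<close>)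
  also have "\<dots> = (2 * pi * \<i> * a) ^ k * (D * (2 * pi * \<i> * a * (qpar \<tau> * qpar (a * z))))"
    by (intro DERIV_imp_deriv DERIV_cmult DERIV_chain2[OF D(1) i])
  also have "\<dots> = (2 * pi * \<i> * a) ^ Suc k * (qpar \<tau> * qpar (a * z) * D)" by (simp add: mult_ac)
  finally show ?case unfolding D(2) .
qed

lemma lambert_qpar_has_fps_expansion:
  assumes "Im \<tau> > 0"
  shows "(\<lambda>z. lambert 0 (qpar \<tau>) (qpar \<tau> * qpar (a * z))) has_fps_expansion
           Abs_fps (\<lambda>k. (2 * pi * \<i> * a) ^ k / fact k * lambert k (qpar \<tau>) (qpar \<tau>))" (is "?f has_fps_expansion _")
proof -
  let ?U = "{z. Im (\<tau> + a * z) > 0}"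
  have "open ?U" by (intro open_Collect_less continuous_intros)
  have "?f holomorphic_on ?U"
  proof (rule holomorphic_onI, rule field_differentiable_at_within)
    fix z assume "z \<in> ?U"
    hence "norm (qpar \<tau> * qpar (a * z)) < 1" by (simp only: qpar_add[symmetric] norm_qpar_less_1_iff) simp
    then obtain D where D: "(lambert 0 (qpar \<tau>) has_field_derivative D) (at (qpar \<tau> * qpar (a * z)))"
      using lambert_has_derivative assms by (metis norm_qpar_less_1_iff)
    have i: "((\<lambda>z. qpar \<tau> * qpar (a * z)) has_field_derivative (2 * pi * \<i> * a * (qpar \<tau> * qpar (a * z)))) (at z)"
      by (rule derivative_eq_intros refl)+ (simp add: mult_ac)
    show "?f field_differentiable at z"
      using DERIV_chain2[OF D i] field_differentiable_def by blast
  qed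
  hence "?f analytic_on {0}" using \<open>open ?U\<close> assms by (auto simp: analytic_at)
  hence *: "?f has_fps_expansion fps_expansion ?f 0" by (rule analytic_at_imp_has_fps_expansion_0)
  have "fps_expansion ?f 0 = Abs_fps (\<lambda>k. (2 * pi * \<i> * a) ^ k / fact k * lambert k (qpar \<tau>) (qpar \<tau>))"
    by (rule fps_ext, subst fps_nth_fps_expansion[OF *], subst higher_deriv_lambert_qpar) (use assms in auto)
  with * show ?thesis by simp
qed

text \<open>This is \<open>pi * cot (pi * z)\<close>, written in the variable
  \<open>qpar z\<close>.\<close>

definition cot_part :: "complex \<Rightarrow> complex" where
  "cot_part z = - pi * \<i> - 2 * pi * \<i> * (qpar z / (1 - qpar z))"

text \<open>Clearing denominators gives a quotient \<open>N / D\<close> of explicit series, with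
  \<open>N\<close> starting at order 3 or later and \<open>D\<close> at order 2. The coefficients
  wanted are the Bernoulli terms \<open>a ^ 2 / 12\<close> and \<open>- (a ^ 4 / 720)\<close> with
  \<open>a = 2 * pi * \<i>\<close>.\<close>

lemma cot_part_expansion:
  obtains F where "(\<lambda>z. if z = 0 then 0 else cot_part z - 1 / z) has_fps_expansion F"
    "fps_nth F 1 = - (pi ^ 2 / 3)" "fps_nth F 3 = - (pi ^ 4 / 45)"
proof -
  define a :: complex where "a = 2 * pi * \<i>"
  have "a \<noteq> 0" by (simp add: a_def)
  define N D where "N = fps_exp a - 1 - fps_const (a / 2) * fps_X * (1 + fps_exp a)"
    and "D = fps_X * (1 - fps_exp a)"
  have Nn: "fps_nth N (Suc n) = a ^ Suc n / fact (Suc n) - a / 2 * (if n = 0 then 2 else a ^ n / fact n)" for n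
    by (simp add: N_def mult.assoc fps_mult_fps_X_commute del: fact_Suc)
  have N0: "fps_nth N 0 = 0" by (simp add: N_def mult.assoc)
  have Dn: "fps_nth D (Suc n) = (if n = 0 then 0 else - (a ^ n / fact n))" for n
    by (simp add: D_def)
  have D0: "fps_nth D 0 = 0" by (simp add: D_def)
  have N: "(\<lambda>z. qpar z - 1 - a / 2 * z * (1 + qpar z)) has_fps_expansion N"
    unfolding N_def qpar_def a_def[symmetric] by (intro fps_expansion_intros)
  have D: "(\<lambda>z. z * (1 - qpar z)) has_fps_expansion D"
    unfolding D_def qpar_def a_def[symmetric] by (intro fps_expansion_intros)
  have "fps_nth D 2 \<noteq> 0" using Dn[of 1] \<open>a \<noteq> 0\<close> by (simp add: numeral_eq_Suc)
  have sD: "subdegree D = 2"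
    by (rule subdegreeI) (use \<open>fps_nth D 2 \<noteq> 0\<close> D0 Dn[of 0] in \<open>auto simp: less_Suc_eq numeral_2_eq_2\<close>)
  have N12: "fps_nth N 1 = 0" "fps_nth N 2 = 0"
    using Nn[of 0] Nn[of 1] by (auto simp: numeral_2_eq_2 power2_eq_square)
  have N3: "fps_nth N 3 = - (a ^ 3 / 12)"
    using Nn[of 2] by (simp add: numeral_3_eq_3 fact_numeral power2_eq_square)
  have "N \<noteq> 0" using N3 \<open>a \<noteq> 0\<close> by auto
  have sN: "subdegree N \<ge> 3"
    by (rule subdegree_geI[OF \<open>N \<noteq> 0\<close>]) (use N0 N12 in \<open>auto simp: less_Suc_eq numeral_2_eq_2 numeral_3_eq_3\<close>)
  have D_nz: "D \<noteq> 0" using sD by auto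
  have F: "(\<lambda>z. if z = 0 then 0 else (qpar z - 1 - a / 2 * z * (1 + qpar z)) / (z * (1 - qpar z))) has_fps_expansion (N / D)"
    by (rule has_fps_expansion_divide[OF N D]) (use sD sN N12 D_nz in auto)
  have "D dvd N" using sN sD D_nz \<open>N \<noteq> 0\<close> by (simp add: fps_dvd_iff)
  hence FD: "N / D * D = N" by simp
  define C where "C = fps_nth (N / D)"
  have D1: "fps_nth D (Suc 0) = 0" using Dn[of 0] by simp
  have Dv: "fps_nth D (Suc (Suc 0)) = - a" "fps_nth D (Suc (Suc (Suc 0))) = - (a ^ 2 / 2)"
    "fps_nth D (Suc (Suc (Suc (Suc 0)))) = - (a ^ 3 / 6)"
    using Dn[of "Suc 0"] Dn[of "Suc (Suc 0)"] Dn[of "Suc (Suc (Suc 0))"]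
    by (simp_all add: power2_eq_square power3_eq_cube)
  have N4: "fps_nth N 4 = - (a ^ 4 / 24)"
    using Nn[of 3] by (simp add: fact_numeral power4_eq_xxxx power3_eq_cube)
  have N5: "fps_nth N 5 = - (a ^ 5 / 80)"
    using Nn[of 4] by (simp add: fact_numeral) (simp add: power_numeral_reduce)
  \<comment> \<open>Comparing coefficients in \<open>N / D * D = N\<close> determines
    \<open>C 0\<close> to \<open>C 3\<close> one after the other from the coefficients of
    \<open>N\<close> of order 2 to 5.\<close>
  have conv: "fps_nth N k = (\<Sum>i\<le>k. C i * fps_nth D (k - i))" for k
    unfolding C_def by (subst FD[symmetric]) (simp add: fps_mult_nth atLeast0AtMost)
  have C0: "C 0 = 0" using conv[of 2] N12 D0 D1 Dv \<open>a \<noteq> 0\<close> by (simp add: numeral_2_eq_2)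
  have C1: "C 1 = a ^ 2 / 12"
    using conv[of 3] N3 D0 D1 Dv C0 \<open>a \<noteq> 0\<close>
    by (simp add: numeral_3_eq_3) (simp add: field_simps power2_eq_square)
  have C2: "C 2 = 0"
  proof -
    have "fps_nth N 4 = C 1 * (- (a ^ 2 / 2)) + C 2 * (- a)"
      using conv[of 4] D0 D1 Dv C0 by (simp add: eval_nat_numeral)
    hence "a * C 2 = 0" unfolding N4 C1 by (simp add: field_simps eval_nat_numeral)
    thus ?thesis using \<open>a \<noteq> 0\<close> by simp
  qed
  have C3: "C 3 = - (a ^ 4 / 720)"
  proof -
    have "fps_nth N 5 = C 1 * (- (a ^ 3 / 6)) + C 3 * (- a)"
      using conv[of 5] D0 D1 Dv C0 C2 by (simp add: eval_nat_numeral)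
    hence "a * C 3 = a * (- (a ^ 4 / 720))" unfolding N5 C1 by (simp add: field_simps eval_nat_numeral)
    thus ?thesis using \<open>a \<noteq> 0\<close> mult_left_cancel by blast
  qed
  have a2: "a ^ 2 = - (4 * pi ^ 2)" by (simp add: a_def power_mult_distrib)
  have a4: "a ^ 4 = 16 * pi ^ 4" by (simp add: a_def power_mult_distrib)
  show ?thesis
  proof (rule that)
    have "(\<lambda>z. if z = 0 then 0 else (qpar z - 1 - a / 2 * z * (1 + qpar z)) / (z * (1 - qpar z))) z
          = (if z = 0 then 0 else cot_part z - 1 / z)" if z: "norm z < 1" for z
    proof (cases "z = 0")
      case False
      have "qpar z \<noteq> 1"
      proof
        assume "qpar z = 1"
        then obtain n where "z = of_int n" by (auto simp: qpar_eq_1_iff Ints_def)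
        with z False show False by simp
      qed
      thus ?thesis using False by (simp add: cot_part_def a_def divide_simps) (simp add: algebra_simps)
    qed auto
    hence "eventually (\<lambda>z. (\<lambda>z. if z = 0 then 0 else (qpar z - 1 - a / 2 * z * (1 + qpar z)) / (z * (1 - qpar z))) z
          = (if z = 0 then 0 else cot_part z - 1 / z)) (nhds 0)"
      by (intro eventually_nhds[THEN iffD2] exI[of _ "ball 0 1"]) auto
    thus "(\<lambda>z. if z = 0 then 0 else cot_part z - 1 / z) has_fps_expansion (N / D)"
      by (rule has_fps_expansion_cong[THEN iffD1, OF _ refl F])
    show "fps_nth (N / D) 1 = - (pi ^ 2 / 3)" using C1 a2 by (simp add: C_def)
    show "fps_nth (N / D) 3 = - (pi ^ 4 / 45)" using C3 a4 by (simp add: C_def)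
  qed
qed

text \<open>In the strip both \<open>qpar \<tau> * qpar z\<close> and
  \<open>qpar \<tau> * qpar (- z)\<close> lie in the unit disc, so after splitting off one term the
  power series apply. The factors -1 and 1 match the parameter \<open>a\<close> of the expansion
  lemma.\<close>

lemma qzeta_near_0:
  assumes "Im \<tau> > 0" "\<bar>Im z\<bar> < Im \<tau>"
  shows "qzeta \<tau> z = cot_part z + 2 * pi * \<i> * (lambert 0 (qpar \<tau>) (qpar \<tau> * qpar (-1 * z)) - lambert 0 (qpar \<tau>) (qpar \<tau> * qpar (1 * z)))"
proof -
  have n: "norm (qpar \<tau>) < 1" "norm (qpar \<tau> * qpar z) < 1" "norm (qpar \<tau> * qpar (- z)) < 1"
    using assms by (simp_all only: qpar_add[symmetric] norm_qpar_less_1_iff) auto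
  have "lambertG (qpar \<tau>) (qpar z) = qpar z / (1 - qpar z) + lambertG (qpar \<tau>) (qpar \<tau> * qpar z)"
    using lambertG_step n by blast
  moreover have "qpar \<tau> / qpar z = qpar \<tau> * qpar (- z)" by (simp add: qpar_minus divide_inverse)
  ultimately show ?thesis using n
    by (simp add: qzeta_def cot_part_def lambertG_eq algebra_simps)
qed

lemma lattice_near_0:
  assumes "Im \<tau> > 0" "\<bar>Im z\<bar> < Im \<tau>" "norm z < 1" "z \<in> lattice \<tau>"
  shows "z = 0"
proof -
  obtain m n where z: "z = of_int m + of_int n * \<tau>" using assms by (auto simp: lattice_def)
  have "\<bar>real_of_int n\<bar> * Im \<tau> < 1 * Im \<tau>" using assms by (simp add: z abs_mult)
  hence "\<bar>real_of_int n\<bar> < 1" using assms(1) by (simp only: mult_less_cancel_right_pos)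
  hence "n = 0" by linarith
  hence "\<bar>real_of_int m\<bar> < 1" using assms(3) by (simp add: z)
  hence "m = 0" by linarith
  with \<open>n = 0\<close> show ?thesis by (simp add: z)
qed

text \<open>\<open>qzeta\<close> near 0 without its pole \<open>1 / z\<close>. The value 0 at the
  origin is the limit, since the cotangent part without its pole is odd and the Lambert terms
  cancel.\<close>

definition qzeta_reg :: "complex \<Rightarrow> complex \<Rightarrow> complex" where
  "qzeta_reg \<tau> z = (if z = 0 then 0 else cot_part z - 1 / z) + 2 * pi * \<i> * (lambert 0 (qpar \<tau>) (qpar \<tau> * qpar (-1 * z)) - lambert 0 (qpar \<tau>) (qpar \<tau> * qpar (1 * z)))"

lemma qzeta_reg_0 [simp]: "qzeta_reg \<tau> 0 = 0"
  by (simp add: qzeta_reg_def)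

lemma qzeta_eq_reg:
  assumes "Im \<tau> > 0" "\<bar>Im z\<bar> < Im \<tau>" "z \<noteq> 0"
  shows "qzeta \<tau> z = 1 / z + qzeta_reg \<tau> z"
  using qzeta_near_0[OF assms(1,2)] assms(3) by (simp add: qzeta_reg_def)

definition eisenstein_E2 :: "complex \<Rightarrow> complex" where
  "eisenstein_E2 \<tau> = 1 - 24 * lambert 1 (qpar \<tau>) (qpar \<tau>)"

lemma eisenstein_E4_eq:
  assumes "Im \<tau> > 0"
  shows "eisenstein_E4 \<tau> = 1 + 240 * lambert 3 (qpar \<tau>) (qpar \<tau>)"
proof -
  have "(\<lambda>m. of_nat (divisor_sum 3 m) * qpar \<tau> ^ m) sums lambert 3 (qpar \<tau>) (qpar \<tau>)"
    by (rule lambert_conv_divisor_sum) (use assms in simp)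
  hence "(\<lambda>m. of_nat (divisor_sum 3 (Suc m)) * qpar \<tau> ^ Suc m) sums lambert 3 (qpar \<tau>) (qpar \<tau>)"
    by (subst sums_Suc_iff) simp
  thus ?thesis unfolding eisenstein_E4_def sigma3_def divisor_sum_def by (simp add: sums_iff)
qed

text \<open>The Lambert series for \<open>a = -1\<close> and \<open>a = 1\<close> enter with
  opposite signs, so their coefficients of odd order add up. The ratios to the cotangent
  coefficients are exactly the -24 and 240 of the Eisenstein series.\<close>

lemma qzeta_reg_expansion:
  assumes "Im \<tau> > 0"
  obtains R where "qzeta_reg \<tau> has_fps_expansion R"
    "fps_nth R 1 = - (pi ^ 2 / 3) * eisenstein_E2 \<tau>"
    "fps_nth R 3 = - (pi ^ 4 / 45) * eisenstein_E4 \<tau>"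
proof -
  obtain F where F: "(\<lambda>z. if z = 0 then 0 else cot_part z - 1 / z) has_fps_expansion F"
    "fps_nth F 1 = - (pi ^ 2 / 3)" "fps_nth F 3 = - (pi ^ 4 / 45)" using cot_part_expansion .
  define H where "H = (\<lambda>a. Abs_fps (\<lambda>k. (2 * pi * \<i> * a) ^ k / fact k * lambert k (qpar \<tau>) (qpar \<tau>)))"
  have H: "(\<lambda>z. lambert 0 (qpar \<tau>) (qpar \<tau> * qpar (a * z))) has_fps_expansion H a" for a
    unfolding H_def by (rule lambert_qpar_has_fps_expansion[OF assms])
  have "qzeta_reg \<tau> has_fps_expansion F + fps_const (2 * pi * \<i>) * (H (-1) - H 1)"
    unfolding qzeta_reg_def
    by (intro has_fps_expansion_add has_fps_expansion_cmult_left has_fps_expansion_diff F(1) H)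
  moreover have "fps_nth (F + fps_const (2 * pi * \<i>) * (H (-1) - H 1)) 1 = - (pi ^ 2 / 3) * eisenstein_E2 \<tau>"
  proof -
    define a :: complex where "a = 2 * pi * \<i>"
    define l where "l = lambert 1 (qpar \<tau>) (qpar \<tau>)"
    have a2: "a ^ 2 = - 4 * pi ^ 2" by (simp add: a_def power_mult_distrib)
    have "fps_nth (F + fps_const a * (H (-1) - H 1)) 1 = - (pi ^ 2 / 3) + a * (- a * l - a * l)"
      using F(2) by (simp add: H_def a_def l_def)
    also have "\<dots> = - (pi ^ 2 / 3) - 2 * a ^ 2 * l" by (simp add: eval_nat_numeral)
    also have "\<dots> = - (pi ^ 2 / 3) * (1 - 24 * l)" unfolding a2 by (simp add: field_simps)
    finally show ?thesis by (simp only: a_def eisenstein_E2_def l_def)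
  qed
  moreover have "fps_nth (F + fps_const (2 * pi * \<i>) * (H (-1) - H 1)) 3 = - (pi ^ 4 / 45) * eisenstein_E4 \<tau>"
  proof -
    define a :: complex where "a = 2 * pi * \<i>"
    define l where "l = lambert 3 (qpar \<tau>) (qpar \<tau>)"
    have a4: "a ^ 4 = 16 * pi ^ 4" by (simp add: a_def power_mult_distrib)
    have "fps_nth (F + fps_const a * (H (-1) - H 1)) 3 = - (pi ^ 4 / 45) + a * ((- a) ^ 3 / 6 * l - a ^ 3 / 6 * l)"
      using F(3) by (simp add: H_def a_def l_def fact_numeral)
    also have "\<dots> = - (pi ^ 4 / 45) - a ^ 4 / 3 * l" by (simp add: eval_nat_numeral)
    also have "\<dots> = - (pi ^ 4 / 45) * (1 + 240 * l)" unfolding a4 by (simp add: algebra_simps)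
    finally show ?thesis by (simp only: a_def eisenstein_E4_eq[OF assms] l_def)
  qed
  ultimately show ?thesis by (rule that)
qed

section \<open>Inversion of the Eisenstein series\<close>


lemma periodic_of_int:
  fixes f :: "complex \<Rightarrow> complex"
  assumes "\<And>z. f (z + c) = f z"
  shows "f (z + of_int m * c) = f z"
proof -
  have nat: "f (z + of_nat n * c) = f z" for n z
  proof (induction n)
    case (Suc n)
    have "f (z + of_nat (Suc n) * c) = f ((z + of_nat n * c) + c)" by (simp add: algebra_simps)
    thus ?case using assms Suc.IH by simp
  qed auto
  show ?thesis
  proof (cases "m \<ge> 0")
    case True
    thus ?thesis using nat[of z "nat m"] by simp
  next
    case False
    thus ?thesis using nat[of "z + of_int m * c" "nat (- m)"] by (simp add: algebra_simps)
  qed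
qed

text \<open>Every value is attained on the compact period parallelogram \<open>K\<close>, so the
  function is bounded and Liouville's theorem applies.\<close>

lemma doubly_periodic_entire_constant:
  fixes f :: "complex \<Rightarrow> complex"
  assumes holo: "f holomorphic_on UNIV" and "Im \<tau> > 0"
    and p1: "\<And>z. f (z + 1) = f z" and p2: "\<And>z. f (z + \<tau>) = f z"
  shows "f constant_on UNIV"
proof -
  define K where "K = (\<lambda>(a, b). of_real a + of_real b * \<tau>) ` ({0..1::real} \<times> {0..1::real})"
  have "compact K" unfolding K_def
    by (intro compact_continuous_image compact_Times compact_Icc) (auto simp: case_prod_unfold intro!: continuous_intros)
  moreover have "continuous_on K f" using holo holomorphic_on_imp_continuous_on holomorphic_on_subset by blast
  ultimately have "bounded (f ` K)" using compact_continuous_image compact_imp_bounded by blast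
  moreover have "range f \<subseteq> f ` K"
  proof safe
    fix z
    define b where "b = Im z / Im \<tau>"
    define a where "a = Re (z - b * \<tau>)"
    have z: "z = of_real a + of_real b * \<tau>"
      using assms(2) by (auto simp: complex_eq_iff a_def b_def)
    define w where "w = of_real (frac a) + of_real (frac b) * \<tau>"
    have "f z = f (w + of_int \<lfloor>b\<rfloor> * \<tau> + of_int \<lfloor>a\<rfloor> * 1)"
      by (rule arg_cong[of _ _ f]) (simp add: z w_def frac_def algebra_simps)
    also have "\<dots> = f w" using periodic_of_int[of f 1, OF p1] periodic_of_int[of f \<tau>, OF p2] by metis
    finally have "f z = f w" .
    moreover have "w \<in> K" unfolding K_def w_def
      by (rule image_eqI[of _ _ "(frac a, frac b)"]) (auto simp: frac_lt_1 less_imp_le)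
    ultimately show "f z \<in> f ` K" by blast
  qed
  ultimately have "bounded (range f)" using bounded_subset by blast
  thus ?thesis using Liouville_theorem[OF holo] by (auto simp: constant_on_def)
qed

lemma Im_inversion: "\<tau> \<noteq> 0 \<Longrightarrow> Im (-1 / \<tau>) = Im \<tau> / norm \<tau> ^ 2"
  by (simp add: Im_divide cmod_power2)

lemma Im_inversion_pos: "Im \<tau> > 0 \<Longrightarrow> Im (-1 / \<tau>) > 0"
  by (subst Im_inversion) (auto intro!: divide_pos_pos)

text \<open>The difference \<open>D\<close> is doubly periodic: under \<open>z + 1\<close> the jump
  of the first term by \<open>2 * pi * \<i> / \<tau>\<close> is absorbed by the linear term, and
  under \<open>z + \<tau>\<close> the jump of \<open>qzeta \<tau>\<close> is. The poles cancel,
  since \<open>1 / (z / \<tau>) / \<tau> = 1 / z\<close>. So \<open>D\<close> extends to a constant,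
  which is 0 because both regular parts vanish at 0.\<close>

lemma qzeta_reg_inversion:
  assumes "Im \<tau> > 0"
  shows "eventually (\<lambda>z. qzeta_reg (-1 / \<tau>) (z / \<tau>) / \<tau> = qzeta_reg \<tau> z + 2 * pi * \<i> * z / \<tau>) (nhds 0)"
proof -
  define \<tau>' where "\<tau>' = -1 / \<tau>"
  have [simp]: "\<tau> \<noteq> 0" using assms by auto
  have \<tau>': "Im \<tau>' > 0" using Im_inversion_pos assms by (simp add: \<tau>'_def)
  define D where "D = (\<lambda>z. qzeta \<tau>' (z / \<tau>) / \<tau> - qzeta \<tau> z - 2 * pi * \<i> * z / \<tau>)"
  \<comment> \<open>\<open>E\<close> is the candidate for the entire extension of \<open>D\<close>;
    near 0 it agrees with \<open>A\<close>, the same expression in the regular parts, so the value 0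
    removes the singularity.\<close>
  define E where "E = (\<lambda>z. if z \<in> lattice \<tau> then 0 else D z)"
  define A where "A = (\<lambda>z. qzeta_reg \<tau>' (z / \<tau>) / \<tau> - qzeta_reg \<tau> z - 2 * pi * \<i> * z / \<tau>)"
  have E1: "E (z + 1) = E z" for z
  proof (cases "z \<in> lattice \<tau>")
    case False
    hence F: "z + 1 \<notin> lattice \<tau>" using lattice_add_iff lattice_period by blast
    have "(z + 1) / \<tau> \<notin> lattice \<tau>'" unfolding \<tau>'_def using lattice_inversion F by simp
    hence "qzeta \<tau>' ((z + 1) / \<tau> + \<tau>') = qzeta \<tau>' ((z + 1) / \<tau>) - 2 * pi * \<i>"
      by (rule qzeta_add_tau[OF \<tau>'])
    moreover have "(z + 1) / \<tau> + \<tau>' = z / \<tau>" by (simp add: \<tau>'_def add_divide_distrib)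
    ultimately have "qzeta \<tau>' ((z + 1) / \<tau>) = qzeta \<tau>' (z / \<tau>) + 2 * pi * \<i>" by simp
    hence "D (z + 1) = D z" unfolding D_def qzeta_add_1 by (simp add: field_simps)
    thus ?thesis using False F by (simp add: E_def)
  qed (use lattice_add_iff lattice_period in \<open>simp add: E_def\<close>)
  have Et: "E (z + \<tau>) = E z" for z
  proof (cases "z \<in> lattice \<tau>")
    case False
    hence F: "z + \<tau> \<notin> lattice \<tau>" using lattice_add_iff lattice_period by blast
    have "(z + \<tau>) / \<tau> = z / \<tau> + 1" by (simp add: add_divide_distrib)
    hence "qzeta \<tau>' ((z + \<tau>) / \<tau>) = qzeta \<tau>' (z / \<tau>)" by (simp add: qzeta_add_1)
    hence "D (z + \<tau>) = D z" unfolding D_def qzeta_add_tau[OF assms False] by (simp add: field_simps)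
    thus ?thesis using False F by (simp add: E_def)
  qed (use lattice_add_iff lattice_period in \<open>simp add: E_def\<close>)
  have EA: "eventually (\<lambda>z. E z = A z) (nhds 0)"
  proof -
    have "eventually (\<lambda>z. \<bar>Im z\<bar> < Im \<tau> \<and> norm z < 1 \<and> \<bar>Im (z / \<tau>)\<bar> < Im \<tau>') (nhds 0)"
    proof (intro eventually_conj)
      have "open {z. \<bar>Im z\<bar> < Im \<tau>}" "open {z :: complex. norm z < 1}" "open {z. \<bar>Im (z / \<tau>)\<bar> < Im \<tau>'}"
        by (intro open_Collect_less continuous_intros; simp)+
      thus "eventually (\<lambda>z. \<bar>Im z\<bar> < Im \<tau>) (nhds 0)" "eventually (\<lambda>z::complex. norm z < 1) (nhds 0)"
         "eventually (\<lambda>z. \<bar>Im (z / \<tau>)\<bar> < Im \<tau>') (nhds 0)"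
        using assms \<tau>' by (auto simp: eventually_nhds)
    qed
    thus ?thesis
    proof eventually_elim
      case (elim z)
      show ?case
      proof (cases "z = 0")
        case False
        hence "z \<notin> lattice \<tau>" using lattice_near_0 assms elim by blast
        hence "E z = D z" by (simp add: E_def)
        moreover have e: "qzeta \<tau> z = 1 / z + qzeta_reg \<tau> z" "qzeta \<tau>' (z / \<tau>) = \<tau> / z + qzeta_reg \<tau>' (z / \<tau>)"
          using qzeta_eq_reg[of \<tau> z] qzeta_eq_reg[of \<tau>' "z / \<tau>"] elim assms \<tau>' False by auto
        have "D z = A z" unfolding D_def A_def e using False by (simp add: field_simps)
        ultimately show ?thesis by simp
      qed (simp add: E_def A_def lattice_period)
    qed
  qed
  have an: "qzeta_reg \<sigma> analytic_on {0}" if "Im \<sigma> > 0" for \<sigma>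
    using qzeta_reg_expansion[OF that] has_fps_expansion_imp_analytic_0 by metis
  have "(\<lambda>z. qzeta_reg \<tau>' (z / \<tau>)) analytic_on {0}"
    using analytic_on_compose[of "\<lambda>z. z / \<tau>" "{0}" "qzeta_reg \<tau>'"] an[OF \<tau>'] by (simp add: o_def analytic_on_divide)
  hence "A analytic_on {0}" unfolding A_def by (intro analytic_intros an assms) auto
  hence "A field_differentiable at 0" using analytic_on_imp_differentiable_at by blast
  then obtain A' where "(A has_field_derivative A') (at 0)" by (auto simp: field_differentiable_def)
  hence E0: "(E has_field_derivative A') (at 0)" using EA DERIV_cong_ev by blast
  have "E field_differentiable at z" for z
  proof (cases "z \<in> lattice \<tau>")
    case True
    then obtain m n where z: "z = of_int m + of_int n * \<tau>" by (auto simp: lattice_def)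
    \<comment> \<open>Periodicity carries differentiability from the origin to every other lattice
      point.\<close>
    have "E = (\<lambda>w. E (w - z))"
    proof
      fix w
      have "E w = E ((w - z) + of_int n * \<tau> + of_int m * 1)" by (simp add: z)
      also have "\<dots> = E (w - z)" using periodic_of_int[of E 1, OF E1] periodic_of_int[of E \<tau>, OF Et] by metis
      finally show "E w = E (w - z)" .
    qed
    moreover have "((\<lambda>w. E (w - z)) has_field_derivative A' * 1) (at z)"
      by (rule DERIV_chain2[where f = E]) (use E0 in \<open>auto intro!: derivative_eq_intros\<close>)
    ultimately show ?thesis by (auto simp: field_differentiable_def)
  next
    case False
    have o: "open (- lattice \<tau>)" using closed_lattice[OF assms] by auto
    have "(\<lambda>z. qzeta \<tau>' (z / \<tau>)) holomorphic_on (- lattice \<tau>)"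
      by (rule holomorphic_on_compose_gen[of "\<lambda>z. z / \<tau>", unfolded o_def, OF _ qzeta_holomorphic[OF \<tau>']])
         (use lattice_inversion[OF \<open>\<tau> \<noteq> 0\<close>] in \<open>auto simp: \<tau>'_def intro!: holomorphic_intros\<close>)
    hence "D holomorphic_on (- lattice \<tau>)" unfolding D_def
      by (intro holomorphic_intros qzeta_holomorphic assms) auto
    hence "E holomorphic_on (- lattice \<tau>)" by (rule holomorphic_transform) (auto simp: E_def)
    thus ?thesis using o False by (auto simp: holomorphic_on_open field_differentiable_def)
  qed
  hence "E holomorphic_on UNIV" by (simp add: holomorphic_on_def)
  hence "E constant_on UNIV" by (rule doubly_periodic_entire_constant[OF _ assms E1 Et])
  hence "E z = E 0" for z by (auto simp: constant_on_def)
  hence "E z = 0" for z by (simp add: E_def lattice_period)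
  with EA have "eventually (\<lambda>z. A z = 0) (nhds 0)" by (auto elim!: eventually_mono)
  thus ?thesis by eventually_elim (auto simp: A_def \<tau>'_def algebra_simps)
qed

lemma eisenstein_inversion:
  assumes "Im \<tau> > 0"
  shows eisenstein_E2_inversion: "eisenstein_E2 (-1 / \<tau>) = \<tau> ^ 2 * eisenstein_E2 \<tau> - 6 * \<i> * \<tau> / pi"
    and eisenstein_E4_inversion: "eisenstein_E4 (-1 / \<tau>) = \<tau> ^ 4 * eisenstein_E4 \<tau>"
proof -
  have [simp]: "\<tau> \<noteq> 0" using assms by auto
  obtain R where R: "qzeta_reg \<tau> has_fps_expansion R"
    "fps_nth R 1 = - (pi ^ 2 / 3) * eisenstein_E2 \<tau>"
    "fps_nth R 3 = - (pi ^ 4 / 45) * eisenstein_E4 \<tau>" using qzeta_reg_expansion[OF assms] .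
  obtain R' where R': "qzeta_reg (-1/\<tau>) has_fps_expansion R'"
    "fps_nth R' 1 = - (pi ^ 2 / 3) * eisenstein_E2 (-1/\<tau>)"
    "fps_nth R' 3 = - (pi ^ 4 / 45) * eisenstein_E4 (-1/\<tau>)" using qzeta_reg_expansion[OF Im_inversion_pos[OF assms]] .
  have "(\<lambda>z. (1 / \<tau>) * z) has_fps_expansion (fps_const (1 / \<tau>) * fps_X)"
    by (intro fps_expansion_intros)
  from has_fps_expansion_compose[OF R'(1) this]
  have "(\<lambda>z. qzeta_reg (-1/\<tau>) (z / \<tau>)) has_fps_expansion Abs_fps (\<lambda>n. (1 / \<tau>) ^ n * fps_nth R' n)"
    by (simp add: o_def fps_compose_linear)
  from has_fps_expansion_cmult_right[OF this, of "1 / \<tau>"]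
  have L: "(\<lambda>z. qzeta_reg (-1/\<tau>) (z / \<tau>) / \<tau>) has_fps_expansion (Abs_fps (\<lambda>n. (1 / \<tau>) ^ n * fps_nth R' n) * fps_const (1 / \<tau>))"
    by simp
  have "(\<lambda>z. qzeta_reg \<tau> z + (2 * pi * \<i> / \<tau>) * z) has_fps_expansion (R + fps_const (2 * pi * \<i> / \<tau>) * fps_X)"
    by (intro fps_expansion_intros R)
  hence "(\<lambda>z. qzeta_reg \<tau> z + 2 * pi * \<i> * z / \<tau>) has_fps_expansion (R + fps_const (2 * pi * \<i> / \<tau>) * fps_X)"
    by simp
  hence "(\<lambda>z. qzeta_reg (-1/\<tau>) (z / \<tau>) / \<tau>) has_fps_expansion (R + fps_const (2 * pi * \<i> / \<tau>) * fps_X)"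
    by (rule has_fps_expansion_cong[THEN iffD2, OF qzeta_reg_inversion[OF assms] refl])
  from fps_expansion_unique_complex[OF L this]
  have eq: "Abs_fps (\<lambda>n. (1 / \<tau>) ^ n * fps_nth R' n) * fps_const (1 / \<tau>) = R + fps_const (2 * pi * \<i> / \<tau>) * fps_X" .
  have 1: "(1 / \<tau>) * fps_nth R' 1 * (1 / \<tau>) = fps_nth R 1 + 2 * pi * \<i> / \<tau>"
    using arg_cong[OF eq, of "\<lambda>f. fps_nth f 1"] by simp
  have 3: "(1 / \<tau>) ^ 3 * fps_nth R' 3 * (1 / \<tau>) = fps_nth R 3"
    using arg_cong[OF eq, of "\<lambda>f. fps_nth f 3"] by simp
  have "fps_nth R' 1 = \<tau> ^ 2 * fps_nth R 1 + 2 * pi * \<i> * \<tau>"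
    using 1 by (simp add: field_simps power2_eq_square)
  moreover have "eisenstein_E2 (-1 / \<tau>) = - (3 / pi ^ 2) * fps_nth R' 1" unfolding R' by simp
  ultimately have "eisenstein_E2 (-1 / \<tau>) = - (3 / pi ^ 2) * (\<tau> ^ 2 * fps_nth R 1 + 2 * pi * \<i> * \<tau>)" by simp
  also have "\<dots> = \<tau> ^ 2 * eisenstein_E2 \<tau> - 6 * \<i> * \<tau> / pi"
    unfolding R by (simp add: field_simps power2_eq_square)
  finally show "eisenstein_E2 (-1 / \<tau>) = \<tau> ^ 2 * eisenstein_E2 \<tau> - 6 * \<i> * \<tau> / pi" .
  have "fps_nth R' 3 = \<tau> ^ 4 * fps_nth R 3"
    using 3 by (simp add: field_simps eval_nat_numeral)
  thus "eisenstein_E4 (-1 / \<tau>) = \<tau> ^ 4 * eisenstein_E4 \<tau>"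
    unfolding R R' by (simp add: field_simps)
qed

section \<open>Modular functions on the upper half-plane\<close>


text \<open>If \<open>\<bar>Re \<tau>\<bar> \<le> 1/2\<close> and \<open>Im \<tau> < 1/2\<close>, then inversion at least doubles the imaginary part,
  so finitely many steps suffice.\<close>

lemma modular_reduction:
  assumes T: "\<And>\<tau>. Im \<tau> > 0 \<Longrightarrow> P (\<tau> + 1) \<longleftrightarrow> P \<tau>"
    and S: "\<And>\<tau>. Im \<tau> > 0 \<Longrightarrow> P (-1 / \<tau>) \<Longrightarrow> P \<tau>"
    and base: "\<And>\<tau>. \<bar>Re \<tau>\<bar> \<le> 1 / 2 \<Longrightarrow> Im \<tau> \<ge> 1 / 2 \<Longrightarrow> P \<tau>"
    and "Im \<tau> > 0"
  shows "P \<tau>"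
proof -
  have Tn: "P (\<tau> + of_nat n) \<longleftrightarrow> P \<tau>" if "Im \<tau> > 0" for \<tau> n
  proof (induction n)
    case (Suc n)
    have "P (\<tau> + of_nat (Suc n)) \<longleftrightarrow> P ((\<tau> + of_nat n) + 1)" by (simp add: algebra_simps)
    also have "\<dots> \<longleftrightarrow> P \<tau>" using T[of "\<tau> + of_nat n"] Suc.IH that by simp
    finally show ?case .
  qed auto
  have Tm: "P (\<tau> + of_int m) \<longleftrightarrow> P \<tau>" if "Im \<tau> > 0" for \<tau> m
  proof (cases "m \<ge> 0")
    case True
    thus ?thesis using Tn[OF that, of "nat m"] by simp
  next
    case False
    thus ?thesis using Tn[of "\<tau> + of_int m" "nat (- m)"] that by simp
  qed
  have main: "P \<tau>" if "Im \<tau> > 0" "Im \<tau> \<ge> 1 / 2 ^ k" for k \<tau>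
    using that
  proof (induction k arbitrary: \<tau>)
    case (0 \<tau>)
    let ?t = "\<tau> + of_int (- round (Re \<tau>))"
    have "P ?t" by (rule base) (use 0 of_int_round_abs_le[of "Re \<tau>"] in \<open>auto simp: abs_minus_commute\<close>)
    thus ?case using Tm 0 by blast
  next
    case (Suc k \<tau>)
    let ?t = "\<tau> + of_int (- round (Re \<tau>))"
    have re: "\<bar>Re ?t\<bar> \<le> 1 / 2" using of_int_round_abs_le[of "Re \<tau>"] by (auto simp: abs_minus_commute)
    have im: "Im ?t = Im \<tau>" by simp
    have "P ?t"
    proof (cases "Im \<tau> \<ge> 1 / 2")
      case True
      thus ?thesis using base re im by metis
    next
      case False
      have "Re ?t ^ 2 \<le> (1 / 2) ^ 2" using re by (metis abs_le_square_iff abs_of_nonneg zero_le_divide_1_iff zero_le_numeral)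
      moreover have "Im ?t ^ 2 \<le> (1 / 2) ^ 2" using False Suc.prems im by (intro power_mono) auto
      ultimately have n: "norm ?t ^ 2 \<le> 1 / 2" unfolding cmod_power2 by (simp add: power2_eq_square)
      have nz: "?t \<noteq> 0" using Suc.prems(1) im by (metis less_irrefl zero_complex.sel(2))
      hence np: "norm ?t ^ 2 > 0" by simp
      have e: "Im (-1 / ?t) = Im \<tau> / norm ?t ^ 2" using Im_inversion[OF nz] im by simp
      have "Im \<tau> / norm ?t ^ 2 \<ge> Im \<tau> / (1 / 2)" using n np Suc.prems by (intro divide_left_mono) auto
      hence "Im (-1 / ?t) \<ge> 1 / 2 ^ k" unfolding e using Suc.prems(2) by simp
      moreover have "Im (-1 / ?t) > 0" using Im_inversion_pos Suc.prems im by metis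
      ultimately have "P (-1 / ?t)" by (intro Suc.IH)
      thus ?thesis using S Suc.prems im by metis
    qed
    thus ?case using Tm Suc.prems by blast
  qed
  obtain k where "(1 / 2) ^ k < Im \<tau>" using real_arch_pow_inv[of "Im \<tau>" "1/2"] assms(4) by auto
  thus ?thesis using main[of \<tau> k] assms(4) by (simp add: power_one_over less_imp_le)
qed

text \<open>The neighbourhoods of infinity in the upper half-plane are the half-planes of large
  imaginary part, so limits along this filter are uniform in the real part.\<close>

definition cusp :: "complex filter" where
  "cusp = filtercomap Im at_top"

lemma eventually_cusp: "eventually P cusp \<longleftrightarrow> (\<exists>M. \<forall>\<tau>. Im \<tau> > M \<longrightarrow> P \<tau>)"
  unfolding cusp_def eventually_filtercomap_at_top_dense by simp

lemma upper_half_plane_simps: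
  "\<tau> \<in> upper_half_plane \<longleftrightarrow> Im \<tau> > 0" "open upper_half_plane" "connected upper_half_plane" "convex upper_half_plane"
proof -
  have "convex upper_half_plane" unfolding upper_half_plane_def by (rule convex_halfspace_Im_gt)
  moreover have "open upper_half_plane" unfolding upper_half_plane_def by (rule open_halfspace_Im_gt)
  ultimately show "\<tau> \<in> upper_half_plane \<longleftrightarrow> Im \<tau> > 0" "open upper_half_plane" "connected upper_half_plane" "convex upper_half_plane"
    by (auto simp: upper_half_plane_def convex_connected)
qed

text \<open>If \<open>F \<tau>\<close> were nonzero, \<open>norm F\<close> would attain its maximum
  over the half-plane on a compact part \<open>K\<close> of a vertical strip, since higher up it is
  smaller than \<open>norm (F \<tau>)\<close>. The maximum modulus principle makes \<open>F\<close>
  constant, contradicting the strict decrease towards the cusp.\<close>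

lemma modular_function_vanishing_at_cusp:
  assumes holo: "F holomorphic_on upper_half_plane"
    and T: "\<And>\<tau>. Im \<tau> > 0 \<Longrightarrow> F (\<tau> + 1) = F \<tau>"
    and S: "\<And>\<tau>. Im \<tau> > 0 \<Longrightarrow> F (-1 / \<tau>) = F \<tau>"
    and lim: "(F \<longlongrightarrow> 0) cusp" and "Im \<tau> > 0"
  shows "F \<tau> = 0"
proof (rule ccontr)
  assume nz: "F \<tau> \<noteq> 0"
  have "eventually (\<lambda>z. norm (F z) < norm (F \<tau>)) cusp"
    using lim nz by (intro order_tendstoD[OF tendsto_norm_zero]) auto
  then obtain M where M: "\<And>z. Im z > M \<Longrightarrow> norm (F z) < norm (F \<tau>)" by (auto simp: eventually_cusp)
  \<comment> \<open>Taking the maximum with 1/2 ensures that the box \<open>K\<close> is not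
    empty.\<close>
  define M' where "M' = max M (1/2)"
  define K where "K = cbox (Complex (-1/2) (1/2)) (Complex (1/2) M')"
  have K_iff: "z \<in> K \<longleftrightarrow> \<bar>Re z\<bar> \<le> 1/2 \<and> 1/2 \<le> Im z \<and> Im z \<le> M'" for z
    by (auto simp: K_def in_cbox_complex_iff)
  have Ksub: "K \<subseteq> upper_half_plane" by (auto simp: K_iff upper_half_plane_simps)
  have "compact K" by (simp add: K_def)
  moreover have "continuous_on K (\<lambda>z. norm (F z))"
    using holo Ksub holomorphic_on_imp_continuous_on continuous_on_subset continuous_on_norm by blast
  moreover have "K \<noteq> {}"
  proof -
    have "Complex 0 (1/2) \<in> K" by (simp add: K_iff M'_def)
    thus ?thesis by blast
  qed
  ultimately obtain \<xi> where \<xi>: "\<xi> \<in> K" "\<And>z. z \<in> K \<Longrightarrow> norm (F z) \<le> norm (F \<xi>)"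
    using continuous_attains_sup by metis
  \<comment> \<open>This disjunction is invariant under both generators, so it suffices to check it
    in the strip. Applied to \<open>\<tau>\<close> itself it gives
    \<open>norm (F \<tau>) \<le> norm (F \<xi>)\<close>, which turns the first alternative into the
    second.\<close>
  have bd: "norm (F z) < norm (F \<tau>) \<or> norm (F z) \<le> norm (F \<xi>)" if "Im z > 0" for z
    using _ _ _ that
  proof (rule modular_reduction)
    fix z assume z: "\<bar>Re z\<bar> \<le> 1/2" "Im z \<ge> 1/2"
    show "norm (F z) < norm (F \<tau>) \<or> norm (F z) \<le> norm (F \<xi>)"
    proof (cases "z \<in> K")
      case False
      hence "Im z > M" using z by (auto simp: K_iff M'_def)
      thus ?thesis using M by blast
    qed (use \<xi>(2) in blast)
  qed (use T S in auto)
  have bd': "norm (F z) \<le> norm (F \<xi>)" if "Im z > 0" for z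
    using bd[OF that] bd[OF assms(5)] by linarith
  have "F constant_on upper_half_plane"
    by (rule maximum_modulus_principle[OF holo _ _ _ order_refl, of \<xi>])
       (use bd' \<xi>(1) Ksub in \<open>auto simp: upper_half_plane_simps\<close>)
  then obtain c where c: "\<And>z. Im z > 0 \<Longrightarrow> F z = c" by (auto simp: constant_on_def upper_half_plane_simps)
  define z where "z = Complex 0 (max M 0 + 1)"
  have "Im z > M" "Im z > 0" by (auto simp: z_def)
  hence "norm c < norm c" using M[of z] c[of z] c[of \<tau>] assms(5) by simp
  thus False by simp
qed

lemma qpar_tendsto_0: "filterlim qpar (at 0) cusp"
  unfolding filterlim_at
proof
  have "filterlim (\<lambda>\<tau>. - 2 * pi * Im \<tau>) at_bot cusp"
    unfolding cusp_def by (intro filterlim_tendsto_neg_mult_at_bot[where c = "- 2 * pi"] filterlim_filtercomap tendsto_const) auto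
  hence "((\<lambda>\<tau>. norm (qpar \<tau>)) \<longlongrightarrow> 0) cusp"
    unfolding norm_qpar by (rule filterlim_compose[OF exp_at_bot])
  thus "(qpar \<longlongrightarrow> 0) cusp" by (rule tendsto_norm_zero_cancel)
qed auto

section \<open>The Euler product as a holomorphic function of the nome\<close>

definition euler_phi_prod :: "complex \<Rightarrow> complex" where
  "euler_phi_prod x = (\<Prod>m. 1 - x ^ Suc m)"

lemma convergent_euler_phi_prod:
  assumes "norm x < 1"
  shows "convergent_prod (\<lambda>m. 1 - x ^ Suc m :: complex)"
proof -
  have "summable (\<lambda>m. norm x ^ Suc m)" using assms by (subst summable_Suc_iff) (simp add: summable_geometric)
  hence "abs_convergent_prod (\<lambda>m. 1 + - (x ^ Suc m))"
    by (intro summable_imp_abs_convergent_prod) (simp add: norm_power norm_mult)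
  thus ?thesis by (simp add: abs_convergent_prod_imp_convergent_prod)
qed

lemma euler_phi_prod_nonzero:
  assumes "norm x < 1"
  shows "euler_phi_prod x \<noteq> 0"
  unfolding euler_phi_prod_def
proof (rule prodinf_nonzero[OF convergent_euler_phi_prod[OF assms]])
  fix m
  have "norm (x ^ Suc m) < 1" unfolding norm_power by (subst power_less_one_iff) (use assms in auto)
  thus "1 - x ^ Suc m \<noteq> 0" by (metis eq_iff_diff_eq_0 less_irrefl norm_one)
qed

lemma uniform_limit_euler_phi_prod:
  assumes "0 \<le> r" "r < 1"
  shows "uniform_limit (cball 0 r) (\<lambda>n x. \<Prod>m<n. 1 - x ^ Suc m) euler_phi_prod sequentially"
proof -
  have "uniformly_convergent_on (cball 0 r) (\<lambda>N x. \<Prod>m<N. 1 - x ^ Suc m :: complex)"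
  proof (rule uniformly_convergent_on_prod')
    show "uniformly_convergent_on (cball 0 r) (\<lambda>N x. \<Sum>n<N. norm (1 - x ^ Suc n - 1 :: complex))"
    proof (rule Weierstrass_m_test')
      fix n :: nat and x :: complex assume "x \<in> cball 0 r"
      thus "norm (norm (1 - x ^ Suc n - 1 :: complex)) \<le> r ^ Suc n"
        using power_mono[of "norm x" r "Suc n"] by (simp add: norm_power norm_mult)
    next
      show "summable (\<lambda>n. r ^ Suc n)" using assms by (subst summable_Suc_iff) (simp add: summable_geometric)
    qed
  qed (auto intro!: continuous_intros)
  then obtain l where l: "uniform_limit (cball 0 r) (\<lambda>N x. \<Prod>m<N. 1 - x ^ Suc m) (l :: complex \<Rightarrow> complex) sequentially"
    unfolding uniformly_convergent_on_def by blast
  have "l x = euler_phi_prod x" if x: "x \<in> cball 0 r" for x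
  proof -
    have "(\<lambda>N. \<Prod>m<N. 1 - x ^ Suc m) \<longlonglongrightarrow> l x" using l x by (rule tendsto_uniform_limitI)
    moreover have "(\<lambda>N. \<Prod>m\<le>N. 1 - x ^ Suc m) \<longlonglongrightarrow> euler_phi_prod x"
      unfolding euler_phi_prod_def by (rule convergent_prod_LIMSEQ, rule convergent_euler_phi_prod) (use x assms in auto)
    hence "(\<lambda>N. \<Prod>m<N. 1 - x ^ Suc m) \<longlonglongrightarrow> euler_phi_prod x"
      unfolding lessThan_Suc_atMost[symmetric] by (rule LIMSEQ_imp_Suc)
    ultimately show ?thesis using LIMSEQ_unique by blast
  qed
  hence "uniform_limit (cball 0 r) (\<lambda>N x. \<Prod>m<N. 1 - x ^ Suc m) l sequentially
     \<longleftrightarrow> uniform_limit (cball 0 r) (\<lambda>N x. \<Prod>m<N. 1 - x ^ Suc m) euler_phi_prod sequentially"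
    by (intro uniform_limit_cong' refl)
  with l show ?thesis by blast
qed

text \<open>Termwise logarithmic differentiation, allowed by locally uniform convergence, turns the
  product into minus the Lambert series with index 1. This is the link between \<open>\<eta>\<close>
  and \<open>eisenstein_E2\<close>.\<close>

lemma euler_phi_prod_derivative:
  assumes "norm x < 1"
  obtains D where "(euler_phi_prod has_field_derivative D) (at x)"
    "x * D = - lambert 1 x x * euler_phi_prod x"
proof -
  obtain r where r: "norm x < r" "r < 1" using assms dense by blast
  have "0 \<le> r" using r(1) norm_ge_zero[of x] by linarith
  have lim: "uniform_limit (ball 0 r) (\<lambda>n x. \<Prod>m<n. 1 - x ^ Suc m) euler_phi_prod sequentially"
    by (rule uniform_limit_on_subset[OF uniform_limit_euler_phi_prod[OF \<open>0 \<le> r\<close> r(2)]]) auto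
  have "euler_phi_prod holomorphic_on ball 0 r"
  proof (rule holomorphic_uniform_sequence)
    fix z assume "z \<in> ball (0::complex) r"
    then obtain d where "d > 0" "cball z d \<subseteq> ball 0 r" using open_contains_cball open_ball by blast
    thus "\<exists>d>0. cball z d \<subseteq> ball 0 r \<and> uniform_limit (cball z d) (\<lambda>n x. \<Prod>m<n. 1 - x ^ Suc m) euler_phi_prod sequentially"
      using uniform_limit_on_subset[OF lim] by blast
  qed (auto intro!: holomorphic_intros)
  hence d: "(euler_phi_prod has_field_derivative deriv euler_phi_prod x) (at x)"
    using r by (intro holomorphic_derivI[of _ "ball 0 r"]) auto
  have "(\<lambda>k. deriv (\<lambda>x. 1 - x ^ Suc k) x / (1 - x ^ Suc k)) sums (deriv euler_phi_prod x / euler_phi_prod x)"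
    by (rule logderiv_prodinf_complex_uniform_limit[OF lim])
       (use r euler_phi_prod_nonzero[OF assms] in \<open>auto intro!: holomorphic_intros\<close>)
  moreover have "deriv (\<lambda>x. 1 - x ^ Suc k) x = - (of_nat (Suc k) * x ^ k)" for k
    by (rule DERIV_imp_deriv) (rule derivative_eq_intros refl | simp)+
  ultimately have "(\<lambda>k. - (of_nat (Suc k) * x ^ k) / (1 - x ^ Suc k)) sums (deriv euler_phi_prod x / euler_phi_prod x)"
    by simp
  from sums_mult[OF this, of x]
  have "(\<lambda>k. - (of_nat (Suc k) ^ 1 / (1 - x ^ Suc k) * x ^ Suc k)) sums (x * (deriv euler_phi_prod x / euler_phi_prod x))"
    by (simp add: mult_ac)
  from sums_minus[OF this]
  have "(\<lambda>k. (of_nat (Suc k) ^ 1 / (1 - x ^ Suc k) * x ^ Suc k)) sums - (x * (deriv euler_phi_prod x / euler_phi_prod x))"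
    by simp
  hence "(\<lambda>k. (of_nat k ^ 1 / (1 - x ^ k) * x ^ k)) sums - (x * (deriv euler_phi_prod x / euler_phi_prod x))"
    by (subst (asm) sums_Suc_iff) simp
  hence "lambert 1 x x = - (x * (deriv euler_phi_prod x / euler_phi_prod x))"
    unfolding lambert_def by (rule sums_unique[symmetric])
  hence "x * deriv euler_phi_prod x = - lambert 1 x x * euler_phi_prod x"
    using euler_phi_prod_nonzero[OF assms] by (simp add: field_simps)
  thus ?thesis using that d by blast
qed

section \<open>The eta function, the discriminant and the Eisenstein series\<close>


lemma dedekind_eta_eq: "dedekind_eta \<tau> = exp (2 * pi * \<i> * \<tau> / 24) * euler_phi_prod (qpar \<tau>)"
  by (simp add: dedekind_eta_def euler_phi_prod_def)

lemma dedekind_eta_nonzero: "Im \<tau> > 0 \<Longrightarrow> dedekind_eta \<tau> \<noteq> 0"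
  by (simp add: dedekind_eta_eq euler_phi_prod_nonzero)

lemma dedekind_eta_has_derivative:
  assumes "Im \<tau> > 0"
  shows "(dedekind_eta has_field_derivative (2 * pi * \<i> / 24 * eisenstein_E2 \<tau> * dedekind_eta \<tau>)) (at \<tau>)"
proof -
  obtain D where D: "(euler_phi_prod has_field_derivative D) (at (qpar \<tau>))"
    "qpar \<tau> * D = - lambert 1 (qpar \<tau>) (qpar \<tau>) * euler_phi_prod (qpar \<tau>)"
    using euler_phi_prod_derivative[of "qpar \<tau>"] assms by auto
  have q: "(qpar has_field_derivative (2 * pi * \<i> * qpar \<tau>)) (at \<tau>)"
    by (rule derivative_eq_intros refl | simp)+
  have e: "((\<lambda>\<tau>. exp (2 * pi * \<i> * \<tau> / 24)) has_field_derivative (2 * pi * \<i> / 24 * exp (2 * pi * \<i> * \<tau> / 24))) (at \<tau>)"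
    by (rule derivative_eq_intros refl | simp)+
  have "(dedekind_eta has_field_derivative
     (2 * pi * \<i> / 24 * exp (2 * pi * \<i> * \<tau> / 24) * euler_phi_prod (qpar \<tau>)
      + D * (2 * pi * \<i> * qpar \<tau>) * exp (2 * pi * \<i> * \<tau> / 24))) (at \<tau>)"
    unfolding dedekind_eta_eq[abs_def] by (rule DERIV_mult[OF e DERIV_chain2[OF D(1) q]])
  also have "D * (2 * pi * \<i> * qpar \<tau>) = 2 * pi * \<i> * (qpar \<tau> * D)" by simp
  also have "2 * pi * \<i> / 24 * exp (2 * pi * \<i> * \<tau> / 24) * euler_phi_prod (qpar \<tau>) 
       + 2 * pi * \<i> * (qpar \<tau> * D) * exp (2 * pi * \<i> * \<tau> / 24) =
     2 * pi * \<i> / 24 * eisenstein_E2 \<tau> * dedekind_eta \<tau>"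
    unfolding D(2) dedekind_eta_eq eisenstein_E2_def by (simp add: algebra_simps)
  finally show ?thesis .
qed

lemma dedekind_eta_holomorphic: "dedekind_eta holomorphic_on upper_half_plane"
  by (auto simp: holomorphic_on_open upper_half_plane_simps intro!: exI dedekind_eta_has_derivative)

lemma dedekind_eta_add_1: "dedekind_eta (\<tau> + 1) = exp (2 * pi * \<i> / 24) * dedekind_eta \<tau>"
  by (simp add: dedekind_eta_eq qpar_add ring_distribs add_divide_distrib exp_add)

lemma has_field_derivative_inversion:
  assumes "Im \<tau> > 0" "(f has_field_derivative f') (at (-1 / \<tau>))"
  shows "((\<lambda>\<tau>. f (-1 / \<tau>)) has_field_derivative f' / \<tau> ^ 2) (at \<tau>)"
proof -
  have "\<tau> \<noteq> 0" using assms by auto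
  hence "((\<lambda>\<tau>. -1 / \<tau>) has_field_derivative 1 / \<tau> ^ 2) (at \<tau>)"
    by (auto intro!: derivative_eq_intros simp: power2_eq_square)
  from DERIV_chain2[OF assms(2) this] show ?thesis by simp
qed

text \<open>In the derivative of the quotient \<open>F\<close> the non-modular term of
  \<open>eisenstein_E2 (-1 / \<tau>)\<close> cancels the contribution of \<open>\<tau> ^ 2\<close>,
  so \<open>F\<close> is constant. Working with the fourth power avoids the square root in the law
  of \<open>\<eta>\<close> itself.\<close>

lemma dedekind_eta_pow4_inversion:
  assumes "Im \<tau> > 0"
  shows "dedekind_eta (-1 / \<tau>) ^ 4 = - (\<tau> ^ 2) * dedekind_eta \<tau> ^ 4"
proof -
  define F where "F = (\<lambda>\<tau>. dedekind_eta (-1 / \<tau>) ^ 4 / (\<tau> ^ 2 * dedekind_eta \<tau> ^ 4))"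
  have "\<exists>c. \<forall>\<tau>\<in>upper_half_plane. F \<tau> = c"
  proof (rule has_field_derivative_zero_constant)
    fix \<tau> assume "\<tau> \<in> upper_half_plane"
    hence \<tau>: "Im \<tau> > 0" by (simp add: upper_half_plane_simps)
    hence nz: "\<tau> \<noteq> 0" by auto
    define c :: complex where "c = 2 * pi * \<i> / 24"
    define v where "v = dedekind_eta \<tau>"
    define u where "u = dedekind_eta (-1 / \<tau>)"
    define E where "E = eisenstein_E2 \<tau>"
    define E' where "E' = eisenstein_E2 (-1 / \<tau>)"
    have v: "v \<noteq> 0" using dedekind_eta_nonzero \<tau> by (simp add: v_def)
    have d1: "(dedekind_eta has_field_derivative (c * E * v)) (at \<tau>)"
      unfolding c_def E_def v_def by (rule dedekind_eta_has_derivative[OF \<tau>])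
    have d2: "((\<lambda>\<tau>. dedekind_eta (-1 / \<tau>)) has_field_derivative (c * E' * u) / \<tau> ^ 2) (at \<tau>)"
      unfolding c_def E'_def u_def
      by (rule has_field_derivative_inversion[OF \<tau> dedekind_eta_has_derivative[OF Im_inversion_pos[OF \<tau>]]])
    have n4: "((\<lambda>\<tau>. dedekind_eta (-1 / \<tau>) ^ 4) has_field_derivative (4 * u ^ 3 * ((c * E' * u) / \<tau> ^ 2))) (at \<tau>)"
      using DERIV_power[OF d2, of 4] by (simp add: u_def mult_ac)
    have v4: "((\<lambda>\<tau>. dedekind_eta \<tau> ^ 4) has_field_derivative (4 * v ^ 3 * (c * E * v))) (at \<tau>)"
      using DERIV_power[OF d1, of 4] by (simp add: v_def mult_ac)
    have t2: "((\<lambda>\<tau>. \<tau> ^ 2) has_field_derivative 2 * \<tau>) (at \<tau>)"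
      by (auto intro!: derivative_eq_intros)
    have dn: "((\<lambda>\<tau>. \<tau> ^ 2 * dedekind_eta \<tau> ^ 4) has_field_derivative (2 * \<tau> * v ^ 4 + 4 * v ^ 3 * (c * E * v) * \<tau> ^ 2)) (at \<tau>)"
      using DERIV_mult[OF t2 v4] by (simp add: v_def)
    have "(F has_field_derivative ((4 * u ^ 3 * ((c * E' * u) / \<tau> ^ 2)) * (\<tau> ^ 2 * v ^ 4)
        - u ^ 4 * (2 * \<tau> * v ^ 4 + 4 * v ^ 3 * (c * E * v) * \<tau> ^ 2)) / ((\<tau> ^ 2 * v ^ 4) * (\<tau> ^ 2 * v ^ 4))) (at \<tau>)"
      using DERIV_divide[OF n4 dn] nz v by (simp add: F_def u_def v_def)
    also have "(4 * u ^ 3 * ((c * E' * u) / \<tau> ^ 2)) * (\<tau> ^ 2 * v ^ 4)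
        - u ^ 4 * (2 * \<tau> * v ^ 4 + 4 * v ^ 3 * (c * E * v) * \<tau> ^ 2)
        = u ^ 4 * v ^ 4 * (4 * c * (E' - \<tau> ^ 2 * E) - 2 * \<tau>)"
      using nz by (simp add: field_simps eval_nat_numeral)
    also have "E' = \<tau> ^ 2 * E - 6 * \<i> * \<tau> / pi"
      unfolding E'_def E_def by (rule eisenstein_E2_inversion[OF \<tau>])
    also have "4 * c * (\<tau> ^ 2 * E - 6 * \<i> * \<tau> / pi - \<tau> ^ 2 * E) - 2 * \<tau> = 0"
      by (simp add: c_def)
    finally show "(F has_field_derivative 0) (at \<tau> within upper_half_plane)"
      by (simp add: has_field_derivative_at_within)
  qed (simp add: upper_half_plane_simps)
  then obtain c where c: "\<And>\<tau>. Im \<tau> > 0 \<Longrightarrow> F \<tau> = c" by (auto simp: upper_half_plane_simps)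
  \<comment> \<open>Inversion fixes \<open>\<i>\<close>, so the eta values cancel and
    \<open>1 / \<i> ^ 2\<close> remains.\<close>
  have "F \<i> = -1" using dedekind_eta_nonzero[of \<i>] by (simp add: F_def)
  hence "F \<tau> = -1" using c[of \<i>] c[OF assms] by simp
  moreover have "\<tau> \<noteq> 0" using assms by auto
  ultimately show ?thesis using dedekind_eta_nonzero[OF assms] by (simp add: F_def divide_eq_eq)
qed

lemma modular_Delta_inversion:
  assumes "Im \<tau> > 0" shows "modular_Delta (-1 / \<tau>) = \<tau> ^ 12 * modular_Delta \<tau>"
proof -
  have "modular_Delta (-1 / \<tau>) = (dedekind_eta (-1 / \<tau>) ^ 4) ^ 6"
    by (simp only: modular_Delta_def power_mult[symmetric]) simp
  also have "\<dots> = \<tau> ^ 12 * modular_Delta \<tau>"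
    unfolding dedekind_eta_pow4_inversion[OF assms] modular_Delta_def
    by (simp only: power_mult_distrib power_mult[symmetric] power_minus_even) simp
  finally show ?thesis .
qed

lemma modular_Delta_add_1: "modular_Delta (\<tau> + 1) = modular_Delta \<tau>"
proof -
  have "exp (2 * pi * \<i> / 24) ^ 24 = exp (of_nat 24 * (2 * pi * \<i> / 24) :: complex)"
    by (rule exp_of_nat_mult[symmetric])
  also have "of_nat 24 * (2 * pi * \<i> / 24) = 2 * pi * \<i> * 1" by simp
  also have "exp (2 * pi * \<i> * 1) = 1" using qpar_1 by (simp only: qpar_def)
  finally show ?thesis by (simp add: modular_Delta_def dedekind_eta_add_1 power_mult_distrib)
qed

lemma modular_Delta_nonzero: "Im \<tau> > 0 \<Longrightarrow> modular_Delta \<tau> \<noteq> 0"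
  by (simp add: modular_Delta_def dedekind_eta_nonzero)

lemma modular_Delta_eq: "modular_Delta \<tau> = qpar \<tau> * euler_phi_prod (qpar \<tau>) ^ 24"
proof -
  have "exp (2 * pi * \<i> * \<tau> / 24) ^ 24 = exp (of_nat 24 * (2 * pi * \<i> * \<tau> / 24))"
    by (rule exp_of_nat_mult[symmetric])
  also have "of_nat 24 * (2 * pi * \<i> * \<tau> / 24) = 2 * pi * \<i> * \<tau>" by simp
  also have "exp (2 * pi * \<i> * \<tau>) = qpar \<tau>" by (simp only: qpar_def)
  finally show ?thesis by (simp add: modular_Delta_def dedekind_eta_eq power_mult_distrib)
qed

lemma modular_Delta_holomorphic: "modular_Delta holomorphic_on upper_half_plane"
  unfolding modular_Delta_def by (intro holomorphic_intros dedekind_eta_holomorphic)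

lemma modular_Delta_has_derivative:
  assumes "Im \<tau> > 0"
  shows "(modular_Delta has_field_derivative (2 * pi * \<i> * eisenstein_E2 \<tau> * modular_Delta \<tau>)) (at \<tau>)"
proof -
  have "(modular_Delta has_field_derivative (24 * dedekind_eta \<tau> ^ 23 * (2 * pi * \<i> / 24 * eisenstein_E2 \<tau> * dedekind_eta \<tau>))) (at \<tau>)"
    unfolding modular_Delta_def
    using DERIV_power[OF dedekind_eta_has_derivative[OF assms], of 24] by (simp add: mult_ac)
  also have "24 * dedekind_eta \<tau> ^ 23 * (2 * pi * \<i> / 24 * eisenstein_E2 \<tau> * dedekind_eta \<tau>) = 
      2 * pi * \<i> * eisenstein_E2 \<tau> * (dedekind_eta \<tau> ^ 23 * dedekind_eta \<tau>)" by (simp add: mult_ac)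
  also have "dedekind_eta \<tau> ^ 23 * dedekind_eta \<tau> = modular_Delta \<tau>"
    unfolding modular_Delta_def power_Suc2[symmetric] by simp
  finally show ?thesis .
qed

text \<open>The exponent \<open>j\<close> counts applications of the Euler operator.
  \<open>lambert_has_derivative\<close> differentiates in \<open>x\<close> with \<open>q\<close>
  fixed; for \<open>lambert k q q\<close>, where both arguments vary, this power series in one
  variable is differentiated instead.\<close>

definition divisor_series :: "nat \<Rightarrow> nat \<Rightarrow> complex \<Rightarrow> complex" where
  "divisor_series j k x = (\<Sum>m. of_nat m ^ j * of_nat (divisor_sum k m) * x ^ m)"

lemma summable_divisor_series:
  fixes x :: complex
  assumes "norm x < 1"
  shows "summable (\<lambda>m. of_nat m ^ j * of_nat (divisor_sum k m) * x ^ m)"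
  by (rule summable_power_times[OF _ assms]) (use lambert_conv_divisor_sum sums_summable in blast)

lemma divisor_series_0: "norm q < 1 \<Longrightarrow> divisor_series 0 k q = lambert k q q"
  unfolding divisor_series_def using lambert_conv_divisor_sum[of q k] by (simp add: sums_iff)

lemma divisor_series_has_derivative:
  assumes "norm x < 1"
  obtains D where "(divisor_series j k has_field_derivative D) (at x)" "x * D = divisor_series (Suc j) k x"
proof -
  have "\<exists>D. ((\<lambda>x. \<Sum>m. (of_nat m ^ j * of_nat (divisor_sum k m)) * x ^ m) has_field_derivative D) (at x)
     \<and> x * D = (\<Sum>m. of_nat m * (of_nat m ^ j * of_nat (divisor_sum k m)) * x ^ m)"
    by (rule euler_power_series(2)) (use summable_divisor_series assms in auto)
  thus ?thesis using that unfolding divisor_series_def by (auto simp: mult.assoc)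
qed

text \<open>At 0 the identity for \<open>x * D\<close> says nothing about \<open>D\<close>; here the
  derivative is the linear coefficient, the divisor sum of 1. It supplies the leading terms of the
  Eisenstein series at the cusp.\<close>

lemma divisor_series_has_derivative_0: "(divisor_series j k has_field_derivative 1) (at 0)"
proof -
  have d1: "divisor_sum k (Suc 0) = 1" by (simp add: divisor_sum_def)
  have "((\<lambda>x. \<Sum>m. (of_nat m ^ j * of_nat (divisor_sum k m)) * x ^ m) has_field_derivative
     (\<Sum>m. diffs (\<lambda>m. of_nat m ^ j * of_nat (divisor_sum k m)) m * 0 ^ m)) (at (0::complex))"
    by (rule termdiffs_strong[of _ "1 / 2"]) (use summable_divisor_series[of "1/2"] in auto)
  moreover have "(\<Sum>m. diffs (\<lambda>m. of_nat m ^ j * of_nat (divisor_sum k m)) m * 0 ^ m) = (1::complex)"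
    by (subst powser_zero) (simp add: diffs_def d1)
  ultimately show ?thesis unfolding divisor_series_def by simp
qed

lemma divisor_series_at_0 [simp]: "divisor_series j k 0 = 0"
  unfolding divisor_series_def by (subst powser_zero) simp

lemma divisor_series_qpar_has_derivative:
  assumes "Im \<tau> > 0"
  shows "((\<lambda>\<tau>. divisor_series j k (qpar \<tau>)) has_field_derivative 2 * pi * \<i> * divisor_series (Suc j) k (qpar \<tau>)) (at \<tau>)"
proof -
  obtain D where D: "(divisor_series j k has_field_derivative D) (at (qpar \<tau>))" "qpar \<tau> * D = divisor_series (Suc j) k (qpar \<tau>)"
    using divisor_series_has_derivative[of "qpar \<tau>"] assms by auto
  have q: "(qpar has_field_derivative (2 * pi * \<i> * qpar \<tau>)) (at \<tau>)"
    by (rule derivative_eq_intros refl | simp)+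
  from DERIV_chain2[OF D(1) q] show ?thesis unfolding D(2)[symmetric] by (simp add: mult_ac)
qed

lemma divisor_series_qpar_holomorphic:
  "(\<lambda>\<tau>. divisor_series j k (qpar \<tau>)) holomorphic_on upper_half_plane"
  by (auto simp: holomorphic_on_open upper_half_plane_simps intro!: exI divisor_series_qpar_has_derivative)

lemma eisenstein_E2_conv: "Im \<tau> > 0 \<Longrightarrow> eisenstein_E2 \<tau> = 1 - 24 * divisor_series 0 1 (qpar \<tau>)"
  by (simp add: eisenstein_E2_def divisor_series_0)

lemma eisenstein_E4_conv: "Im \<tau> > 0 \<Longrightarrow> eisenstein_E4 \<tau> = 1 + 240 * divisor_series 0 3 (qpar \<tau>)"
  by (simp add: eisenstein_E4_eq divisor_series_0)

text \<open>This is \<open>E_2 E_4 - 3 D E_4\<close> with \<open>D = q d/dq\<close>: the quasi-modular terms of \<open>E_2\<close> and of the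
  derivative of \<open>E_4\<close> under inversion cancel.\<close>

definition eisenstein_E6 :: "complex \<Rightarrow> complex" where
  "eisenstein_E6 \<tau> = eisenstein_E2 \<tau> * eisenstein_E4 \<tau> - 720 * divisor_series 1 3 (qpar \<tau>)"

lemma eisenstein_E4_has_derivative:
  assumes "Im \<tau> > 0"
  shows "(eisenstein_E4 has_field_derivative (2 * pi * \<i> * (240 * divisor_series 1 3 (qpar \<tau>)))) (at \<tau>)"
proof -
  have "((\<lambda>\<tau>. 1 + 240 * divisor_series 0 3 (qpar \<tau>)) has_field_derivative (2 * pi * \<i> * (240 * divisor_series 1 3 (qpar \<tau>)))) (at \<tau>)"
    by (rule derivative_eq_intros divisor_series_qpar_has_derivative assms refl | simp)+
  moreover have "eventually (\<lambda>\<tau>. 1 + 240 * divisor_series 0 3 (qpar \<tau>) = eisenstein_E4 \<tau>) (nhds \<tau>)"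
    using eventually_nhds_in_open[of upper_half_plane \<tau>] assms
    by (auto simp: upper_half_plane_simps eisenstein_E4_conv elim!: eventually_mono)
  ultimately show ?thesis by (subst (asm) DERIV_cong_ev[OF refl _ refl])
qed

lemma eisenstein_E4_holomorphic: "eisenstein_E4 holomorphic_on upper_half_plane"
  by (auto simp: holomorphic_on_open upper_half_plane_simps intro!: exI eisenstein_E4_has_derivative)

lemma eisenstein_E6_holomorphic: "eisenstein_E6 holomorphic_on upper_half_plane"
proof -
  have "(\<lambda>\<tau>. 1 - 24 * divisor_series 0 1 (qpar \<tau>)) holomorphic_on upper_half_plane"
    by (intro holomorphic_intros divisor_series_qpar_holomorphic)
  hence "eisenstein_E2 holomorphic_on upper_half_plane"
    by (rule holomorphic_transform) (auto simp: eisenstein_E2_conv upper_half_plane_simps)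
  thus ?thesis unfolding eisenstein_E6_def
    by (intro holomorphic_intros divisor_series_qpar_holomorphic eisenstein_E4_holomorphic)
qed

lemma eisenstein_add_1: 
  "eisenstein_E2 (\<tau> + 1) = eisenstein_E2 \<tau>" "eisenstein_E4 (\<tau> + 1) = eisenstein_E4 \<tau>"
  "eisenstein_E6 (\<tau> + 1) = eisenstein_E6 \<tau>"
  by (simp_all add: eisenstein_E2_def eisenstein_E4_def eisenstein_E6_def qpar_add)

text \<open>The law of the derivative term \<open>d\<close> follows by differentiating
  \<open>E_4(-1/\<tau>) = \<tau>^4 E_4(\<tau>)\<close> and comparing the two resulting derivatives
  at \<open>\<tau>\<close>.\<close>

lemma eisenstein_E6_inversion:
  assumes "Im \<tau> > 0"
  shows "eisenstein_E6 (-1 / \<tau>) = \<tau> ^ 6 * eisenstein_E6 \<tau>"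
proof -
  have [simp]: "\<tau> \<noteq> 0" using assms by auto
  define d where "d = (\<lambda>\<tau>. 240 * divisor_series 1 3 (qpar \<tau>))"
  have "((\<lambda>\<tau>. eisenstein_E4 (-1 / \<tau>)) has_field_derivative (2 * pi * \<i> * d (-1 / \<tau>)) / \<tau> ^ 2) (at \<tau>)"
    unfolding d_def by (rule has_field_derivative_inversion[OF assms eisenstein_E4_has_derivative[OF Im_inversion_pos[OF assms]]])
  moreover have "eventually (\<lambda>\<tau>. eisenstein_E4 (-1 / \<tau>) = \<tau> ^ 4 * eisenstein_E4 \<tau>) (nhds \<tau>)"
    using eventually_nhds_in_open[of upper_half_plane \<tau>] assms
    by (auto simp: upper_half_plane_simps eisenstein_E4_inversion[simplified] elim!: eventually_mono)
  ultimately have "((\<lambda>\<tau>. \<tau> ^ 4 * eisenstein_E4 \<tau>) has_field_derivative (2 * pi * \<i> * d (-1 / \<tau>)) / \<tau> ^ 2) (at \<tau>)"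
    by (subst (asm) DERIV_cong_ev[OF refl _ refl])
  moreover have "((\<lambda>\<tau>. \<tau> ^ 4 * eisenstein_E4 \<tau>) has_field_derivative (4 * \<tau> ^ 3 * eisenstein_E4 \<tau> + 2 * pi * \<i> * d \<tau> * \<tau> ^ 4)) (at \<tau>)"
    unfolding d_def
    by (rule derivative_eq_intros eisenstein_E4_has_derivative assms refl | simp)+
  ultimately have "(2 * pi * \<i> * d (-1 / \<tau>)) / \<tau> ^ 2 = 4 * \<tau> ^ 3 * eisenstein_E4 \<tau> + 2 * pi * \<i> * d \<tau> * \<tau> ^ 4"
    by (rule DERIV_unique)
  hence "d (-1 / \<tau>) = (\<tau> ^ 2 / (2 * pi * \<i>)) * (4 * \<tau> ^ 3 * eisenstein_E4 \<tau> + 2 * pi * \<i> * d \<tau> * \<tau> ^ 4)"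
    by (simp add: field_simps)
  also have "\<dots> = \<tau> ^ 6 * d \<tau> - 2 * \<i> * \<tau> ^ 5 * eisenstein_E4 \<tau> / pi"
    by (simp add: field_simps eval_nat_numeral)
  finally have d: "d (-1 / \<tau>) = \<tau> ^ 6 * d \<tau> - 2 * \<i> * \<tau> ^ 5 * eisenstein_E4 \<tau> / pi" .
  have E6: "eisenstein_E6 \<tau> = eisenstein_E2 \<tau> * eisenstein_E4 \<tau> - 3 * d \<tau>" for \<tau>
    by (simp add: eisenstein_E6_def d_def)
  show ?thesis unfolding E6 d eisenstein_inversion[OF assms] by (simp add: field_simps eval_nat_numeral)
qed

lemma euler_phi_prod_tendsto: "((\<lambda>\<tau>. euler_phi_prod (qpar \<tau>)) \<longlongrightarrow> 1) cusp"
proof -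
  obtain D where "(euler_phi_prod has_field_derivative D) (at 0)" using euler_phi_prod_derivative[of 0] by auto
  hence "isCont euler_phi_prod 0" by (rule DERIV_isCont)
  hence "euler_phi_prod \<midarrow>0\<rightarrow> euler_phi_prod 0" by (simp add: isCont_def)
  moreover have "euler_phi_prod 0 = 1" by (simp add: euler_phi_prod_def)
  ultimately show ?thesis using filterlim_compose[OF _ qpar_tendsto_0] by metis
qed

lemma eventually_cusp_Im_pos: "eventually (\<lambda>\<tau>. Im \<tau> > 0) cusp"
  by (auto simp: eventually_cusp)

text \<open>Both sides have weight 12, so their quotient is invariant, and it is holomorphic because
  \<open>\<Delta>\<close> has no zeros. It remains to see that the quotient tends to 1728 at the
  cusp.\<close>

lemma eisenstein_cubes_minus_squares:
  assumes "Im \<tau> > 0"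
  shows "eisenstein_E4 \<tau> ^ 3 - eisenstein_E6 \<tau> ^ 2 = 1728 * modular_Delta \<tau>"
proof -
  define F where "F = (\<lambda>\<tau>. (eisenstein_E4 \<tau> ^ 3 - eisenstein_E6 \<tau> ^ 2) / modular_Delta \<tau> - 1728)"
  have "F \<tau> = 0"
  proof (rule modular_function_vanishing_at_cusp[OF _ _ _ _ assms])
    show "F holomorphic_on upper_half_plane" unfolding F_def
      by (intro holomorphic_intros eisenstein_E4_holomorphic eisenstein_E6_holomorphic modular_Delta_holomorphic)
         (auto simp: modular_Delta_nonzero upper_half_plane_simps)
    show "F (\<tau> + 1) = F \<tau>" for \<tau> by (simp add: F_def eisenstein_add_1 modular_Delta_add_1)
    show "F (-1 / \<tau>) = F \<tau>" if "Im \<tau> > 0" for \<tau>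
    proof -
      have "(eisenstein_E4 (-1/\<tau>) ^ 3 - eisenstein_E6 (-1/\<tau>) ^ 2) = \<tau> ^ 12 * (eisenstein_E4 \<tau> ^ 3 - eisenstein_E6 \<tau> ^ 2)"
        unfolding eisenstein_E4_inversion[OF that] eisenstein_E6_inversion[OF that]
        by (simp add: algebra_simps power_mult_distrib power_mult[symmetric])
      moreover have "\<tau> \<noteq> 0" using that by auto
      ultimately show ?thesis unfolding F_def modular_Delta_inversion[OF that] by simp
    qed
    define e4 where "e4 = (\<lambda>x. 1 + 240 * divisor_series 0 3 x)"
    define e6 where "e6 = (\<lambda>x. (1 - 24 * divisor_series 0 1 x) * e4 x - 720 * divisor_series 1 3 x)"
    \<comment> \<open>In the nome, the linear coefficients are 240 and -24 + 240 - 720 = -504, so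
      that of \<open>e4 ^ 3 - e6 ^ 2\<close> is 3 * 240 + 2 * 504 = 1728. The constant terms cancel,
      which compensates the simple zero of \<open>\<Delta>\<close>.\<close>
    have d4: "(e4 has_field_derivative 240) (at 0)" unfolding e4_def
      by (rule derivative_eq_intros divisor_series_has_derivative_0 refl | simp)+
    have d6: "(e6 has_field_derivative -504) (at 0)" unfolding e6_def
      by (rule derivative_eq_intros divisor_series_has_derivative_0 d4 refl | simp add: e4_def)+
    have v: "e4 0 = 1" "e6 0 = 1" by (simp_all add: e4_def e6_def)
    have "((\<lambda>x. e4 x ^ 3 - e6 x ^ 2) has_field_derivative 1728) (at 0)"
      by (rule derivative_eq_intros d4 d6 refl | simp add: v)+
    hence "(\<lambda>x. (e4 x ^ 3 - e6 x ^ 2) / x) \<midarrow>0\<rightarrow> 1728"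
      by (simp add: DERIV_def v)
    from filterlim_compose[OF this qpar_tendsto_0]
    have "((\<lambda>\<tau>. (e4 (qpar \<tau>) ^ 3 - e6 (qpar \<tau>) ^ 2) / qpar \<tau> / euler_phi_prod (qpar \<tau>) ^ 24 - 1728) \<longlongrightarrow> 1728 / 1 ^ 24 - 1728) cusp"
      by (intro tendsto_intros euler_phi_prod_tendsto) auto
    moreover have "eventually (\<lambda>\<tau>. (e4 (qpar \<tau>) ^ 3 - e6 (qpar \<tau>) ^ 2) / qpar \<tau> / euler_phi_prod (qpar \<tau>) ^ 24 - 1728 = F \<tau>) cusp"
      using eventually_cusp_Im_pos
      by eventually_elim (simp add: F_def modular_Delta_eq e4_def e6_def eisenstein_E6_def eisenstein_E4_conv eisenstein_E2_conv)
    ultimately show "(F \<longlongrightarrow> 0) cusp" by (simp add: tendsto_cong)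
  qed
  thus ?thesis using modular_Delta_nonzero[OF assms] by (simp add: F_def field_simps)
qed

section \<open>The invariant J\<close>


lemma modular_J_add_1: "modular_J (\<tau> + 1) = modular_J \<tau>"
  by (simp add: modular_J_def eisenstein_add_1 modular_Delta_add_1)

lemma modular_J_inversion:
  assumes "Im \<tau> > 0" shows "modular_J (-1 / \<tau>) = modular_J \<tau>"
proof -
  have [simp]: "\<tau> \<noteq> 0" using assms by auto
  show ?thesis unfolding modular_J_def eisenstein_E4_inversion[OF assms] modular_Delta_inversion[OF assms]
    by (simp add: power_mult_distrib power_mult[symmetric])
qed

lemma modular_J_holomorphic: "modular_J holomorphic_on upper_half_plane"
  unfolding modular_J_def
  by (intro holomorphic_intros eisenstein_E4_holomorphic modular_Delta_holomorphic)
     (auto simp: modular_Delta_nonzero upper_half_plane_simps)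

lemma modular_J_at_cusp: "filterlim modular_J at_infinity cusp"
proof -
  have e4: "((\<lambda>\<tau>. 1 + 240 * divisor_series 0 3 (qpar \<tau>)) \<longlongrightarrow> 1 + 240 * 0) cusp"
  proof (intro tendsto_intros)
    have "isCont (divisor_series 0 3) 0" using divisor_series_has_derivative_0 by (rule DERIV_isCont)
    hence "divisor_series 0 3 \<midarrow>0\<rightarrow> 0" by (simp add: isCont_def)
    thus "((\<lambda>\<tau>. divisor_series 0 3 (qpar \<tau>)) \<longlongrightarrow> 0) cusp" by (rule filterlim_compose[OF _ qpar_tendsto_0])
  qed
  have q0: "(qpar \<longlongrightarrow> 0) cusp" using qpar_tendsto_0 by (simp add: filterlim_at)
  have "((\<lambda>\<tau>. 1728 * (qpar \<tau> * euler_phi_prod (qpar \<tau>) ^ 24)) \<longlongrightarrow> 1728 * (0 * 1 ^ 24)) cusp"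
    by (intro tendsto_intros q0 euler_phi_prod_tendsto)
  hence "((\<lambda>\<tau>. 1728 * modular_Delta \<tau>) \<longlongrightarrow> 0) cusp" by (simp add: modular_Delta_eq)
  moreover have "eventually (\<lambda>\<tau>. 1728 * modular_Delta \<tau> \<noteq> 0) cusp"
    using eventually_cusp_Im_pos by eventually_elim (simp add: modular_Delta_nonzero)
  ultimately have D: "filterlim (\<lambda>\<tau>. 1728 * modular_Delta \<tau>) (at 0) cusp" by (simp add: filterlim_at)
  have "filterlim (\<lambda>\<tau>. (1 + 240 * divisor_series 0 3 (qpar \<tau>)) ^ 3 / (1728 * modular_Delta \<tau>)) at_infinity cusp"
    by (rule filterlim_divide_at_infinity[OF tendsto_power[OF e4] D]) simp
  moreover have "eventually (\<lambda>\<tau>. (1 + 240 * divisor_series 0 3 (qpar \<tau>)) ^ 3 / (1728 * modular_Delta \<tau>) = modular_J \<tau>) cusp"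
    using eventually_cusp_Im_pos by eventually_elim (simp add: modular_J_def eisenstein_E4_conv)
  ultimately show ?thesis by (simp add: filterlim_cong)
qed

text \<open>If \<open>J\<close> omitted the value \<open>x\<close>, then \<open>1 / (J - x)\<close>
  would be holomorphic and invariant and would vanish at the cusp, hence everywhere; but it has no
  zero.\<close>

lemma modular_J_surj: "\<exists>\<tau>. Im \<tau> > 0 \<and> modular_J \<tau> = x"
proof (rule ccontr)
  assume "\<not> ?thesis"
  hence no: "modular_J \<tau> \<noteq> x" if "Im \<tau> > 0" for \<tau> using that by blast
  define F where "F = (\<lambda>\<tau>. 1 / (modular_J \<tau> - x))"
  have "F \<i> = 0"
  proof (rule modular_function_vanishing_at_cusp[of F])
    show "F holomorphic_on upper_half_plane" unfolding F_def
      by (intro holomorphic_intros modular_J_holomorphic) (auto simp: no upper_half_plane_simps)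
    show "F (\<tau> + 1) = F \<tau>" for \<tau> by (simp add: F_def modular_J_add_1)
    show "F (-1 / \<tau>) = F \<tau>" if "Im \<tau> > 0" for \<tau> unfolding F_def modular_J_inversion[OF that] ..
    have "filterlim (\<lambda>\<tau>. - x + modular_J \<tau>) at_infinity cusp"
      by (rule tendsto_add_filterlim_at_infinity[OF tendsto_const modular_J_at_cusp])
    thus "(F \<longlongrightarrow> 0) cusp" unfolding F_def by (intro tendsto_divide_0[OF tendsto_const]) simp
  qed simp
  thus False using no[of \<i>] by (simp add: F_def)
qed

text \<open>The quotient rule produces \<open>3 D E_4 - E_2 E_4\<close> with
  \<open>D = q d/dq\<close>, which is \<open>- E_6\<close> by the definition of
  \<open>eisenstein_E6\<close>.\<close>

lemma modular_J_has_derivative: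
  assumes "Im \<tau> > 0"
  shows "(modular_J has_field_derivative
    (- 2 * pi * \<i> * eisenstein_E4 \<tau> ^ 2 * eisenstein_E6 \<tau> / (1728 * modular_Delta \<tau>))) (at \<tau>)"
proof -
  define a :: complex where "a = 2 * pi * \<i>"
  define d where "d = 240 * divisor_series 1 3 (qpar \<tau>)"
  define D where "D = modular_Delta \<tau>"
  define E where "E = eisenstein_E4 \<tau>"
  have "D \<noteq> 0" using modular_Delta_nonzero assms by (simp add: D_def)
  have E: "(eisenstein_E4 has_field_derivative a * d) (at \<tau>)"
    unfolding a_def d_def by (rule eisenstein_E4_has_derivative[OF assms])
  have D: "(modular_Delta has_field_derivative a * eisenstein_E2 \<tau> * D) (at \<tau>)"
    unfolding a_def D_def by (rule modular_Delta_has_derivative[OF assms])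
  have E3: "((\<lambda>\<tau>. eisenstein_E4 \<tau> ^ 3) has_field_derivative 3 * E ^ 2 * (a * d)) (at \<tau>)"
    using DERIV_power[OF E, of 3] by (simp add: E_def mult_ac)
  have D3: "((\<lambda>\<tau>. 1728 * modular_Delta \<tau>) has_field_derivative 1728 * (a * eisenstein_E2 \<tau> * D)) (at \<tau>)"
    by (rule DERIV_cmult[OF D])
  have "(modular_J has_field_derivative (3 * E ^ 2 * (a * d) * (1728 * D) - E ^ 3 * (1728 * (a * eisenstein_E2 \<tau> * D))) / ((1728 * D) * (1728 * D))) (at \<tau>)"
    using DERIV_divide[OF E3 D3] \<open>D \<noteq> 0\<close> unfolding modular_J_def[abs_def] D_def E_def by simp
  also have "(3 * E ^ 2 * (a * d) * (1728 * D) - E ^ 3 * (1728 * (a * eisenstein_E2 \<tau> * D))) / ((1728 * D) * (1728 * D))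
    = - a * E ^ 2 * (eisenstein_E2 \<tau> * E - 3 * d) / (1728 * D)"
    using \<open>D \<noteq> 0\<close> by (simp add: field_simps eval_nat_numeral)
  also have "eisenstein_E2 \<tau> * E - 3 * d = eisenstein_E6 \<tau>" by (simp add: E_def d_def eisenstein_E6_def)
  finally show ?thesis by (simp add: a_def E_def D_def)
qed

text \<open>The sixth power of the identity expressing \<open>\<eta>^4 d\<tau>\<close> as a constant times
  \<open>J^(-2/3) (J - 1)^(-1/2) dJ\<close>, which avoids choosing branches.\<close>

lemma deriv_modular_J_pow6:
  assumes "Im \<tau> > 0"
  shows "deriv modular_J \<tau> ^ 6 = (2 * pi * \<i>) ^ 6 * 1728 * (modular_Delta \<tau> * (modular_J \<tau> ^ 4 * (modular_J \<tau> - 1) ^ 3))"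
proof -
  define a :: complex where "a = 2 * pi * \<i>"
  define D where "D = 1728 * modular_Delta \<tau>"
  define E where "E = eisenstein_E4 \<tau>"
  define G where "G = eisenstein_E6 \<tau>"
  have "D \<noteq> 0" using modular_Delta_nonzero assms by (simp add: D_def)
  have J: "modular_J \<tau> = E ^ 3 / D" by (simp add: modular_J_def E_def D_def)
  have "E ^ 3 - G ^ 2 = D" unfolding E_def G_def D_def by (rule eisenstein_cubes_minus_squares[OF assms])
  hence "E ^ 3 = D + G ^ 2" by (simp add: algebra_simps)
  \<comment> \<open>Since \<open>J\<close> is a cube over \<open>D\<close> and \<open>J - 1\<close>
    a square over \<open>D\<close>, the powers 4 and 3 give exactly the
    \<open>E ^ 12 * G ^ 6\<close> of the sixth power of \<open>J'\<close>.\<close>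
  hence J1: "modular_J \<tau> - 1 = G ^ 2 / D" unfolding J using \<open>D \<noteq> 0\<close> by (simp add: field_simps)
  have "deriv modular_J \<tau> = - a * E ^ 2 * G / D"
    using DERIV_imp_deriv[OF modular_J_has_derivative[OF assms]] by (simp add: a_def E_def G_def D_def)
  hence "deriv modular_J \<tau> ^ 6 = (- a * E ^ 2 * G / D) ^ 6" by simp
  also have "\<dots> = a ^ 6 * E ^ 12 * G ^ 6 / D ^ 6"
    by (simp only: power_divide power_mult_distrib power_mult[symmetric] power_minus_even) simp
  finally have L: "deriv modular_J \<tau> ^ 6 = a ^ 6 * E ^ 12 * G ^ 6 / D ^ 6" .
  have "a ^ 6 * (D * ((E ^ 3 / D) ^ 4 * (G ^ 2 / D) ^ 3)) = a ^ 6 * E ^ 12 * G ^ 6 / D ^ 6"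
    using \<open>D \<noteq> 0\<close> by (simp add: power_divide power_mult[symmetric] field_simps) (simp add: eval_nat_numeral)
  hence "deriv modular_J \<tau> ^ 6 = a ^ 6 * (D * (modular_J \<tau> ^ 4 * (modular_J \<tau> - 1) ^ 3))"
    unfolding L J1 unfolding J by simp
  thus ?thesis by (simp add: a_def D_def mult_ac)
qed

text \<open>Differentiating the identity for \<open>J' ^ 6\<close> logarithmically gives
  \<open>6 J''/J' = 24 \<eta>'/\<eta> + J' (4/J + 3/(J - 1))\<close>; the 24 comes from
  \<open>\<Delta> = \<eta>^24\<close>. The same identity shows that \<open>J'\<close> vanishes only
  over 0 and 1.\<close>

lemma modular_J_second_log_derivative:
  assumes "Im w > 0" "modular_J w \<noteq> 0" "modular_J w \<noteq> 1"
  shows "deriv modular_J w \<noteq> 0"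
    and "deriv (deriv modular_J) w / deriv modular_J w =
      4 * (deriv dedekind_eta w / dedekind_eta w) +
      deriv modular_J w * (2 / 3 / modular_J w + 1 / 2 / (modular_J w - 1))"
proof -
  define c where "c = (2 * pi * \<i>) ^ 6 * 1728"
  have "c \<noteq> 0" by (simp add: c_def)
  define J where "J = modular_J w"
  define J' where "J' = deriv modular_J w"
  define J'' where "J'' = deriv (deriv modular_J) w"
  define D where "D = modular_Delta w"
  define e where "e = deriv dedekind_eta w / dedekind_eta w"
  have "D \<noteq> 0" using modular_Delta_nonzero assms by (simp add: D_def)
  have J6: "deriv modular_J \<tau> ^ 6 = c * (modular_Delta \<tau> * (modular_J \<tau> ^ 4 * (modular_J \<tau> - 1) ^ 3))" if "Im \<tau> > 0" for \<tau>
    using deriv_modular_J_pow6[OF that] by (simp add: c_def)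
  have J6w: "J' ^ 6 = c * (D * (J ^ 4 * (J - 1) ^ 3))" using J6[OF assms(1)] by (simp add: J'_def J_def D_def)
  thus nz: "deriv modular_J w \<noteq> 0" using assms \<open>c \<noteq> 0\<close> \<open>D \<noteq> 0\<close> unfolding J'_def J_def by auto
  have nz': "J' \<noteq> 0" "J \<noteq> 0" "J - 1 \<noteq> 0" using nz assms by (auto simp: J'_def J_def)
  have dJ: "(modular_J has_field_derivative J') (at w)"
    unfolding J'_def using modular_J_holomorphic assms by (intro holomorphic_derivI[of _ upper_half_plane]) (auto simp: upper_half_plane_simps)
  have "deriv modular_J holomorphic_on upper_half_plane" by (intro holomorphic_deriv modular_J_holomorphic upper_half_plane_simps)
  hence dJ': "(deriv modular_J has_field_derivative J'') (at w)"
    unfolding J''_def using assms by (intro holomorphic_derivI[of _ upper_half_plane]) (auto simp: upper_half_plane_simps)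
  have ede: "e = 2 * pi * \<i> / 24 * eisenstein_E2 w"
    using DERIV_imp_deriv[OF dedekind_eta_has_derivative[OF assms(1)]] dedekind_eta_nonzero[OF assms(1)] by (simp add: e_def)
  have dD: "(modular_Delta has_field_derivative (24 * e * D)) (at w)"
  proof -
    have "24 * e * D = 2 * pi * \<i> * eisenstein_E2 w * modular_Delta w" by (simp add: ede D_def)
    thus ?thesis using modular_Delta_has_derivative[OF assms(1)] by (simp only:)
  qed
  have p4: "((\<lambda>\<tau>. modular_J \<tau> ^ 4) has_field_derivative 4 * J ^ 3 * J') (at w)"
    using DERIV_power[OF dJ, of 4] by (simp add: J_def mult_ac)
  have p3: "((\<lambda>\<tau>. (modular_J \<tau> - 1) ^ 3) has_field_derivative 3 * (J - 1) ^ 2 * J') (at w)"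
    using DERIV_power[OF DERIV_diff[OF dJ DERIV_const[of 1]], of 3] by (simp add: J_def mult_ac)
  have "((\<lambda>\<tau>. deriv modular_J \<tau> ^ 6) has_field_derivative 6 * J' ^ 5 * J'') (at w)"
    using DERIV_power[OF dJ', of 6] by (simp add: J'_def mult_ac)
  moreover have "eventually (\<lambda>\<tau>. deriv modular_J \<tau> ^ 6 = c * (modular_Delta \<tau> * (modular_J \<tau> ^ 4 * (modular_J \<tau> - 1) ^ 3))) (nhds w)"
    using eventually_nhds_in_open[of upper_half_plane w] assms J6
    by (auto simp: upper_half_plane_simps elim!: eventually_mono)
  ultimately have "((\<lambda>\<tau>. c * (modular_Delta \<tau> * (modular_J \<tau> ^ 4 * (modular_J \<tau> - 1) ^ 3))) has_field_derivative 6 * J' ^ 5 * J'') (at w)"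
    by (subst (asm) DERIV_cong_ev[OF refl _ refl])
  moreover have "((\<lambda>\<tau>. c * (modular_Delta \<tau> * (modular_J \<tau> ^ 4 * (modular_J \<tau> - 1) ^ 3))) has_field_derivative 
      c * (24 * e * D * (J ^ 4 * (J - 1) ^ 3) + (4 * J ^ 3 * J' * (J - 1) ^ 3 + 3 * (J - 1) ^ 2 * J' * J ^ 4) * D)) (at w)"
    using DERIV_cmult[OF DERIV_mult[OF dD DERIV_mult[OF p4 p3]], of c] by (simp add: J_def D_def)
  ultimately have "6 * J' ^ 5 * J'' = c * (24 * e * D * (J ^ 4 * (J - 1) ^ 3) + (4 * J ^ 3 * J' * (J - 1) ^ 3 + 3 * (J - 1) ^ 2 * J' * J ^ 4) * D)"
    by (rule DERIV_unique)
  also have "\<dots> = c * (D * (J ^ 4 * (J - 1) ^ 3)) * (24 * e + J' * (4 / J + 3 / (J - 1)))"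
  proof -
    have "J ^ 4 * (4 / J) = 4 * J ^ 3" "(J - 1) ^ 3 * (3 / (J - 1)) = 3 * (J - 1) ^ 2"
      using nz' by (simp_all add: eval_nat_numeral)
    thus ?thesis by algebra
  qed
  also have "\<dots> = J' ^ 6 * (24 * e + J' * (4 / J + 3 / (J - 1)))" by (simp only: J6w)
  finally have "J' ^ 5 * (6 * J'') = J' ^ 5 * (J' * (24 * e + J' * (4 / J + 3 / (J - 1))))"
    by (simp add: eval_nat_numeral mult_ac)
  hence "6 * J'' = J' * (24 * e + J' * (4 / J + 3 / (J - 1)))" using nz' by (metis mult_left_cancel power_not_zero)
  moreover have "24 * e + J' * (4 / J + 3 / (J - 1)) = 6 * (4 * e + J' * (2 / 3 / J + 1 / 2 / (J - 1)))"
  proof -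
    have "4 / J = 6 * (2 / 3 / J)" "3 / (J - 1) = 6 * (1 / 2 / (J - 1))" using nz' by (auto simp: divide_simps)
    thus ?thesis by algebra
  qed
  ultimately have "6 * J'' = 6 * (J' * (4 * e + J' * (2 / 3 / J + 1 / 2 / (J - 1))))"
    by (simp only: mult.left_commute)
  hence "J'' = J' * (4 * e + J' * (2 / 3 / J + 1 / 2 / (J - 1)))"
    by (rule mult_left_cancel[THEN iffD1, rotated]) simp
  hence "J'' / J' = 4 * e + J' * (2 / 3 / J + 1 / 2 / (J - 1))" using nz' by simp
  thus "deriv (deriv modular_J) w / deriv modular_J w =
      4 * (deriv dedekind_eta w / dedekind_eta w) +
      deriv modular_J w * (2 / 3 / modular_J w + 1 / 2 / (modular_J w - 1))"
    unfolding J''_def J'_def e_def J_def .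
qed

section \<open>Double poles and Jacobi polynomials\<close>


text \<open>Write \<open>h z = (z - w) * k z\<close>, so that f is
  \<open>\<phi> z / (z - w) ^ 2\<close> with \<open>\<phi> = g / k ^ 2\<close> and the residue is
  \<open>\<phi>'(w)\<close>. As \<open>k w = h'(w)\<close> and \<open>k'(w) = h''(w) / 2\<close>, it
  vanishes when \<open>g'/g = 2 k'/k = h''/h'\<close> at \<open>w\<close>, the hypothesis
  \<open>log\<close>.\<close>

lemma double_pole_zero_residue:
  assumes S: "open S" "w \<in> S" and g: "g holomorphic_on S" and h: "h holomorphic_on S"
    and h0: "h w = 0" and h1: "deriv h w \<noteq> 0" and g0: "g w \<noteq> 0"
    and log: "deriv g w / g w = deriv (deriv h) w / deriv h w"
    and f: "\<And>z. z \<in> S \<Longrightarrow> f z = g z / h z ^ 2"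
  shows "is_pole f w" "zorder f w = -2" "residue f w = 0"
proof -
  define k where "k = (\<lambda>z. if z = w then deriv h w else (h z - h w) / (z - w))"
  have kh: "k holomorphic_on S" unfolding k_def by (rule pole_lemma_open[OF h S(1)])
  have hk: "h z = (z - w) * k z" for z using h0 by (simp add: k_def)
  have k0: "k w \<noteq> 0" using h1 by (simp add: k_def)
  have "continuous_on S k" using kh by (rule holomorphic_on_imp_continuous_on)
  hence "open (S \<inter> k -` (- {0}))" using S by (intro continuous_open_preimage) auto
  define S' where "S' = S \<inter> k -` (- {0})"
  have S': "open S'" "w \<in> S'" "S' \<subseteq> S" using \<open>open (S \<inter> k -` (- {0}))\<close> S k0 by (auto simp: S'_def)
  have knz: "k z \<noteq> 0" if "z \<in> S'" for z using that by (simp add: S'_def)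
  define \<phi> where "\<phi> = (\<lambda>z. g z / k z ^ 2)"
  have \<phi>: "\<phi> holomorphic_on S'" unfolding \<phi>_def
    using holomorphic_on_subset[OF kh S'(3)] holomorphic_on_subset[OF g S'(3)] knz by (intro holomorphic_intros) auto
  have f\<phi>: "f z = \<phi> z / (z - w) ^ 2" if "z \<in> S'" for z
    using f[of z] that S'(3) hk[of z] by (auto simp: \<phi>_def power_mult_distrib mult.commute)
  have dk: "(k has_field_derivative deriv k z) (at z)" if "z \<in> S" for z
    using holomorphic_derivI[OF kh S(1) that] .
  have dg: "(g has_field_derivative deriv g w) (at w)"
    using holomorphic_derivI[OF g S] .
  have "deriv h z = k z + (z - w) * deriv k z" if "z \<in> S" for z
  proof -
    have "((\<lambda>z. (z - w) * k z) has_field_derivative (k z + (z - w) * deriv k z)) (at z)"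
      by (rule derivative_eq_intros dk[OF that] refl | simp)+
    thus ?thesis using DERIV_imp_deriv hk by (metis (no_types, lifting) ext)
  qed
  hence "eventually (\<lambda>z. deriv h z = k z + (z - w) * deriv k z) (nhds w)"
    using eventually_nhds_in_open[OF S] by (auto elim!: eventually_mono)
  hence "deriv (deriv h) w = deriv (\<lambda>z. k z + (z - w) * deriv k z) w" by (rule deriv_cong_ev) simp
  also have "\<dots> = 2 * deriv k w"
  proof (rule DERIV_imp_deriv)
    have "deriv k holomorphic_on S" by (rule holomorphic_deriv[OF kh S(1)])
    hence d2: "(deriv k has_field_derivative deriv (deriv k) w) (at w)" using holomorphic_derivI S by blast
    show "((\<lambda>z. k z + (z - w) * deriv k z) has_field_derivative 2 * deriv k w) (at w)"
      by (rule derivative_eq_intros dk[OF S(2)] d2 refl | simp)+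
  qed
  finally have h2: "deriv (deriv h) w = 2 * deriv k w" .
  have kw: "k w = deriv h w" by (simp add: k_def)
  have "(\<phi> has_field_derivative (deriv g w * k w ^ 2 - g w * (2 * k w * deriv k w)) / (k w ^ 2 * k w ^ 2)) (at w)"
    unfolding \<phi>_def by (rule derivative_eq_intros dg dk[OF S(2)] refl | simp add: k0)+
  moreover have "deriv g w * k w ^ 2 - g w * (2 * k w * deriv k w) = 0"
    using log h1 g0 unfolding h2 kw by (simp add: field_simps power2_eq_square)
  ultimately have d\<phi>: "deriv \<phi> w = 0" using DERIV_imp_deriv by fastforce
  show "zorder f w = -2"
    by (rule zorder_eqI[OF S'(1,2) \<phi>]) (use g0 k0 f\<phi> in \<open>auto simp: \<phi>_def power_int_minus divide_inverse\<close>)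
  have "residue f w = residue (\<lambda>z. \<phi> z / (z - w) ^ Suc 1) w"
    using eventually_nhds_in_open[OF S'(1,2)]
    by (intro residue_cong) (auto simp: eventually_at_filter f\<phi> numeral_2_eq_2 elim!: eventually_mono)
  also have "\<dots> = (deriv ^^ 1) \<phi> w / fact 1"
    by (rule residue_holomorphic_over_power[OF S'(1,2) \<phi>])
  finally show "residue f w = 0" using d\<phi> by simp
  have "is_pole (\<lambda>z. \<phi> z / (z - w) ^ 2) w"
  proof (rule is_pole_divide)
    show "isCont \<phi> w" using \<phi> S' holomorphic_on_imp_continuous_on continuous_on_eq_continuous_at by blast
    have "((\<lambda>z. (z - w) ^ 2) \<longlongrightarrow> (w - w) ^ 2) (at w)" by (intro tendsto_intros)
    thus "filterlim (\<lambda>z. (z - w) ^ 2) (at 0) (at w)" by (auto simp: filterlim_at eventually_at_filter)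
  qed (use g0 k0 in \<open>simp add: \<phi>_def\<close>)
  moreover have "eventually (\<lambda>z. \<phi> z / (z - w) ^ 2 = f z) (at w)"
    using eventually_nhds_in_open[OF S'(1,2)] by (auto simp: eventually_at_filter f\<phi> elim!: eventually_mono)
  ultimately show "is_pole f w" by (subst (asm) is_pole_cong[OF _ refl])
qed

section \<open>Polynomial solutions of the hypergeometric equation and their zeros\<close>

lemma pderiv_linear_power_mult:
  fixes Q :: "complex poly"
  shows "pderiv ([:- a, 1:] ^ Suc k * Q) = [:- a, 1:] ^ k * (smult (of_nat (Suc k)) Q + [:- a, 1:] * pderiv Q)"
proof -
  have "pderiv [:- a, 1:] = 1" by (simp add: pderiv_pCons)
  thus ?thesis unfolding pderiv_mult pderiv_power_Suc by (simp add: algebra_simps)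
qed

lemma of_nat_add_frac_nonzero: "of_nat k + of_real r \<noteq> (0::complex)" if "r > 0"
proof -
  have "of_nat k + of_real r = complex_of_real (real k + r)" by simp
  thus ?thesis using that by (metis add_nonneg_pos less_irrefl of_nat_0_le_iff of_real_eq_0_iff)
qed

locale jacobi_ode =
  fixes P :: "complex poly" and l :: complex
  assumes ode: "[:0, -1, 1:] * pderiv (pderiv P) + [:- (2/3), 7/6:] * pderiv P = smult l P"
    and P_nonzero: "P \<noteq> 0" and P_0: "poly P 0 \<noteq> 0"
begin

text \<open>The indicial exponents of the equation at 1 are 0 and 1/2, so no positive integer is the
  order of a zero there: order \<open>k + 1\<close> would give
  \<open>(k + 1/2) * (k + 1) = 0\<close>.\<close>

lemma not_root_1: "poly P 1 \<noteq> 0"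
proof
  assume "poly P 1 = 0"
  hence "order 1 P \<noteq> 0" using P_nonzero order_root by blast
  then obtain k where k: "order 1 P = Suc k" by (cases "order 1 P") auto
  define u :: "complex poly" where "u = [:-1, 1:]"
  obtain Q where Q: "P = u ^ Suc k * Q" "\<not> u dvd Q"
    using order_decomp[OF P_nonzero, of 1] unfolding k u_def by blast
  have "u \<noteq> 0" by (simp add: u_def)
  have pd: "pderiv (u ^ Suc j * p) = u ^ j * (smult (of_nat (Suc j)) p + u * pderiv p)" for j p
    unfolding u_def by (rule pderiv_linear_power_mult)
  define Q1 where "Q1 = smult (of_nat (Suc k)) Q + u * pderiv Q"
  have P1: "pderiv P = u ^ k * Q1" unfolding Q1_def Q(1) by (rule pd)
  \<comment> \<open>The factor \<open>u\<close>, available because the leading coefficient vanishes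
    at 1, avoids the exponent \<open>k - 1\<close> and so includes a simple root,
    \<open>k = 0\<close>.\<close>
  have P2: "u * pderiv (pderiv P) = u ^ k * (smult (of_nat k) Q1 + u * pderiv Q1)"
  proof (cases k)
    case (Suc j)
    show ?thesis unfolding P1 Suc pd by (simp only: power_Suc mult.assoc)
  qed (simp add: P1)
  have "[:0, -1, 1:] = [:0, 1:] * u" by (simp add: u_def)
  hence "[:0, 1:] * (u * pderiv (pderiv P)) + [:- (2/3), 7/6:] * pderiv P = smult l P"
    using ode by (simp only: mult.assoc)
  hence "u ^ k * ([:0, 1:] * (smult (of_nat k) Q1 + u * pderiv Q1) + [:- (2/3), 7/6:] * Q1) = u ^ k * (smult l (u * Q))"
    unfolding P2 unfolding P1 unfolding Q(1) by (simp only: ring_distribs mult_ac power_Suc mult_smult_right mult_smult_left)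
  hence "[:0, 1:] * (smult (of_nat k) Q1 + u * pderiv Q1) + [:- (2/3), 7/6:] * Q1 = smult l (u * Q)"
    using \<open>u \<noteq> 0\<close> by (metis mult_left_cancel power_not_zero)
  from arg_cong[OF this, of "\<lambda>p. poly p 1"]
  have "(of_nat k + 1/2) * poly Q1 1 = 0" by (simp add: u_def algebra_simps)
  moreover have "of_nat k + 1/2 \<noteq> (0::complex)" using of_nat_add_frac_nonzero[of "1/2" k] by simp
  ultimately have "poly Q1 1 = 0" by simp
  hence "of_nat (Suc k) * poly Q 1 = 0" by (simp add: Q1_def u_def)
  hence "poly Q 1 = 0" using of_nat_neq_0 mult_eq_0_iff by blast
  thus False using Q(2) by (simp add: u_def poly_eq_0_iff_dvd)
qed

text \<open>The point \<open>a\<close> is neither 0 nor 1, so the leading coefficient of the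
  equation is nonzero there. At a root of order \<open>k + 2\<close> the second derivative has order
  \<open>k\<close>, less than the orders of \<open>P'\<close> and \<open>P\<close>, and nothing can
  cancel it.\<close>

lemma simple_root:
  assumes "[:- a, 1:] ^ 2 dvd P" shows False
proof -
  define u :: "complex poly" where "u = [:- a, 1:]"
  have "poly P a = 0" using assms by (metis dvd_power dvd_trans poly_eq_0_iff_dvd zero_less_numeral)
  hence a: "a \<noteq> 0" "a \<noteq> 1" using P_0 not_root_1 by auto
  have "2 \<le> order a P" using assms P_nonzero order_divides by blast
  then obtain k where k: "order a P = Suc (Suc k)" by (metis add_2_eq_Suc le_Suc_ex)
  obtain Q where Q: "P = u ^ Suc (Suc k) * Q" "\<not> u dvd Q"
    using order_decomp[OF P_nonzero, of a] unfolding k u_def by blast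
  have "u \<noteq> 0" by (simp add: u_def)
  define Q1 where "Q1 = smult (of_nat (Suc (Suc k))) Q + u * pderiv Q"
  have P1: "pderiv P = u ^ Suc k * Q1"
    unfolding Q1_def Q(1) u_def by (rule pderiv_linear_power_mult)
  have P2: "pderiv (pderiv P) = u ^ k * (smult (of_nat (Suc k)) Q1 + u * pderiv Q1)"
    unfolding P1 u_def by (rule pderiv_linear_power_mult)
  have "u ^ k * ([:0, -1, 1:] * (smult (of_nat (Suc k)) Q1 + u * pderiv Q1) + [:- (2/3), 7/6:] * (u * Q1)) = u ^ k * (smult l (u * u * Q))"
    using ode unfolding P2 unfolding P1 unfolding Q(1)
    by (simp only: ring_distribs mult_ac power_Suc mult_smult_right mult_smult_left)
  hence "[:0, -1, 1:] * (smult (of_nat (Suc k)) Q1 + u * pderiv Q1) + [:- (2/3), 7/6:] * (u * Q1) = smult l (u * u * Q)"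
    using \<open>u \<noteq> 0\<close> by (metis mult_left_cancel power_not_zero)
  from arg_cong[OF this, of "\<lambda>p. poly p a"]
  have "(a * (a - 1)) * (of_nat (Suc k) * poly Q1 a) = 0" by (simp add: u_def algebra_simps)
  hence "poly Q1 a = 0" using a of_nat_neq_0 by (metis eq_iff_diff_eq_0 mult_eq_0_iff)
  hence "of_nat (Suc (Suc k)) * poly Q a = 0" by (simp add: Q1_def u_def)
  hence "poly Q a = 0" using of_nat_neq_0 mult_eq_0_iff by blast
  thus False using Q(2) by (simp add: u_def poly_eq_0_iff_dvd)
qed

end

text \<open>Coefficients of the hypergeometric polynomial 2F1(-n, n + 1/6; 2/3; x), a Jacobi
  polynomial up to scaling and an affine change of variable. The numerator of the ratio factors as
  \<open>(k - n) * (k + n + 1/6)\<close>, so the series stops after \<open>k = n\<close>.\<close>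

primrec jacobi_coeff :: "nat \<Rightarrow> nat \<Rightarrow> complex" where
  "jacobi_coeff n 0 = 1"
| "jacobi_coeff n (Suc k) = jacobi_coeff n k *
     (of_nat k * (of_nat k + 1/6) - of_nat n * (of_nat n + 1/6)) / (of_nat (Suc k) * (of_nat k + 2/3))"

lemma jacobi_coeff_nonzero: "k \<le> n \<Longrightarrow> jacobi_coeff n k \<noteq> 0"
proof (induction k)
  case (Suc k)
  have "real k * (real k + 1/6) < real n * (real n + 1/6)"
    by (rule mult_strict_mono) (use Suc.prems in auto)
  hence "complex_of_real (real k * (real k + 1/6) - real n * (real n + 1/6)) \<noteq> 0"
    by (simp only: of_real_eq_0_iff)
  moreover have "complex_of_real (real k * (real k + 1/6) - real n * (real n + 1/6)) =
     of_nat k * (of_nat k + 1/6) - of_nat n * (of_nat n + 1/6)" by simp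
  moreover have "of_nat k + 2/3 \<noteq> (0::complex)" using of_nat_add_frac_nonzero[of "2/3" k] by simp
  moreover have "of_nat (Suc k) \<noteq> (0::complex)" by (rule of_nat_neq_0)
  ultimately show ?case using Suc by (simp del: of_nat_Suc)
qed simp

lemma jacobi_coeff_zero: "k > n \<Longrightarrow> jacobi_coeff n k = 0"
proof (induction k)
  case (Suc k)
  thus ?case by (cases "k = n") auto
qed simp

definition jacobi_poly :: "nat \<Rightarrow> complex poly" where
  "jacobi_poly n = (\<Sum>k\<le>n. monom (jacobi_coeff n k) k)"

lemma coeff_jacobi_poly: "coeff (jacobi_poly n) k = jacobi_coeff n k"
proof -
  have "coeff (jacobi_poly n) k = (if k \<le> n then jacobi_coeff n k else 0)"
    by (simp add: jacobi_poly_def coeff_sum)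
  thus ?thesis using jacobi_coeff_zero[of n k] by auto
qed

lemma degree_jacobi_poly: "degree (jacobi_poly n) = n"
  by (rule antisym[OF degree_le le_degree])
     (use jacobi_coeff_nonzero[of n n] jacobi_coeff_zero in \<open>auto simp: coeff_jacobi_poly\<close>)

text \<open>At \<open>x^k\<close> the left side contributes \<open>k * (k + 1/6)\<close> times the
  k-th coefficient minus \<open>(k + 1) * (k + 2/3)\<close> times the next one, so the equation is
  the recursion of \<open>jacobi_coeff\<close>.\<close>

lemma jacobi_poly_ode:
  "[:0, -1, 1:] * pderiv (pderiv (jacobi_poly n)) + [:- (2/3), 7/6:] * pderiv (jacobi_poly n)
     = smult (of_nat n * (of_nat n + 1/6)) (jacobi_poly n)"
proof (rule poly_eqI)
  fix k
  define a where "a = jacobi_coeff n"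
  define L :: complex where "L = of_nat n * (of_nat n + 1/6)"
  have step: "a (Suc k) * (of_nat (Suc k) * (of_nat k + 2/3)) = a k * (of_nat k * (of_nat k + 1/6) - L)"
  proof -
    have "of_nat (Suc k) * (of_nat k + 2/3) \<noteq> (0::complex)"
      using of_nat_add_frac_nonzero[of "2/3" k] of_nat_neq_0[of k] by simp
    thus ?thesis by (simp add: a_def L_def del: of_nat_Suc)
  qed
  have c: "coeff (pderiv (jacobi_poly n)) j = of_nat (Suc j) * a (Suc j)" for j
    by (simp add: coeff_pderiv coeff_jacobi_poly a_def)
  have c2: "coeff (pderiv (pderiv (jacobi_poly n))) j = of_nat (Suc j) * (of_nat (Suc (Suc j)) * a (Suc (Suc j)))" for j
    by (simp only: coeff_pderiv coeff_jacobi_poly a_def)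
  have e1: "[:0, -1, 1:] * p = pCons 0 (pCons 0 p - p)" for p :: "complex poly"
    by simp
  have e2: "[:- (2/3), 7/6:] * p = smult (- (2/3)) p + pCons 0 (smult (7/6) p)" for p :: "complex poly"
    by simp
  have rhs: "coeff (smult L (jacobi_poly n)) k
      = a k * (of_nat k * (of_nat k + 1/6)) - a (Suc k) * (of_nat (Suc k) * (of_nat k + 2/3))"
    unfolding step by (simp add: coeff_jacobi_poly a_def algebra_simps)
  show "coeff ([:0, -1, 1:] * pderiv (pderiv (jacobi_poly n)) + [:- (2/3), 7/6:] * pderiv (jacobi_poly n)) k
     = coeff (smult (of_nat n * (of_nat n + 1/6)) (jacobi_poly n)) k"
  proof (cases k)
    case 0
    show ?thesis unfolding e1 e2 L_def[symmetric] rhs unfolding 0 by (simp add: c c2)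
  next
    case (Suc i)
    show ?thesis unfolding e1 e2 L_def[symmetric] rhs unfolding Suc
      by (cases i) (simp_all add: c c2 field_simps)
  qed
qed

text \<open>At a root \<open>y\<close> write \<open>P = (X - y) * R\<close>. Then
  \<open>P'(y) = R(y)\<close> and \<open>P''(y) = 2 * R'(y)\<close>, so
  \<open>P''(y) / P'(y)\<close> is the sum over the other roots, and the differential equation at
  \<open>y\<close> becomes the desired equation.\<close>

lemma stieltjes_system_solvable:
  obtains x :: "nat \<Rightarrow> complex" where "inj_on x {..<n}" "\<And>i. i < n \<Longrightarrow> x i \<noteq> 0" "\<And>i. i < n \<Longrightarrow> x i \<noteq> 1"
    "\<And>i. i < n \<Longrightarrow> (\<Sum>j\<in>{..<n}-{i}. 2 / (x i - x j)) + 2 / 3 / x i + 1 / 2 / (x i - 1) = 0"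
proof -
  define P where "P = jacobi_poly n"
  interpret jacobi_ode P "of_nat n * (of_nat n + 1/6)"
  proof
    have c0: "coeff P 0 = 1" by (simp add: P_def coeff_jacobi_poly)
    thus "P \<noteq> 0" by auto
    show "poly P 0 \<noteq> 0" using c0 by (simp add: poly_0_coeff_0)
  qed (simp only: P_def jacobi_poly_ode)
  obtain A where A: "size A = degree P" "P = smult (lead_coeff P) (\<Prod>x\<in>#A. [:-x, 1:])"
    using alg_closed_imp_factorization[OF P_nonzero] by blast
  obtain xs where xs: "mset xs = A" using ex_mset by blast
  have len: "length xs = n" using A(1) xs degree_jacobi_poly[of n] by (metis P_def size_mset)
  define x where "x = (\<lambda>i. xs ! i)"
  define c where "c = lead_coeff P"
  have "c \<noteq> 0" using P_nonzero by (simp add: c_def)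
  have "(\<Prod>x\<in>#A. [:-x, 1:]) = (\<Prod>i<n. [:- x i, 1:])"
    unfolding xs[symmetric] x_def len[symmetric]
    by (simp add: prod_mset_prod_list prod.list_conv_set_nth atLeast0LessThan flip: mset_map)
  hence P: "P = smult c (\<Prod>i<n. [:- x i, 1:])" using A(2) by (simp add: c_def)
  define R where "R = (\<lambda>i. smult c (\<Prod>j\<in>{..<n}-{i}. [:- x j, 1:]))"
  have PR: "P = [:- x i, 1:] * R i" if "i < n" for i
    unfolding P R_def using that by (subst prod.remove[of _ i]) auto
  have root: "poly P (x i) = 0" if "i < n" for i unfolding PR[OF that] by simp
  have inj: "inj_on x {..<n}"
  proof (rule inj_onI, rule ccontr)
    fix i j assume ij: "i \<in> {..<n}" "j \<in> {..<n}" "x i = x j" "i \<noteq> j"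
    hence "[:- x j, 1:] dvd R i" unfolding R_def
      by (intro dvd_smult dvd_prodI[of "{..<n}-{i}" j "\<lambda>j. [:- x j, 1:]"]) auto
    hence "[:- x i, 1:] ^ 2 dvd P"
      unfolding PR[OF ij(1)[unfolded lessThan_iff]] ij(3) power2_eq_square by (intro mult_dvd_mono) auto
    thus False by (rule simple_root)
  qed
  have x0: "x i \<noteq> 0" if "i < n" for i using root[OF that] P_0 by metis
  have x1: "x i \<noteq> 1" if "i < n" for i using root[OF that] not_root_1 by metis
  have "(\<Sum>j\<in>{..<n}-{i}. 2 / (x i - x j)) + 2 / 3 / x i + 1 / 2 / (x i - 1) = 0" if i: "i < n" for i
  proof -
    define y where "y = x i"
    have pR: "poly (R i) z = c * (\<Prod>j\<in>{..<n}-{i}. (z - x j))" for z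
      by (simp add: R_def poly_prod algebra_simps)
    have ne: "y - x j \<noteq> 0" if "j \<in> {..<n} - {i}" for j
      using inj that i by (auto simp: y_def inj_on_def)
    have Ry: "poly (R i) y \<noteq> 0" unfolding pR using \<open>c \<noteq> 0\<close> ne by simp
    define s where "s = (\<Sum>j\<in>{..<n}-{i}. 1 / (y - x j))"
    have "((\<lambda>z. \<Prod>j\<in>{..<n}-{i}. (z - x j)) has_field_derivative (\<Prod>j\<in>{..<n}-{i}. (y - x j)) * s) (at y)"
      unfolding s_def by (rule has_field_derivative_prod') (use ne in \<open>auto intro!: derivative_eq_intros\<close>)
    hence "(poly (R i) has_field_derivative poly (R i) y * s) (at y)"
      unfolding pR[abs_def] pR mult.assoc by (rule DERIV_cmult)
    hence R': "poly (pderiv (R i)) y = poly (R i) y * s" using poly_DERIV DERIV_unique by blast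
    define u where "u = [:- y, 1:]"
    have pu: "pderiv u = 1" by (simp add: u_def pderiv_pCons)
    have p1: "pderiv P = R i + u * pderiv (R i)"
      unfolding PR[OF i] y_def[symmetric] u_def[symmetric] pderiv_mult pu by simp
    have p2: "pderiv (pderiv P) = 2 * pderiv (R i) + u * pderiv (pderiv (R i))"
      unfolding p1 pderiv_add pderiv_mult pu by simp
    have "poly (pderiv P) y = poly (R i) y" unfolding p1 by (simp add: u_def)
    moreover have "poly (pderiv (pderiv P)) y = 2 * (poly (R i) y * s)" unfolding p2 by (simp add: R' u_def)
    moreover have "(y * (y - 1)) * poly (pderiv (pderiv P)) y + (7/6 * y - 2/3) * poly (pderiv P) y = 0"
      using arg_cong[OF ode, of "\<lambda>p. poly p y"] root[OF i] by (simp add: y_def algebra_simps)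
    ultimately have "poly (R i) y * (y * (y - 1) * (2 * s) + (7/6 * y - 2/3)) = 0" by (simp add: algebra_simps)
    hence e: "y * (y - 1) * (2 * s) + (7/6 * y - 2/3) = 0" using Ry by simp
    have yn: "y \<noteq> 0" "y - 1 \<noteq> 0" using x0[OF i] x1[OF i] by (auto simp: y_def)
    \<comment> \<open>The first-order coefficient splits as
      \<open>7/6 * y - 2/3 = 2/3 * (y - 1) + 1/2 * y\<close>; dividing by \<open>y * (y - 1)\<close>
      gives the two partial fractions.\<close>
    have "y * (y - 1) * (2 * s + 2/3/y + 1/2/(y - 1)) = y * (y - 1) * (2 * s) + (2/3 * (y - 1) + 1/2 * y)"
    proof -
      have "y * (2/3/y) = 2/3" "(y - 1) * (1/2/(y-1)) = 1/2" using yn by auto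
      thus ?thesis by algebra
    qed
    also have "2/3 * (y - 1) + 1/2 * y = 7/6 * y - 2/3" by (simp add: field_simps)
    also note e
    finally have "2 * s + 2/3/y + 1/2/(y - 1) = 0" using yn by simp
    moreover have "(\<Sum>j\<in>{..<n}-{i}. 2 / (x i - x j)) = 2 * s" by (simp add: s_def sum_distrib_left y_def)
    ultimately show ?thesis by (simp add: y_def)
  qed
  thus ?thesis using that inj x0 x1 by blast
qed

section \<open>Characters and the main theorem\<close>


lemma Im_moebius_pos:
  assumes "a * d - b * c = 1" "Im \<tau> > 0"
  shows "of_int c * \<tau> + of_int d \<noteq> 0" "Im ((of_int a * \<tau> + of_int b) / (of_int c * \<tau> + of_int d)) > 0"
proof -
  show nz: "of_int c * \<tau> + of_int d \<noteq> 0"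
  proof
    assume e: "of_int c * \<tau> + of_int d = 0"
    hence "Im (of_int c * \<tau> + of_int d) = 0" by simp
    hence "c = 0" using assms(2) by simp
    with e have "d = 0" by simp
    with \<open>c = 0\<close> assms(1) show False by simp
  qed
  have "Im ((of_int a * \<tau> + of_int b) / (of_int c * \<tau> + of_int d)) =
    of_int (a * d - b * c) * Im \<tau> / norm (of_int c * \<tau> + of_int d) ^ 2"
    unfolding Im_divide cmod_power2 by (simp add: algebra_simps)
  also have "\<dots> > 0" unfolding assms(1) using assms(2) nz by simp
  finally show "Im ((of_int a * \<tau> + of_int b) / (of_int c * \<tau> + of_int d)) > 0" .
qed

text \<open>The Euclidean algorithm on the first column writes the matrix as a power of the
  translation times the inversion times a matrix with smaller lower left entry. The laws under the
  two generators then compose to some factor \<open>k\<close>.\<close>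

lemma weight2_transformation:
  fixes f :: "complex \<Rightarrow> complex"
  assumes T: "\<And>\<tau>. Im \<tau> > 0 \<Longrightarrow> f (\<tau> + 1) = t * f \<tau>" and t: "t \<noteq> 0"
    and S: "\<And>\<tau>. Im \<tau> > 0 \<Longrightarrow> f (-1 / \<tau>) = s * \<tau> ^ 2 * f \<tau>" and s: "s \<noteq> 0"
    and "a * d - b * c = 1"
  shows "\<exists>k. k \<noteq> 0 \<and> (\<forall>\<tau>. Im \<tau> > 0 \<longrightarrow>
     f ((of_int a * \<tau> + of_int b) / (of_int c * \<tau> + of_int d)) = k * (of_int c * \<tau> + of_int d) ^ 2 * f \<tau>)"
proof -
  have Tn: "f (\<tau> + of_nat n) = t ^ n * f \<tau>" if "Im \<tau> > 0" for \<tau> n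
  proof (induction n)
    case (Suc n)
    have "f (\<tau> + of_nat (Suc n)) = f ((\<tau> + of_nat n) + 1)" by (simp add: algebra_simps)
    also have "\<dots> = t ^ Suc n * f \<tau>" using T[of "\<tau> + of_nat n"] Suc.IH that by simp
    finally show ?case .
  qed auto
  have Tm: "\<exists>k. k \<noteq> 0 \<and> (\<forall>\<tau>. Im \<tau> > 0 \<longrightarrow> f (\<tau> + of_int m) = k * f \<tau>)" for m
  proof (cases "m \<ge> 0")
    case True
    hence "f (\<tau> + of_int m) = t ^ nat m * f \<tau>" if "Im \<tau> > 0" for \<tau> using Tn[OF that, of "nat m"] by simp
    thus ?thesis using t by (intro exI[of _ "t ^ nat m"]) auto
  next
    case False
    have "f (\<tau> + of_int m) = inverse (t ^ nat (- m)) * f \<tau>" if "Im \<tau> > 0" for \<tau>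
    proof -
      have "f \<tau> = t ^ nat (- m) * f (\<tau> + of_int m)"
        using Tn[of "\<tau> + of_int m" "nat (- m)"] that False by simp
      hence "inverse (t ^ nat (- m)) * f \<tau> = inverse (t ^ nat (- m)) * (t ^ nat (- m) * f (\<tau> + of_int m))"
        by (rule arg_cong)
      thus ?thesis using t by simp
    qed
    thus ?thesis using t by (intro exI[of _ "inverse (t ^ nat (- m))"]) auto
  qed
  show ?thesis using assms(5)
  proof (induction "nat \<bar>c\<bar>" arbitrary: a b c d rule: less_induct)
    case less
    show ?case
    proof (cases "c = 0")
      case True
      hence ad: "a * d = 1" using less.prems by simp
      \<comment> \<open>A triangular matrix acts as a translation by \<open>b / d\<close>, which is
        \<open>b * d\<close> since \<open>d\<close> is 1 or -1; the even weight hides the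
        sign.\<close>
      hence "a = 1 \<and> d = 1 \<or> a = -1 \<and> d = -1" using zmult_eq_1_iff by blast
      hence "(of_int a * \<tau> + of_int b) / (of_int c * \<tau> + of_int d) = \<tau> + of_int (b * d)"
        "(of_int c * \<tau> + of_int d) ^ 2 = (1 :: complex)" for \<tau> :: complex
        using True by auto
      thus ?thesis using Tm[of "b * d"] by (simp only: mult_1_right)
    next
      case False
      define m r where "m = a div c" and "r = a mod c"
      define b' where "b' = b - m * d"
      have a: "a = c * m + r" by (simp add: m_def r_def)
      \<comment> \<open>The smaller matrix has rows \<open>(-c, -d)\<close> and
        \<open>(r, b')\<close>; it sends \<open>\<tau>\<close> to the point \<open>\<sigma>\<close>
        with image \<open>-1 / \<sigma> + m\<close> under the original matrix.\<close>
      have det: "- c * b' - (- d) * r = 1" using less.prems by (simp add: b'_def a algebra_simps)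
      have "nat \<bar>r\<bar> < nat \<bar>c\<bar>" using False abs_mod_less[of c a] by (simp add: r_def)
      from less.hyps[OF this det] obtain k where k: "k \<noteq> 0"
        "\<And>\<tau>. Im \<tau> > 0 \<Longrightarrow> f ((of_int (- c) * \<tau> + of_int (- d)) / (of_int r * \<tau> + of_int b')) = k * (of_int r * \<tau> + of_int b') ^ 2 * f \<tau>"
        by blast
      obtain l where l: "l \<noteq> 0" "\<And>\<tau>. Im \<tau> > 0 \<Longrightarrow> f (\<tau> + of_int m) = l * f \<tau>" using Tm by blast
      show ?thesis
      proof (intro exI[of _ "l * s * k"] conjI allI impI)
        fix \<tau> assume \<tau>: "Im \<tau> > 0"
        define x y where "x = of_int r * \<tau> + of_int b'" and "y = of_int c * \<tau> + of_int d"
        define \<sigma> where "\<sigma> = (of_int (- c) * \<tau> + of_int (- d)) / (of_int r * \<tau> + of_int b')"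
        have x: "x \<noteq> 0" and \<sigma>: "Im \<sigma> > 0"
          using Im_moebius_pos[OF det \<tau>] by (simp_all add: x_def \<sigma>_def)
        have y: "y \<noteq> 0" unfolding y_def using Im_moebius_pos(1)[OF less.prems \<tau>] .
        have \<sigma>_eq: "\<sigma> = - y / x" by (simp add: \<sigma>_def x_def y_def)
        have "(of_int a * \<tau> + of_int b) = x + of_int m * y"
          by (simp add: x_def y_def a b'_def algebra_simps)
        hence "(of_int a * \<tau> + of_int b) / y = -1 / \<sigma> + of_int m" using x y by (simp add: \<sigma>_eq field_simps)
        hence "f ((of_int a * \<tau> + of_int b) / y) = l * (s * \<sigma> ^ 2 * f \<sigma>)"
          using l(2)[OF Im_inversion_pos[OF \<sigma>]] S[OF \<sigma>] by simp
        also have "f \<sigma> = k * x ^ 2 * f \<tau>" using k(2)[OF \<tau>] by (simp only: \<sigma>_def x_def)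
        also have "l * (s * \<sigma> ^ 2 * (k * x ^ 2 * f \<tau>)) = l * s * k * y ^ 2 * f \<tau>"
          using x by (simp add: \<sigma>_eq field_simps)
        finally show "f ((of_int a * \<tau> + of_int b) / (of_int c * \<tau> + of_int d)) = l * s * k * (of_int c * \<tau> + of_int d) ^ 2 * f \<tau>"
          by (simp only: y_def)
      qed (use l k s in auto)
    qed
  qed
qed

text \<open>Factors are picked by choice. Evaluating the laws for \<open>g\<close>, \<open>h\<close>
  and their product at \<open>\<tau>0\<close>, and using the cocycle identity for
  \<open>c \<tau> + d\<close>, gives multiplicativity after cancelling the nonzero
  \<open>f \<tau>0\<close>.\<close>

lemma weight2_character_exists:
  fixes f :: "complex \<Rightarrow> complex"
  assumes T: "\<And>\<tau>. Im \<tau> > 0 \<Longrightarrow> f (\<tau> + 1) = t * f \<tau>" and t: "t \<noteq> 0"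
    and S: "\<And>\<tau>. Im \<tau> > 0 \<Longrightarrow> f (-1 / \<tau>) = s * \<tau> ^ 2 * f \<tau>" and s: "s \<noteq> 0"
    and \<tau>0: "Im \<tau>0 > 0" "f \<tau>0 \<noteq> 0"
  shows "\<exists>chi. is_character chi \<and> weight2_with_character chi f"
proof -
  define Q where "Q = (\<lambda>(a, b, c, d) k. k \<noteq> 0 \<and> (\<forall>\<tau>. Im \<tau> > 0 \<longrightarrow>
     f ((of_int a * \<tau> + of_int b) / (of_int c * \<tau> + of_int d)) = k * (of_int c * \<tau> + of_int d) ^ 2 * f \<tau>))"
  define chi where "chi = (\<lambda>g. SOME k. Q g k)"
  have chi: "Q g (chi g)" if "g \<in> SL2Z" for g
  proof -
    obtain a b c d where g: "g = (a, b, c, d)" by (cases g)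
    have "a * d - b * c = 1" using that by (simp add: g SL2Z_def)
    from weight2_transformation[OF T t S s this] have "\<exists>k. Q g k" by (simp add: Q_def g)
    thus ?thesis unfolding chi_def by (rule someI_ex)
  qed
  have "weight2_with_character chi f"
    unfolding weight2_with_character_def
  proof safe
    fix a b c d \<tau> assume "(a, b, c, d) \<in> SL2Z" "\<tau> \<in> upper_half_plane"
    thus "f ((of_int a * \<tau> + of_int b) / (of_int c * \<tau> + of_int d)) = chi (a, b, c, d) * (of_int c * \<tau> + of_int d) ^ 2 * f \<tau>"
      using chi[of "(a, b, c, d)"] by (simp add: Q_def upper_half_plane_simps)
  qed
  moreover have "is_character chi"
    unfolding is_character_def
  proof (intro conjI ballI)
    show "chi g \<noteq> 0" if "g \<in> SL2Z" for g using chi[OF that] by (auto simp: Q_def)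
    fix g h assume gh: "g \<in> SL2Z" "h \<in> SL2Z"
    obtain a b c d where g: "g = (a, b, c, d)" by (cases g)
    obtain a' b' c' d' where h: "h = (a', b', c', d')" by (cases h)
    have dg: "a * d - b * c = 1" and dh: "a' * d' - b' * c' = 1" using gh by (simp_all add: g h SL2Z_def)
    have "(a * a' + b * c') * (c * b' + d * d') - (a * b' + b * d') * (c * a' + d * c') = (a * d - b * c) * (a' * d' - b' * c')"
      by (simp add: algebra_simps)
    hence dm: "(a * a' + b * c') * (c * b' + d * d') - (a * b' + b * d') * (c * a' + d * c') = 1" by (simp add: dg dh)
    hence m: "sl2_mult g h \<in> SL2Z" by (simp add: g h SL2Z_def)
    define \<sigma> where "\<sigma> = (of_int a' * \<tau>0 + of_int b') / (of_int c' * \<tau>0 + of_int d')"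
    define j where "j = of_int c' * \<tau>0 + of_int d'"
    have j: "j \<noteq> 0" and \<sigma>: "Im \<sigma> > 0" using Im_moebius_pos[OF dh \<tau>0(1)] by (simp_all add: j_def \<sigma>_def)
    define j' where "j' = of_int c * \<sigma> + of_int d"
    have j': "j' \<noteq> 0" using Im_moebius_pos(1)[OF dg \<sigma>] by (simp add: j'_def)
    have \<sigma>_j: "\<sigma> * j = of_int a' * \<tau>0 + of_int b'" using j by (simp add: \<sigma>_def j_def)
    \<comment> \<open>The cocycle identity: the automorphy factor of the product at
      \<open>\<tau>0\<close> is that of \<open>g\<close> at the image \<open>\<sigma>\<close> times
      that of \<open>h\<close> at \<open>\<tau>0\<close>.\<close>
    have jj: "of_int (c * a' + d * c') * \<tau>0 + of_int (c * b' + d * d') = j' * j"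
    proof -
      have "j' * j = of_int c * (\<sigma> * j) + of_int d * j" by (simp add: j'_def algebra_simps)
      thus ?thesis unfolding \<sigma>_j by (simp add: j_def algebra_simps)
    qed
    have nn: "of_int (a * a' + b * c') * \<tau>0 + of_int (a * b' + b * d') = (of_int a * \<sigma> + of_int b) * j"
    proof -
      have "(of_int a * \<sigma> + of_int b) * j = of_int a * (\<sigma> * j) + of_int b * j" by (simp add: algebra_simps)
      thus ?thesis unfolding \<sigma>_j by (simp add: j_def algebra_simps)
    qed
    have 1: "f \<sigma> = chi h * j ^ 2 * f \<tau>0" using chi[OF gh(2)] \<tau>0(1) by (simp add: Q_def h \<sigma>_def j_def)
    have 2: "f ((of_int a * \<sigma> + of_int b) / j') = chi g * j' ^ 2 * f \<sigma>" using chi[OF gh(1)] \<sigma> by (simp add: Q_def g j'_def)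
    have "f ((of_int (a * a' + b * c') * \<tau>0 + of_int (a * b' + b * d')) / (of_int (c * a' + d * c') * \<tau>0 + of_int (c * b' + d * d')))
       = chi (sl2_mult g h) * (of_int (c * a' + d * c') * \<tau>0 + of_int (c * b' + d * d')) ^ 2 * f \<tau>0"
      using chi[OF m] \<tau>0(1) unfolding Q_def g h sl2_mult.simps prod.case by blast
    hence "f ((of_int a * \<sigma> + of_int b) / j') = chi (sl2_mult g h) * (j' * j) ^ 2 * f \<tau>0"
      unfolding jj nn using j by simp
    with 1 2 have "chi (sl2_mult g h) * (j' * j) ^ 2 * f \<tau>0 = chi g * j' ^ 2 * (chi h * j ^ 2 * f \<tau>0)" by simp
    hence "(chi (sl2_mult g h) - chi g * chi h) * ((j' * j) ^ 2 * f \<tau>0) = 0" by (simp add: algebra_simps power_mult_distrib)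
    thus "chi (sl2_mult g h) = chi g * chi h" using j j' \<tau>0(2) by simp
  qed
  ultimately show ?thesis by blast
qed

section \<open>Bounds at the cusp and construction of the poles\<close>

lemma modular_J_dist_at_cusp: "eventually (\<lambda>\<tau>. norm (modular_J \<tau> - x) \<ge> 1) cusp"
proof -
  have "eventually (\<lambda>\<tau>. norm (modular_J \<tau>) \<ge> norm x + 1) cusp"
    using modular_J_at_cusp unfolding filterlim_at_infinity[OF order.refl]
    by (elim allE[of _ "norm x + 1"]) (simp add: add_nonneg_pos)
  thus ?thesis
  proof eventually_elim
    case (elim \<tau>)
    thus ?case using norm_triangle_ineq2[of "modular_J \<tau>" x] by linarith
  qed
qed

lemma dedekind_eta_bounded_at_cusp: "eventually (\<lambda>\<tau>. norm (dedekind_eta \<tau>) \<le> 2) cusp"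
proof -
  have "eventually (\<lambda>\<tau>. norm (euler_phi_prod (qpar \<tau>)) < 2) cusp"
    by (rule order_tendstoD(2)[OF tendsto_norm[OF euler_phi_prod_tendsto]]) simp
  with eventually_cusp_Im_pos show ?thesis
  proof eventually_elim
    case (elim \<tau>)
    have "norm (exp (2 * pi * \<i> * \<tau> / 24)) \<le> 1" using elim by simp
    hence "norm (dedekind_eta \<tau>) \<le> 1 * 2"
      unfolding dedekind_eta_eq norm_mult using elim by (intro mult_mono) auto
    thus ?case by simp
  qed
qed

theorem theorem7p2:
  fixes n :: nat
  assumes "n > 0"
  shows "\<exists>w :: nat \<Rightarrow> complex.
    (\<forall>i<n. w i \<in> upper_half_plane) \<and>
    (let f = (\<lambda>\<tau>. dedekind_eta \<tau> ^ 4 /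
                    (\<Prod>i<n. (modular_J \<tau> - modular_J (w i)) ^ 2));
         P = {\<tau>\<in>upper_half_plane. \<exists>i<n. modular_J \<tau> = modular_J (w i)}
     in f meromorphic_on upper_half_plane \<and>
        (\<exists>chi. is_character chi \<and> weight2_with_character chi f) \<and>
        (\<forall>\<tau>\<in>upper_half_plane - P. f \<tau> \<noteq> 0) \<and>
        (\<forall>i<n. is_pole f (w i) \<and> zorder f (w i) = -2 \<and> residue f (w i) = 0) \<and>
        f analytic_on (upper_half_plane - P) \<and>
        (\<exists>C M. \<forall>\<tau>. Im \<tau> > M \<longrightarrow> norm (f \<tau>) \<le> C))"
proof -
  obtain x :: "nat \<Rightarrow> complex" where inj: "inj_on x {..<n}"
    and x0: "\<And>i. i < n \<Longrightarrow> x i \<noteq> 0" and x1: "\<And>i. i < n \<Longrightarrow> x i \<noteq> 1"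
    and st: "\<And>i. i < n \<Longrightarrow> (\<Sum>j\<in>{..<n}-{i}. 2 / (x i - x j)) + 2 / 3 / x i + 1 / 2 / (x i - 1) = 0"
    using stieltjes_system_solvable by blast
  have "\<forall>i. \<exists>\<tau>. Im \<tau> > 0 \<and> modular_J \<tau> = x i" using modular_J_surj by blast
  then obtain w where w: "\<And>i. Im (w i) > 0" "\<And>i. modular_J (w i) = x i" by metis
  define f where "f = (\<lambda>\<tau>. dedekind_eta \<tau> ^ 4 / (\<Prod>i<n. (modular_J \<tau> - x i) ^ 2))"
  define P where "P = {\<tau>\<in>upper_half_plane. \<exists>i<n. modular_J \<tau> = x i}"
  have an: "dedekind_eta analytic_on upper_half_plane" "modular_J analytic_on upper_half_plane"
    using dedekind_eta_holomorphic modular_J_holomorphic by (simp_all add: analytic_on_open upper_half_plane_simps)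
  have mero: "f meromorphic_on upper_half_plane"
    unfolding f_def by (intro meromorphic_intros analytic_on_imp_meromorphic_on an)
  have ana: "f analytic_on (upper_half_plane - P)"
    unfolding f_def using analytic_on_subset[OF an(1)] analytic_on_subset[OF an(2)]
    by (intro analytic_intros) (auto simp: P_def)
  have nz: "f \<tau> \<noteq> 0" if "\<tau> \<in> upper_half_plane - P" for \<tau>
    using that by (auto simp: f_def P_def dedekind_eta_nonzero upper_half_plane_simps)
  have char: "\<exists>chi. is_character chi \<and> weight2_with_character chi f"
  proof -
    \<comment> \<open>All \<open>x i\<close> differ from 0, so a zero of \<open>J\<close> lies
      outside \<open>P\<close>, where \<open>f\<close> does not vanish.\<close>
    obtain \<tau>0 where \<tau>0: "Im \<tau>0 > 0" "modular_J \<tau>0 = 0" using modular_J_surj by blast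
    show ?thesis
    proof (rule weight2_character_exists[where t = "exp (2 * pi * \<i> / 24) ^ 4" and s = "-1"])
      show "f (\<tau> + 1) = exp (2 * pi * \<i> / 24) ^ 4 * f \<tau>" for \<tau>
        by (simp add: f_def dedekind_eta_add_1 modular_J_add_1 power_mult_distrib)
      show "f (-1 / \<tau>) = -1 * \<tau> ^ 2 * f \<tau>" if "Im \<tau> > 0" for \<tau>
        unfolding f_def dedekind_eta_pow4_inversion[OF that] modular_J_inversion[OF that] by simp
      show "f \<tau>0 \<noteq> 0" using \<tau>0 x0 by (intro nz) (auto simp: P_def upper_half_plane_simps)
    qed (use \<tau>0 in auto)
  qed
  have pole: "is_pole f (w i) \<and> zorder f (w i) = -2 \<and> residue f (w i) = 0" if i: "i < n" for i
  proof -
    define W where "W = w i"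
    define J' where "J' = deriv modular_J W"
    have W: "Im W > 0" "W \<in> upper_half_plane" "modular_J W = x i" using w by (auto simp: W_def upper_half_plane_simps)
    have J'0: "J' \<noteq> 0" and J'': "deriv (deriv modular_J) W / J' =
      4 * (deriv dedekind_eta W / dedekind_eta W) + J' * (2 / 3 / x i + 1 / 2 / (x i - 1))"
      using modular_J_second_log_derivative[OF W(1)] x0[OF i] x1[OF i] unfolding W(3) J'_def by auto
    \<comment> \<open>\<open>R\<close> collects the factors other than the i-th one, so that
      \<open>f = g / h ^ 2\<close> with \<open>h = J - x i\<close> having a simple zero at
      \<open>W\<close>; \<open>S\<close> leaves out the zeros of \<open>R\<close>.\<close>
    define R where "R = (\<lambda>\<tau>. \<Prod>j\<in>{..<n}-{i}. (modular_J \<tau> - x j))"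
    define g where "g = (\<lambda>\<tau>. dedekind_eta \<tau> ^ 4 / R \<tau> ^ 2)"
    define S where "S = upper_half_plane \<inter> R -` (- {0})"
    have Rh: "R holomorphic_on upper_half_plane" unfolding R_def by (intro holomorphic_intros modular_J_holomorphic)
    have ne: "modular_J W - x j \<noteq> 0" if "j \<in> {..<n} - {i}" for j
      using inj that i by (auto simp: W(3) inj_on_def)
    have RW: "R W \<noteq> 0" using ne by (simp add: R_def)
    have "open S" unfolding S_def
      by (intro continuous_open_preimage holomorphic_on_imp_continuous_on Rh upper_half_plane_simps) auto
    have dJ: "(modular_J has_field_derivative J') (at W)"
      unfolding J'_def by (rule holomorphic_derivI[OF modular_J_holomorphic upper_half_plane_simps(2) W(2)])
    have deta: "(dedekind_eta has_field_derivative deriv dedekind_eta W) (at W)"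
      by (rule holomorphic_derivI[OF dedekind_eta_holomorphic upper_half_plane_simps(2) W(2)])
    have dR: "(R has_field_derivative R W * (\<Sum>j\<in>{..<n}-{i}. J' / (modular_J W - x j))) (at W)"
      unfolding R_def by (rule has_field_derivative_prod') (use ne in \<open>auto intro!: derivative_eq_intros dJ\<close>)
    have eta0: "dedekind_eta W \<noteq> 0" using dedekind_eta_nonzero W(1) .
    define \<Sigma> where "\<Sigma> = (\<Sum>j\<in>{..<n}-{i}. 1 / (x i - x j))"
    have dR': "(R has_field_derivative R W * (J' * \<Sigma>)) (at W)"
      using dR by (simp add: \<Sigma>_def W(3) sum_distrib_left)
    have e4: "((\<lambda>\<tau>. dedekind_eta \<tau> ^ 4) has_field_derivative 4 * dedekind_eta W ^ 3 * deriv dedekind_eta W) (at W)"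
      using DERIV_power[OF deta, of 4] by (simp add: mult_ac)
    have R2: "((\<lambda>\<tau>. R \<tau> ^ 2) has_field_derivative 2 * R W * (R W * (J' * \<Sigma>))) (at W)"
      using DERIV_power[OF dR', of 2] by (simp add: mult_ac)
    have "(g has_field_derivative (4 * dedekind_eta W ^ 3 * deriv dedekind_eta W * R W ^ 2 - dedekind_eta W ^ 4 * (2 * R W * (R W * (J' * \<Sigma>)))) / (R W ^ 2 * R W ^ 2)) (at W)"
      unfolding g_def by (rule DERIV_divide[OF e4 R2]) (use RW in simp)
    hence "deriv g W / g W = (4 * dedekind_eta W ^ 3 * deriv dedekind_eta W * R W ^ 2 - dedekind_eta W ^ 4 * (2 * R W * (R W * (J' * \<Sigma>)))) / (R W ^ 2 * R W ^ 2) / g W"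
      by (simp add: DERIV_imp_deriv)
    also have "\<dots> = 4 * (deriv dedekind_eta W / dedekind_eta W) - 2 * (J' * \<Sigma>)"
      unfolding g_def using RW eta0 by (simp add: field_simps eval_nat_numeral)
    also have "\<dots> = deriv (deriv modular_J) W / J'"
    proof -
      have "(\<Sum>j\<in>{..<n}-{i}. 2 / (x i - x j)) = 2 * \<Sigma>" by (simp add: \<Sigma>_def sum_distrib_left)
      \<comment> \<open>The i-th Stieltjes equation turns the contribution
        \<open>- 2 * J' * \<Sigma>\<close> of the other factors into the rational terms in the
        formula for \<open>J'' / J'\<close>.\<close>
      hence "2 * \<Sigma> + (2 / 3 / x i + 1 / 2 / (x i - 1)) = 0" using st[OF i] by (simp add: add.assoc)
      hence "2 / 3 / x i + 1 / 2 / (x i - 1) = - (2 * \<Sigma>)" by (rule minus_unique[symmetric])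
      thus ?thesis unfolding J'' by simp
    qed
    finally have log: "deriv g W / g W = deriv (deriv modular_J) W / J'" .
    define h where "h = (\<lambda>\<tau>. modular_J \<tau> - x i)"
    have dh: "deriv h \<tau> = deriv modular_J \<tau>" if "Im \<tau> > 0" for \<tau>
    proof -
      have "(modular_J has_field_derivative deriv modular_J \<tau>) (at \<tau>)"
        using that by (intro holomorphic_derivI[OF modular_J_holomorphic upper_half_plane_simps(2)]) (simp add: upper_half_plane_simps)
      hence "(h has_field_derivative deriv modular_J \<tau> - 0) (at \<tau>)" unfolding h_def by (intro DERIV_diff DERIV_const)
      thus ?thesis by (simp add: DERIV_imp_deriv)
    qed
    have "eventually (\<lambda>\<tau>. deriv h \<tau> = deriv modular_J \<tau>) (nhds W)"
      using eventually_nhds_in_open[OF upper_half_plane_simps(2) W(2)] dh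
      by (auto simp: upper_half_plane_simps elim!: eventually_mono)
    hence ddh: "deriv (deriv h) W = deriv (deriv modular_J) W" by (rule deriv_cong_ev) simp
    have "R holomorphic_on S" "dedekind_eta holomorphic_on S" "h holomorphic_on S"
      unfolding h_def S_def
      by (intro holomorphic_intros holomorphic_on_subset[OF Rh] holomorphic_on_subset[OF dedekind_eta_holomorphic]
          holomorphic_on_subset[OF modular_J_holomorphic]; blast)+
    hence hol: "g holomorphic_on S" "h holomorphic_on S"
      unfolding g_def by (auto intro!: holomorphic_intros simp: S_def)
    have fgh: "f \<tau> = g \<tau> / h \<tau> ^ 2" for \<tau>
    proof -
      have "(\<Prod>j<n. (modular_J \<tau> - x j) ^ 2) = h \<tau> ^ 2 * R \<tau> ^ 2"
        unfolding h_def R_def prod_power_distrib[symmetric] using i by (subst prod.remove[of _ i]) (auto simp: power_mult_distrib)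
      thus ?thesis by (simp add: f_def g_def mult.commute)
    qed
    have "W \<in> S" "h W = 0" "deriv h W \<noteq> 0" "g W \<noteq> 0"
      using W RW J'0 dh[OF W(1)] eta0 by (auto simp: S_def h_def J'_def g_def)
    moreover have "deriv g W / g W = deriv (deriv h) W / deriv h W"
      using log by (simp add: ddh dh[OF W(1)] J'_def)
    ultimately show ?thesis
      using double_pole_zero_residue[of S W g h f] \<open>open S\<close> hol fgh unfolding W_def by blast
  qed
  have bounded: "\<exists>C M. \<forall>\<tau>. Im \<tau> > M \<longrightarrow> norm (f \<tau>) \<le> C"
  proof -
    have "eventually (\<lambda>\<tau>. \<forall>i\<in>{..<n}. norm (modular_J \<tau> - x i) \<ge> 1) cusp"
      by (intro eventually_ball_finite ballI modular_J_dist_at_cusp) auto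
    \<comment> \<open>High up, the numerator is at most \<open>2 ^ 4\<close> in norm and each factor
      of the denominator is at least 1.\<close>
    with dedekind_eta_bounded_at_cusp have "eventually (\<lambda>\<tau>. norm (f \<tau>) \<le> 16) cusp"
    proof eventually_elim
      case (elim \<tau>)
      have "norm (dedekind_eta \<tau>) ^ 4 \<le> 2 ^ 4" using elim by (intro power_mono) auto
      moreover have "(\<Prod>i<n. norm (modular_J \<tau> - x i) ^ 2) \<ge> 1"
        using elim by (intro prod_ge_1 one_le_power) auto
      ultimately have "norm (dedekind_eta \<tau>) ^ 4 / (\<Prod>i<n. norm (modular_J \<tau> - x i) ^ 2) \<le> 16 / 1"
        by (intro frac_le) auto
      thus ?case by (simp add: f_def norm_divide norm_power prod_norm[symmetric])
    qed
    thus ?thesis by (auto simp: eventually_cusp)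
  qed
  show ?thesis
    unfolding Let_def
    by (rule exI[of _ w]) (use mero char nz pole ana bounded w in \<open>simp add: f_def P_def upper_half_plane_simps\<close>)
qed

end
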